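(* Let $J\in\{I,J_1,J_+\}$, let $X$ be a closure space and let $\{A,B\}$ be an interior cover of $X$. Then there are long exact sequences $$\cdots\to H^J_n(A\cap B)\to H^J_n(A)\oplus H^J_n(B)\to H^J_n(X)\to H^J_{n-1}(A\cap B)\to\cdots$$ $$\cdots\to H^{(J,\times)}_n(A\cap B)\to H^{(J,\times)}_n(A)\oplus H^{(J,\times)}_n(B)\to H^{(J,\times)}_n(X)\to H^{(J,\times)}_{n-1}(A\cap B)\to\cdots$$
   Context: A closure space $(X,c)$ is a set $X$ with a map $c:\mathcal P(X)\to\mathcal P(X)$ such that $c(\emptyset)=\emptyset$, $A\subseteq c(A)$, and $c(A\cup B)=c(A)\cup c(B)$. A subset $A\subseteq X$ carries the subspace closure $B\mapsto c(B)\cap A$. The interior is $i(A)=X\setminus c(X\setminus A)$, and $V$ is a neighborhood of $x$ if $x\in i(V)$. An interior cover of $X$ is a family $\mathcal U$ of subsets with $X=\bigcup_{U\in\mathcal U}i(U)$. A map $f:(X,c)\to(Y,d)$ is continuous if $f(c(A))\subseteq d(f(A))$ for all $A\subseteq X$. Topological spaces are closure spaces via the topological closure. The product $X\times Y$ is the set product with the closure for which the sets $U\times V$ ($U$ a neighborhood of $x$, $V$ of $y$) form a neighborhood base at $(x,y)$. Spaces: $I=[0,1]$ with the usual topology; $J_1=\{0,1\}$ with the indiscrete closure; $J_+=\{0,1\}$ with $c(\{0\})=\{0,1\}$, $c(\{1\})=\{1\}$. Singular simplices: $|\Delta^n|^{I}$ is the standard topological $n$-simplex; $|\Delta^n|^{J_1}$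 is $\{0,\dots,n\}$ with the indiscrete closure; $|\Delta^n|^{J_+}$ is $\{0,\dots,n\}$ with $c(\{i\})=\{j: j\ge i\}$. $C^J_n(X)$ is the free abelian group on continuous maps $\sigma:|\Delta^n|^J\to X$, with $\partial\sigma=\sum_{i=0}^n(-1)^i\sigma\circ d^i$, $d^i$ the $i$-th face inclusion; $H^J_n(X)$ is its homology. Singular cubes: $J^{\times n}$ is the $n$-fold product (a point if $n=0$). Let $Q_n(X)$ be the free abelian group on continuous maps $\sigma:J^{\times n}\to X$ and $D_n(X)$ the subgroup generated by the degenerate $\sigma$, i.e. those that do not depend on their $i$-th coordinate for some $1\le i\le n$. Then $C^{(J,\times)}_n(X)=Q_n(X)/D_n(X)$, with $\partial\sigma=\sum_{i=1}^n(-1)^i(A_i\sigma-B_i\sigma)$, where $A_i\sigma$ (resp. $B_i\sigma$) is $\sigma$ with $0$ (resp. $1$) inserted in the $i$-th coordinate; $H^{(J,\times)}_n(X)$ is its homology. In both sequences the first two displayed maps are induced by the chain maps $x\mapsto(x,-x)$ and $(x,y)\mapsto x+y$ (with inclusions understood). *)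

theory Defs
  imports "HOL-Homology.Homology"
begin

section \<open>Closure spaces\<close>

text \<open>The value of \<open>cl\<close> is only meaningful on subsets of \<open>points\<close>.\<close>

record 'a cspace =
  points :: "'a set"
  cl :: "'a set \<Rightarrow> 'a set"

definition closure_space :: "'a cspace \<Rightarrow> bool" where
  "closure_space X \<longleftrightarrow>
     cl X {} = {} \<and>
     (\<forall>A. A \<subseteq> points X \<longrightarrow> A \<subseteq> cl X A \<and> cl X A \<subseteq> points X) \<and>
     (\<forall>A B. A \<subseteq> points X \<longrightarrow> B \<subseteq> points X \<longrightarrow> cl X (A \<union> B) = cl X A \<union> cl X B)"

definition csubspace :: "'a cspace \<Rightarrow> 'a set \<Rightarrow> 'a cspace" where
  "csubspace X A = \<lparr>points = A, cl = (\<lambda>B. cl X B \<inter> A)\<rparr>"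

definition cinterior :: "'a cspace \<Rightarrow> 'a set \<Rightarrow> 'a set" where
  "cinterior X A = points X - cl X (points X - A)"

definition nhood :: "'a cspace \<Rightarrow> 'a \<Rightarrow> 'a set \<Rightarrow> bool" where
  "nhood X x V \<longleftrightarrow> V \<subseteq> points X \<and> x \<in> cinterior X V"

definition interior_cover :: "'a cspace \<Rightarrow> 'a set set \<Rightarrow> bool" where
  "interior_cover X \<U> \<longleftrightarrow>
     (\<forall>U\<in>\<U>. U \<subseteq> points X) \<and> points X = (\<Union>U\<in>\<U>. cinterior X U)"

definition ccontinuous :: "'a cspace \<Rightarrow> 'b cspace \<Rightarrow> ('a \<Rightarrow> 'b) \<Rightarrow> bool" where
  "ccontinuous X Y f \<longleftrightarrow>
     f \<in> points X \<rightarrow> points Y \<and> (\<forall>A. A \<subseteq> points X \<longrightarrow> f ` cl X A \<subseteq> cl Y (f ` A))"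

definition cspace_of :: "'a topology \<Rightarrow> 'a cspace" where
  "cspace_of T = \<lparr>points = topspace T, cl = (\<lambda>A. T closure_of A)\<rparr>"

definition indiscrete :: "'a set \<Rightarrow> 'a cspace" where
  "indiscrete S = \<lparr>points = S, cl = (\<lambda>A. if A = {} then {} else S)\<rparr>"

text \<open>The \<open>n\<close>-fold product, with coordinates indexed by \<open>{1..n}\<close>: a point lies in the closure
  of \<open>A\<close> iff every product of coordinate neighborhoods meets \<open>A\<close>. That these products form a
  neighborhood base is \<open>nhood_cpower_iff\<close> below.\<close>

definition cpower :: "'j cspace \<Rightarrow> nat \<Rightarrow> (nat \<Rightarrow> 'j) cspace" where
  "cpower J n =
     \<lparr>points = {1..n} \<rightarrow>\<^sub>E points J,
      cl = (\<lambda>A. {x \<in> {1..n} \<rightarrow>\<^sub>E points J.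
                  \<forall>U. (\<forall>i\<in>{1..n}. nhood J (x i) (U i)) \<longrightarrow> (\<Pi>\<^sub>E i\<in>{1..n}. U i) \<inter> A \<noteq> {}})\<rparr>"


section \<open>Intervals and simplices\<close>

text \<open>All three intervals have endpoints the real numbers 0 and 1.\<close>

definition J_I :: "real cspace" where
  "J_I = cspace_of (top_of_set {0..1})"

definition J_one :: "real cspace" where
  "J_one = indiscrete {0, 1}"

definition J_plus :: "real cspace" where
  "J_plus = \<lparr>points = {0, 1}, cl = (\<lambda>A. if 0 \<in> A then {0, 1} else A)\<rparr>"

definition simplex_I :: "nat \<Rightarrow> (nat \<Rightarrow> real) cspace" where
  "simplex_I n = cspace_of (subtopology (powertop_real UNIV) (standard_simplex n))"

definition simplex_one :: "nat \<Rightarrow> nat cspace" where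
  "simplex_one n = indiscrete {..n}"

text \<open>The closure of a set is the union of the closures of its points.\<close>

definition simplex_plus :: "nat \<Rightarrow> nat cspace" where
  "simplex_plus n = \<lparr>points = {..n}, cl = (\<lambda>A. {j \<in> {..n}. \<exists>i\<in>A. i \<le> j})\<rparr>"

text \<open>The \<open>i\<close>-th face inclusion on vertices; for \<open>simplex_I\<close> it is the library's
  \<open>simplical_face\<close>.\<close>

definition vertex_face :: "nat \<Rightarrow> nat \<Rightarrow> nat" where
  "vertex_face i j = (if j < i then j else Suc j)"


section \<open>Chain complexes and homology\<close>

text \<open>The map \<open>G Mod M \<rightarrow> H Mod N\<close> of quotients induced by a map \<open>f\<close> from \<open>G\<close> to \<open>H\<close>;
  \<open>K\<close> is a coset of \<open>M\<close>.\<close>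

definition coset_map :: "('b, 'm) monoid_scheme \<Rightarrow> 'b set \<Rightarrow> ('a \<Rightarrow> 'b) \<Rightarrow> 'a set \<Rightarrow> 'b set" where
  "coset_map H N f K = the_elem ((\<lambda>x. N #>\<^bsub>H\<^esub> f x) ` K)"

record 'c chain_cplx =
  chains :: "int \<Rightarrow> 'c monoid"
  bdry :: "int \<Rightarrow> 'c \<Rightarrow> 'c"

definition boundaries :: "'c chain_cplx \<Rightarrow> int \<Rightarrow> 'c set" where
  "boundaries C n = bdry C (n + 1) ` carrier (chains C (n + 1))"

definition homology :: "'c chain_cplx \<Rightarrow> int \<Rightarrow> 'c set monoid" where
  "homology C n =
     (chains C n)\<lparr>carrier := kernel (chains C n) (chains C (n - 1)) (bdry C n)\<rparr>
       Mod boundaries C n"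

text \<open>The map \<open>H\<^sub>n(C) \<rightarrow> H\<^sub>n(C')\<close> induced by a chain map \<open>f\<close>.\<close>

definition homology_map :: "'d chain_cplx \<Rightarrow> int \<Rightarrow> ('c \<Rightarrow> 'd) \<Rightarrow> 'c set \<Rightarrow> 'd set" where
  "homology_map C' n f = coset_map (chains C' n) (boundaries C' n) f"


section \<open>Singular simplices\<close>

text \<open>Here \<open>D n\<close> is the model \<open>n\<close>-simplex and \<open>d i\<close> its \<open>i\<close>-th face inclusion. Singular
  simplices and cubes are extensional functions, so that they are determined by their values on
  the model. Degrees are integers; in negative degrees there are no simplices or cubes, and the
  chain groups are trivial.\<close>

definition singular_simplices ::
  "(nat \<Rightarrow> 'p cspace) \<Rightarrow> 'a cspace \<Rightarrow> int \<Rightarrow> ('p \<Rightarrow> 'a) set" where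
  "singular_simplices D X n =
     (if n < 0 then {}
      else {\<sigma> \<in> extensional (points (D (nat n))). ccontinuous (D (nat n)) X \<sigma>})"

definition simplex_bdry ::
  "(nat \<Rightarrow> 'p cspace) \<Rightarrow> (nat \<Rightarrow> 'p \<Rightarrow> 'p) \<Rightarrow> int \<Rightarrow> ('p \<Rightarrow> 'a) \<Rightarrow> ('p \<Rightarrow> 'a) \<Rightarrow>\<^sub>0 int" where
  "simplex_bdry D d n \<sigma> =
     (if n \<le> 0 then 0
      else \<Sum>i\<le>nat n. frag_cmul ((-1) ^ i) (frag_of (restrict (\<sigma> \<circ> d i) (points (D (nat n - 1))))))"

definition simplicial_cplx ::
  "(nat \<Rightarrow> 'p cspace) \<Rightarrow> (nat \<Rightarrow> 'p \<Rightarrow> 'p) \<Rightarrow> 'a cspace \<Rightarrow> (('p \<Rightarrow> 'a) \<Rightarrow>\<^sub>0 int) chain_cplx" where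
  "simplicial_cplx D d X =
     \<lparr>chains = (\<lambda>n. free_Abelian_group (singular_simplices D X n)),
      bdry = (\<lambda>n. frag_extend (simplex_bdry D d n))\<rparr>"

text \<open>Inclusion of the chains of a subspace into those of \<open>X\<close>. A singular simplex of a subspace
  is, as a function, a singular simplex of \<open>X\<close>.\<close>

definition simplicial_incl ::
  "'a cspace \<Rightarrow> int \<Rightarrow> (('p \<Rightarrow> 'a) \<Rightarrow>\<^sub>0 int) \<Rightarrow> (('p \<Rightarrow> 'a) \<Rightarrow>\<^sub>0 int)" where
  "simplicial_incl X n c = c"


section \<open>Singular cubes\<close>

definition singular_cubes :: "'j cspace \<Rightarrow> 'a cspace \<Rightarrow> int \<Rightarrow> ((nat \<Rightarrow> 'j) \<Rightarrow> 'a) set" where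
  "singular_cubes J X n =
     (if n < 0 then {}
      else {\<sigma> \<in> extensional (points (cpower J (nat n))). ccontinuous (cpower J (nat n)) X \<sigma>})"

definition degenerate_cubes :: "'j cspace \<Rightarrow> 'a cspace \<Rightarrow> int \<Rightarrow> ((nat \<Rightarrow> 'j) \<Rightarrow> 'a) set" where
  "degenerate_cubes J X n =
     {\<sigma> \<in> singular_cubes J X n.
        \<exists>i\<in>{1..nat n}. \<forall>x \<in> points (cpower J (nat n)). \<forall>y \<in> points (cpower J (nat n)).
          (\<forall>k. k \<noteq> i \<longrightarrow> x k = y k) \<longrightarrow> \<sigma> x = \<sigma> y}"

definition insert_coord :: "nat \<Rightarrow> 'j \<Rightarrow> (nat \<Rightarrow> 'j) \<Rightarrow> nat \<Rightarrow> 'j" where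
  "insert_coord i t x = (\<lambda>k. if k < i then x k else if k = i then t else x (k - 1))"

definition cube_face ::
  "'j cspace \<Rightarrow> int \<Rightarrow> nat \<Rightarrow> 'j \<Rightarrow> ((nat \<Rightarrow> 'j) \<Rightarrow> 'a) \<Rightarrow> (nat \<Rightarrow> 'j) \<Rightarrow> 'a" where
  "cube_face J n i t \<sigma> = restrict (\<sigma> \<circ> insert_coord i t) (points (cpower J (nat n - 1)))"

definition cube_bdry ::
  "real cspace \<Rightarrow> int \<Rightarrow> ((nat \<Rightarrow> real) \<Rightarrow> 'a) \<Rightarrow> ((nat \<Rightarrow> real) \<Rightarrow> 'a) \<Rightarrow>\<^sub>0 int" where
  "cube_bdry J n \<sigma> =
     (\<Sum>i\<in>{1..nat n}. frag_cmul ((-1) ^ i)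
        (frag_of (cube_face J n i 0 \<sigma>) - frag_of (cube_face J n i 1 \<sigma>)))"

definition cube_Q ::
  "'j cspace \<Rightarrow> 'a cspace \<Rightarrow> int \<Rightarrow> (((nat \<Rightarrow> 'j) \<Rightarrow> 'a) \<Rightarrow>\<^sub>0 int) monoid" where
  "cube_Q J X n = free_Abelian_group (singular_cubes J X n)"

definition cube_D ::
  "'j cspace \<Rightarrow> 'a cspace \<Rightarrow> int \<Rightarrow> (((nat \<Rightarrow> 'j) \<Rightarrow> 'a) \<Rightarrow>\<^sub>0 int) set" where
  "cube_D J X n = generate (cube_Q J X n) (frag_of ` degenerate_cubes J X n)"

definition cubical_cplx ::
  "real cspace \<Rightarrow> 'a cspace \<Rightarrow> (((nat \<Rightarrow> real) \<Rightarrow> 'a) \<Rightarrow>\<^sub>0 int) set chain_cplx" where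
  "cubical_cplx J X =
     \<lparr>chains = (\<lambda>n. cube_Q J X n Mod cube_D J X n),
      bdry = (\<lambda>n. coset_map (cube_Q J X (n - 1)) (cube_D J X (n - 1))
                    (frag_extend (cube_bdry J n)))\<rparr>"

text \<open>The map \<open>Q\<^sub>n(A) Mod D\<^sub>n(A) \<rightarrow> Q\<^sub>n(X) Mod D\<^sub>n(X)\<close> induced by \<open>Q\<^sub>n(A) \<subseteq> Q\<^sub>n(X)\<close>, for \<open>A\<close> a
  subspace of \<open>X\<close>.\<close>

definition cubical_incl ::
  "real cspace \<Rightarrow> 'a cspace \<Rightarrow> int \<Rightarrow>
    (((nat \<Rightarrow> real) \<Rightarrow> 'a) \<Rightarrow>\<^sub>0 int) set \<Rightarrow> (((nat \<Rightarrow> real) \<Rightarrow> 'a) \<Rightarrow>\<^sub>0 int) set" where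
  "cubical_incl J X n = coset_map (cube_Q J X n) (cube_D J X n) (\<lambda>c. c)"


section \<open>The Mayer--Vietoris sequence\<close>

text \<open>The library's \<open>exact_seq\<close> requires all groups in the sequence to have the same type.\<close>

definition exact_at ::
  "('a, 'k) monoid_scheme \<Rightarrow> ('a \<Rightarrow> 'b) \<Rightarrow> ('b, 'm) monoid_scheme \<Rightarrow> ('b \<Rightarrow> 'c) \<Rightarrow>
    ('c, 'n) monoid_scheme \<Rightarrow> bool" where
  "exact_at G f H g K \<longleftrightarrow> group_hom G H f \<and> group_hom H K g \<and> f ` carrier G = kernel H K g"

text \<open>\<open>C Y\<close> is the chain complex of \<open>Y\<close>, and \<open>inc Y n\<close> the inclusion of the \<open>n\<close>-chains of a
  subspace of \<open>Y\<close> into those of \<open>Y\<close>. The maps \<open>\<phi>\<close> and \<open>\<psi>\<close> are induced by \<open>x \<mapsto> (x, -x)\<close> and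
  \<open>(x, y) \<mapsto> x + y\<close>. All integer degrees are included; as the groups in degree \<open>-1\<close> are trivial,
  the sequence ends with \<open>H\<^sub>0(X) \<rightarrow> 0\<close>.\<close>

definition mayer_vietoris ::
  "('a cspace \<Rightarrow> 'c chain_cplx) \<Rightarrow> ('a cspace \<Rightarrow> int \<Rightarrow> 'c \<Rightarrow> 'c) \<Rightarrow>
    'a cspace \<Rightarrow> 'a set \<Rightarrow> 'a set \<Rightarrow> bool" where
  "mayer_vietoris C inc X A B \<longleftrightarrow>
    (let XA = csubspace X A;
         XB = csubspace X B;
         XAB = csubspace X (A \<inter> B);
         H = (\<lambda>n Y. homology (C Y) n);
         i = (\<lambda>n Y. homology_map (C Y) n (inc Y n));
         \<phi> = (\<lambda>n z. (i n XA z, inv\<^bsub>H n XB\<^esub> (i n XB z)));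
         \<psi> = (\<lambda>n (u, v). i n X u \<otimes>\<^bsub>H n X\<^esub> i n X v)
     in \<exists>\<delta>. \<forall>n.
          exact_at (H n XAB) (\<phi> n) (H n XA \<times>\<times> H n XB) (\<psi> n) (H n X) \<and>
          exact_at (H n XA \<times>\<times> H n XB) (\<psi> n) (H n X) (\<delta> n) (H (n - 1) XAB) \<and>
          exact_at (H n X) (\<delta> n) (H (n - 1) XAB) (\<phi> (n - 1)) (H (n - 1) XA \<times>\<times> H (n - 1) XB))"


section \<open>The spaces above are closure spaces\<close>

lemma closure_space_mono:
  assumes "closure_space X" "A \<subseteq> B" "B \<subseteq> points X"
  shows "cl X A \<subseteq> cl X B"
proof -
  have "cl X (A \<union> B) = cl X A \<union> cl X B"
    using assms unfolding closure_space_def by (meson order_trans)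
  then show ?thesis using assms(2) by (metis Un_absorb1 Un_upper1)
qed

lemma closure_space_csubspace:
  assumes "closure_space X" "A \<subseteq> points X"
  shows "closure_space (csubspace X A)"
proof -
  have "cl X (B \<union> C) = cl X B \<union> cl X C" if "B \<subseteq> A" "C \<subseteq> A" for B C
    using assms that unfolding closure_space_def by (meson order_trans)
  then show ?thesis
    using assms unfolding closure_space_def csubspace_def by auto
qed

lemma closure_space_cspace_of: "closure_space (cspace_of T)"
  unfolding closure_space_def cspace_of_def
  by (auto simp: closure_of_Un closure_of_subset dest: closure_of_subset[THEN subsetD]
      in_closure_of[THEN iffD1])

lemma closure_space_indiscrete: "closure_space (indiscrete S)"
  unfolding closure_space_def indiscrete_def by auto

lemma closure_space_J:
  "closure_space J_I" "closure_space J_one" "closure_space J_plus"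
  by (simp_all add: J_I_def J_one_def closure_space_cspace_of closure_space_indiscrete)
    (auto simp: J_plus_def closure_space_def)

lemma closure_space_simplex:
  "closure_space (simplex_I n)" "closure_space (simplex_one n)" "closure_space (simplex_plus n)"
  by (simp_all add: simplex_I_def simplex_one_def closure_space_cspace_of closure_space_indiscrete)
    (auto simp: simplex_plus_def closure_space_def)

lemma nhood_points:
  assumes "closure_space X" "x \<in> points X"
  shows "nhood X x (points X)"
  using assms by (auto simp: nhood_def cinterior_def closure_space_def)

lemma nhood_mem:
  assumes "closure_space X" "nhood X x V"
  shows "x \<in> V"
  using assms unfolding nhood_def cinterior_def closure_space_def by blast

lemma nhood_Int:
  assumes "closure_space X" "nhood X x U" "nhood X x V"
  shows "nhood X x (U \<inter> V)"
proof -
  have "cl X ((points X - U) \<union> (points X - V)) = cl X (points X - U) \<union> cl X (points X - V)"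
    using assms(1) unfolding closure_space_def by (meson Diff_subset)
  then show ?thesis
    using assms(2,3) by (auto simp: nhood_def cinterior_def Diff_Int)
qed

lemma closure_space_cpower:
  assumes J: "closure_space J"
  shows "closure_space (cpower J n)"
proof -
  let ?P = "{1..n} \<rightarrow>\<^sub>E points J"
  let ?c = "cl (cpower J n)"
  have c: "?c A = {x \<in> ?P. \<forall>U. (\<forall>i\<in>{1..n}. nhood J (x i) (U i)) \<longrightarrow> PiE {1..n} U \<inter> A \<noteq> {}}" for A
    by (simp add: cpower_def)
  have empty: "?c {} = {}"
  proof -
    have "\<exists>U. \<forall>i\<in>{1..n}. nhood J (x i) (U i)" if "x \<in> ?P" for x
      using that nhood_points[OF J] by (intro exI[of _ "\<lambda>i. points J"]) auto
    then show ?thesis unfolding c by auto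
  qed
  have sub: "A \<subseteq> ?c A" if "A \<subseteq> ?P" for A
  proof
    fix x assume x: "x \<in> A"
    have "x \<in> PiE {1..n} U" if "\<forall>i\<in>{1..n}. nhood J (x i) (U i)" for U
      using that x \<open>A \<subseteq> ?P\<close> nhood_mem[OF J] by (auto simp: PiE_iff)
    then show "x \<in> ?c A" using x that unfolding c by blast
  qed
  have Un: "?c (A \<union> B) = ?c A \<union> ?c B" for A B
  proof
    show "?c A \<union> ?c B \<subseteq> ?c (A \<union> B)" unfolding c by blast
    show "?c (A \<union> B) \<subseteq> ?c A \<union> ?c B"
    proof (rule ccontr)
      assume "\<not> ?thesis"
      then obtain x where x: "x \<in> ?c (A \<union> B)" "x \<notin> ?c A" "x \<notin> ?c B" by blast
      then have "x \<in> ?P" by (simp add: c)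
      with x obtain U V
        where U: "\<forall>i\<in>{1..n}. nhood J (x i) (U i)" "PiE {1..n} U \<inter> A = {}"
          and V: "\<forall>i\<in>{1..n}. nhood J (x i) (V i)" "PiE {1..n} V \<inter> B = {}"
        unfolding c by blast
      have "\<forall>i\<in>{1..n}. nhood J (x i) (U i \<inter> V i)"
        using U(1) V(1) nhood_Int[OF J] by blast
      then have "PiE {1..n} (\<lambda>i. U i \<inter> V i) \<inter> (A \<union> B) \<noteq> {}"
        using x(1) unfolding c by (auto dest: spec[of _ "\<lambda>i. U i \<inter> V i"])
      moreover have "PiE {1..n} (\<lambda>i. U i \<inter> V i) \<subseteq> PiE {1..n} U \<inter> PiE {1..n} V"
        by (auto simp: PiE_iff)
      ultimately show False using U(2) V(2) by blast
    qed
  qed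
  have "points (cpower J n) = ?P" by (simp add: cpower_def)
  then show ?thesis
    unfolding closure_space_def using empty sub Un by (auto simp: c)
qed

lemma nhood_cpower_iff:
  "nhood (cpower J n) x W \<longleftrightarrow>
     x \<in> {1..n} \<rightarrow>\<^sub>E points J \<and> W \<subseteq> ({1..n} \<rightarrow>\<^sub>E points J) \<and>
     (\<exists>U. (\<forall>i\<in>{1..n}. nhood J (x i) (U i)) \<and> (\<Pi>\<^sub>E i\<in>{1..n}. U i) \<subseteq> W)"
proof -
  let ?P = "{1..n} \<rightarrow>\<^sub>E points J"
  have "PiE {1..n} U \<inter> (?P - W) = {} \<longleftrightarrow> PiE {1..n} U \<subseteq> W"
    if "\<forall>i\<in>{1..n}. nhood J (x i) (U i)" for U
  proof -
    have "PiE {1..n} U \<subseteq> ?P" using that by (intro PiE_mono) (auto simp: nhood_def)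
    then show ?thesis by blast
  qed
  then show ?thesis
    unfolding nhood_def[of "cpower J n"] cinterior_def[of "cpower J n"]
    by (auto simp: cpower_def)
qed

end

theory Submission
  imports Defs
begin

text \<open>Homology classes are handled through representing chains in free abelian groups: all the groups
  in the sequences are quotients of subgroups of free abelian groups, and a degenerate cube counts as
  zero. Call a chain small if it is a sum of a chain in \<open>A\<close>, a chain in \<open>B\<close> and a degenerate chain.
  Exactness follows by diagram chasing once every chain \<open>c\<close> of \<open>X\<close> with small boundary becomes
  small after subtracting the boundary of some chain.

  For \<open>J_one\<close> and \<open>J_plus\<close> there is nothing to subtract: some point of the model simplex or cube has
  the whole model as its only neighborhood, so that every singular simplex or cube of \<open>X\<close> lies in
  \<open>A\<close> or in \<open>B\<close>. For \<open>J_I\<close> one subdivides. The interior in a closure space need not be open, but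
  the preimages of \<open>A\<close> and \<open>B\<close> under a continuous map \<open>\<sigma>\<close> are neighborhoods that cover the model,
  so that a Lebesgue number exists and iterated subdivisions of \<open>\<sigma>\<close> are small. A homotopy \<open>h\<close> between
  the subdivision and the identity that maps chains of a subspace to chains of that subspace
  then gives the chain to subtract, because \<open>h (bd c)\<close> is small if \<open>bd c\<close> is.\<close>

section \<open>Groups presented as quotients of additive subgroups\<close>

text \<open>A cubical chain group is itself a quotient, so a cubical homology class is a coset of
  cosets. Recording each group by a numerator and a denominator inside one additive group removes
  both layers: a class of a subspace and its image in the larger space have the same representing
  chain, and only the denominator changes. In return the diagram chase holds only modulo degenerate
  chains, and intersecting must survive this: a chain in \<open>A\<close> and a chain in
  \<open>B\<close> that agree modulo degenerate chains must agree, in the same sense, with a chain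
  in the intersection. This is true because the degenerate cubes are some of the free generators, so
  a degenerate sum splits into degenerate chains in \<open>A\<close> and in \<open>B\<close>. The
  condition on small chains says that all chains modulo small ones form an acyclic complex. It
  contains both halves of the usual comparison: every class has a small representative, and a small
  cycle that bounds is the boundary of a small chain. The cubical prisms are chosen so that all but
  one of the end faces of a subdivided cube are degenerate.\<close>

definition add_subgroup :: "'q::ab_group_add set \<Rightarrow> bool" where
  "add_subgroup Z \<longleftrightarrow> 0 \<in> Z \<and> (\<forall>x\<in>Z. \<forall>y\<in>Z. x - y \<in> Z)"

lemma add_subgroup_closed:
  assumes "add_subgroup Z"
  shows "0 \<in> Z"
    and "x \<in> Z \<Longrightarrow> y \<in> Z \<Longrightarrow> x - y \<in> Z"
    and "x \<in> Z \<Longrightarrow> - x \<in> Z"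
    and "x \<in> Z \<Longrightarrow> y \<in> Z \<Longrightarrow> x + y \<in> Z"
proof -
  show *: "0 \<in> Z" "\<And>x y. x \<in> Z \<Longrightarrow> y \<in> Z \<Longrightarrow> x - y \<in> Z"
    using assms by (auto simp: add_subgroup_def)
  show m: "\<And>x. x \<in> Z \<Longrightarrow> - x \<in> Z"
    using *(1) *(2)[of 0] by simp
  show "x \<in> Z \<Longrightarrow> y \<in> Z \<Longrightarrow> x + y \<in> Z"
    using *(2)[of x "- y"] m[of y] by simp
qed

text \<open>\<open>presents G Z B p\<close> says that \<open>p\<close> induces an isomorphism \<open>Z/B \<cong> G\<close>.\<close>

definition presents :: "('g, 'm) monoid_scheme \<Rightarrow> 'q::ab_group_add set \<Rightarrow> 'q set \<Rightarrow> ('q \<Rightarrow> 'g) \<Rightarrow> bool" where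
  "presents G Z B p \<longleftrightarrow>
     comm_group G \<and> add_subgroup Z \<and> p ` Z = carrier G \<and>
     (\<forall>x\<in>Z. \<forall>y\<in>Z. p (x + y) = p x \<otimes>\<^bsub>G\<^esub> p y) \<and>
     (\<forall>x\<in>Z. p x = \<one>\<^bsub>G\<^esub> \<longleftrightarrow> x \<in> B)"

context
  fixes G :: "('g, 'm) monoid_scheme" and Z B :: "'q::ab_group_add set" and p
  assumes P: "presents G Z B p"
begin

lemma presents_group: "group G" "comm_group G"
  using P comm_group.axioms(2) by (auto simp: presents_def)

lemma presents_add_subgroup: "add_subgroup Z"
  using P by (simp add: presents_def)

lemma presents_carrier: "carrier G = p ` Z"
  using P by (simp add: presents_def)

lemma presents_mem: "x \<in> Z \<Longrightarrow> p x \<in> carrier G"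
  by (simp add: presents_carrier)

lemma presents_add: "x \<in> Z \<Longrightarrow> y \<in> Z \<Longrightarrow> p (x + y) = p x \<otimes>\<^bsub>G\<^esub> p y"
  using P by (simp add: presents_def)

lemma presents_eq_one_iff: "x \<in> Z \<Longrightarrow> p x = \<one>\<^bsub>G\<^esub> \<longleftrightarrow> x \<in> B"
  using P by (simp add: presents_def)

lemma presents_zero: "p 0 = \<one>\<^bsub>G\<^esub>"
proof -
  have "0 \<in> Z" using presents_add_subgroup by (rule add_subgroup_closed)
  then have "p 0 \<otimes>\<^bsub>G\<^esub> p 0 = p 0"
    using presents_add[of 0 0] by simp
  then show ?thesis
    using presents_group(1) presents_mem[OF \<open>0 \<in> Z\<close>] by (metis group.l_cancel_one)
qed

lemma presents_minus: "x \<in> Z \<Longrightarrow> p (- x) = inv\<^bsub>G\<^esub> p x"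
proof -
  assume x: "x \<in> Z"
  then have m: "- x \<in> Z" by (rule add_subgroup_closed[OF presents_add_subgroup])
  have "p (- x) \<otimes>\<^bsub>G\<^esub> p x = \<one>\<^bsub>G\<^esub>"
    using presents_add[OF m x] presents_zero by simp
  then show ?thesis
    using presents_group(1) presents_mem[OF x] presents_mem[OF m] by (metis group.inv_equality)
qed

lemma presents_eq_iff: "x \<in> Z \<Longrightarrow> y \<in> Z \<Longrightarrow> p x = p y \<longleftrightarrow> x - y \<in> B"
proof -
  assume x: "x \<in> Z" and y: "y \<in> Z"
  interpret group G by (rule presents_group)
  have d: "x - y \<in> Z" using x y by (rule add_subgroup_closed[OF presents_add_subgroup])
  have eq: "p x = p (x - y) \<otimes>\<^bsub>G\<^esub> p y" using presents_add[OF d y] by simp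
  have "p x = p y \<longleftrightarrow> p (x - y) = \<one>\<^bsub>G\<^esub>"
    unfolding eq using presents_mem d y by simp
  then show ?thesis using presents_eq_one_iff[OF d] by simp
qed

lemma presents_subgroup_image:
  assumes M: "add_subgroup M" "M \<subseteq> Z"
  shows "subgroup (p ` M) G"
proof
  note MS = add_subgroup_closed[OF M(1)]
  show "p ` M \<subseteq> carrier G" using M presents_mem by auto
  show "\<one>\<^bsub>G\<^esub> \<in> p ` M" using presents_zero MS(1) by (metis imageI)
  show "x \<otimes>\<^bsub>G\<^esub> y \<in> p ` M" if "x \<in> p ` M" "y \<in> p ` M" for x y
    using that presents_add MS(4) M(2) by (smt (verit) imageE imageI subsetD)
  show "inv\<^bsub>G\<^esub> x \<in> p ` M" if "x \<in> p ` M" for x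
    using that presents_minus MS(3) M(2) by (smt (verit) imageE imageI subsetD)
qed

lemma presents_restrict:
  assumes M: "add_subgroup M" "M \<subseteq> Z"
  shows "presents (G\<lparr>carrier := p ` M\<rparr>) M B p"
proof -
  interpret comm_group G by (rule presents_group)
  have sub: "subgroup (p ` M) G" by (rule presents_subgroup_image[OF M])
  have "comm_group (G\<lparr>carrier := p ` M\<rparr>)"
    by (rule group.group_comm_groupI[OF subgroup.subgroup_is_group[OF sub is_group]])
      (use subgroup.mem_carrier[OF sub] m_comm in auto)
  then show ?thesis
    unfolding presents_def
    using M presents_add presents_eq_one_iff by (auto simp: subset_iff)
qed

text \<open>Third isomorphism theorem: dividing \<open>Z/B\<close> by the image of \<open>M\<close>
  gives \<open>Z\<close> modulo \<open>M + B\<close>, and the new denominator is the part of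
  \<open>M + B\<close> inside \<open>Z\<close>.\<close>

lemma presents_Mod:
  assumes M: "add_subgroup M" "M \<subseteq> Z"
  shows "presents (G Mod (p ` M)) Z {x \<in> Z. \<exists>m\<in>M. x - m \<in> B} (\<lambda>x. p ` M #>\<^bsub>G\<^esub> p x)"
proof -
  interpret comm_group G by (rule presents_group)
  have sub: "subgroup (p ` M) G" by (rule presents_subgroup_image[OF M])
  then have nrm: "p ` M \<lhd> G" by (rule subgroup_imp_normal)
  have "p ` M #>\<^bsub>G\<^esub> p x = p ` M \<longleftrightarrow> (\<exists>m\<in>M. x - m \<in> B)" if x: "x \<in> Z" for x
  proof -
    have "p ` M #>\<^bsub>G\<^esub> p x = p ` M \<longleftrightarrow> p x \<in> p ` M"
      using sub presents_mem[OF x] by (metis coset_join1 coset_join2 subgroup.subset)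
    also have "\<dots> \<longleftrightarrow> (\<exists>m\<in>M. p x = p m)" by auto
    also have "\<dots> \<longleftrightarrow> (\<exists>m\<in>M. x - m \<in> B)" using presents_eq_iff x M(2) by blast
    finally show ?thesis .
  qed
  moreover have "comm_group (G Mod (p ` M))"
    using sub by (rule abelian_FactGroup)
  ultimately show ?thesis
    unfolding presents_def
    using presents_add_subgroup presents_add presents_mem presents_carrier normal.rcos_sum[OF nrm]
    by (auto simp: FactGroup_def RCOSETS_def)
qed

text \<open>Only the part of the denominator inside \<open>Z\<close> matters, so denominators can be
  stated without a membership condition.\<close>

lemma presents_cong:
  assumes "B \<inter> Z = B' \<inter> Z" "\<And>x. x \<in> Z \<Longrightarrow> p x = p' x"
  shows "presents G Z B' p'"
proof -
  have "p' ` Z = p ` Z" using assms(2) by auto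
  moreover have "x + y \<in> Z" if "x \<in> Z" "y \<in> Z" for x y
    using that add_subgroup_closed(4)[OF presents_add_subgroup] by blast
  ultimately show ?thesis
    using P assms unfolding presents_def by auto
qed

end

text \<open>The elements of the coset of \<open>p x\<close> are the \<open>p (m + x)\<close> with
  \<open>m\<close> in \<open>M\<close>. The map \<open>g\<close> on numerators, from which
  \<open>f\<close> comes, moves \<open>m\<close> into \<open>M'\<close>, so their images under
  \<open>f\<close> all lie in one coset.\<close>

lemma coset_map_presents:
  assumes p: "presents G Z B p" and p': "presents G' Z' B' p'"
    and M: "add_subgroup M" "M \<subseteq> Z" and M': "add_subgroup M'" "M' \<subseteq> Z'"
    and f: "\<And>x. x \<in> Z \<Longrightarrow> f (p x) = p' (g x)" "\<And>x. x \<in> Z \<Longrightarrow> g x \<in> Z'"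
      "\<And>x y. x \<in> Z \<Longrightarrow> y \<in> Z \<Longrightarrow> g (x + y) = g x + g y" "\<And>x. x \<in> M \<Longrightarrow> g x \<in> M'"
    and x: "x \<in> Z"
  shows "coset_map G' (p' ` M') f (p ` M #>\<^bsub>G\<^esub> p x) = p' ` M' #>\<^bsub>G'\<^esub> p' (g x)"
proof -
  interpret G': comm_group G' by (rule presents_group[OF p'])
  have sub: "subgroup (p' ` M') G'" by (rule presents_subgroup_image[OF p' M'])
  have "p' ` M' #>\<^bsub>G'\<^esub> f k = p' ` M' #>\<^bsub>G'\<^esub> p' (g x)" if k: "k \<in> p ` M #>\<^bsub>G\<^esub> p x" for k
  proof -
    obtain m where m: "m \<in> M" "k = p m \<otimes>\<^bsub>G\<^esub> p x"
      using k by (auto simp: r_coset_def)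
    have mz: "m \<in> Z" using m M(2) by auto
    have "k = p (m + x)" using m mz x presents_add[OF p] by simp
    then have "f k = p' (g m) \<otimes>\<^bsub>G'\<^esub> p' (g x)"
      using f mz x add_subgroup_closed(4)[OF presents_add_subgroup[OF p]] presents_add[OF p'] by simp
    moreover have gm: "p' (g m) \<in> p' ` M'" using m f(4) by auto
    ultimately show ?thesis
      using G'.coset_mult_assoc[of "p' ` M'" "p' (g m)" "p' (g x)"] sub presents_mem[OF p'] f(2) mz x
      by (metis G'.coset_join2 subgroup.subset subsetD)
  qed
  \<comment> \<open>\<open>the_elem\<close> in \<open>coset_map\<close> needs a singleton, and an
    empty coset would have an empty image.\<close>
  moreover have "p ` M #>\<^bsub>G\<^esub> p x \<noteq> {}"
    using add_subgroup_closed(1)[OF M(1)] by (auto simp: r_coset_def)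
  ultimately have "(\<lambda>k. p' ` M' #>\<^bsub>G'\<^esub> f k) ` (p ` M #>\<^bsub>G\<^esub> p x) = {p' ` M' #>\<^bsub>G'\<^esub> p' (g x)}"
    by auto
  then show ?thesis by (simp add: coset_map_def)
qed


section \<open>Presented chain complexes\<close>

text \<open>\<open>Q n\<close> and \<open>D n\<close> are the numerator and the denominator of the
  \<open>n\<close>-th chain group. The map \<open>bd\<close> is a differential on \<open>Q\<close>
  itself, not only modulo \<open>D\<close>, and \<open>D\<close> is a subcomplex.\<close>

locale presented_complex =
  fixes C :: "'c chain_cplx" and Q D :: "int \<Rightarrow> 'q::ab_group_add set"
    and bd :: "int \<Rightarrow> 'q \<Rightarrow> 'q" and p :: "int \<Rightarrow> 'q \<Rightarrow> 'c"
  assumes chains: "\<And>n. presents (chains C n) (Q n) (D n) (p n)"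
    and bdry: "\<And>n x. x \<in> Q n \<Longrightarrow> bdry C n (p n x) = p (n - 1) (bd n x)"
    and D_sub: "\<And>n. D n \<subseteq> Q n"
    and bd_diff: "\<And>n x y. bd n (x - y) = bd n x - bd n y"
    and bd_Q: "\<And>n x. x \<in> Q n \<Longrightarrow> bd n x \<in> Q (n - 1)"
    and bd_D: "\<And>n x. x \<in> D n \<Longrightarrow> bd n x \<in> D (n - 1)"
    and bd_bd: "\<And>n x. x \<in> Q n \<Longrightarrow> bd (n - 1) (bd n x) = 0"
begin

text \<open>This is the preimage in \<open>Q\<close> of the cycles of the quotient complex
  \<open>Q/D\<close>; likewise \<open>Bc\<close> is the preimage of its boundaries.\<close>

definition Zc :: "int \<Rightarrow> 'q set" where "Zc n = {x \<in> Q n. bd n x \<in> D (n - 1)}"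

definition Bc :: "int \<Rightarrow> 'q set" where "Bc n = {x. \<exists>y\<in>Q (n + 1). x - bd (n + 1) y \<in> D n}"

definition hcls :: "int \<Rightarrow> 'q \<Rightarrow> 'c set" where
  "hcls n x = boundaries C n #>\<^bsub>chains C n\<^esub> p n x"

lemma Q_subgroup: "add_subgroup (Q n)"
  by (rule presents_add_subgroup[OF chains])

lemma bd_0: "bd n 0 = 0"
  using bd_diff[of n 0 0] by simp

text \<open>\<open>D n\<close> is the kernel of \<open>p n\<close> on \<open>Q n\<close>.\<close>

lemma D_subgroup: "add_subgroup (D n)"
proof -
  have "0 \<in> D n"
    using presents_zero[OF chains] presents_eq_one_iff[OF chains] add_subgroup_closed(1)[OF Q_subgroup] by blast
  moreover have "x - y \<in> D n" if "x \<in> D n" "y \<in> D n" for x y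
    using presents_eq_iff[OF chains, of x n y] presents_eq_one_iff[OF chains] that D_sub
    by (metis subsetD)
  ultimately show ?thesis by (auto simp: add_subgroup_def)
qed

lemma Zc_subgroup: "add_subgroup (Zc n)"
  unfolding Zc_def add_subgroup_def
  using add_subgroup_closed[OF Q_subgroup] add_subgroup_closed[OF D_subgroup]
  by (auto simp: bd_diff bd_0)

lemma image_bd_subgroup: "add_subgroup (bd n ` Q n)"
  unfolding add_subgroup_def
proof (intro conjI ballI)
  show "0 \<in> bd n ` Q n" using add_subgroup_closed(1)[OF Q_subgroup] bd_0 by (metis imageI)
  fix x y assume "x \<in> bd n ` Q n" "y \<in> bd n ` Q n"
  then show "x - y \<in> bd n ` Q n"
    using add_subgroup_closed(2)[OF Q_subgroup] by (auto simp flip: bd_diff)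
qed

lemma bd_cycle: "x \<in> Q (n + 1) \<Longrightarrow> bd (n + 1) x \<in> Zc n"
  using bd_Q[of x "n + 1"] bd_bd[of x "n + 1"] add_subgroup_closed(1)[OF D_subgroup]
  by (auto simp: Zc_def)

lemma boundaries_eq: "boundaries C n = p n ` bd (n + 1) ` Q (n + 1)"
proof -
  have "bdry C (n + 1) (p (n + 1) x) = p n (bd (n + 1) x)" if "x \<in> Q (n + 1)" for x
    using bdry[OF that] by simp
  then show ?thesis
    unfolding boundaries_def presents_carrier[OF chains] image_image by auto
qed

lemma kernel_eq: "kernel (chains C n) (chains C (n - 1)) (bdry C n) = p n ` Zc n"
  unfolding kernel_def presents_carrier[OF chains]
  using bdry bd_Q presents_eq_one_iff[OF chains] by (auto simp: Zc_def)

text \<open>Restricting the presentation of the chain group to \<open>Zc n\<close> and dividing by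
  the boundaries gives the denominator \<open>bd Q + D\<close>. Cosets formed inside the group of
  cycles are cosets in the whole chain group, since both use the same multiplication.\<close>

lemma presents_homology: "presents (homology C n) (Zc n) (Bc n) (hcls n)"
proof -
  let ?M = "bd (n + 1) ` Q (n + 1)"
  have Z: "Zc n \<subseteq> Q n" by (auto simp: Zc_def)
  have M: "?M \<subseteq> Zc n" using bd_cycle by auto
  have "presents (homology C n) (Zc n) {x \<in> Zc n. \<exists>m\<in>?M. x - m \<in> D n}
      (\<lambda>x. p n ` ?M #>\<^bsub>chains C n\<lparr>carrier := p n ` Zc n\<rparr>\<^esub> p n x)"
    unfolding homology_def kernel_eq boundaries_eq
    using presents_Mod[OF presents_restrict[OF chains Zc_subgroup Z] image_bd_subgroup M] .
  then show ?thesis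
    by (rule presents_cong) (auto simp: Bc_def hcls_def boundaries_eq r_coset_def)
qed

end

text \<open>Both complexes share the differential on chains, so the induced map can leave the
  representing chain as it is.\<close>

lemma homology_map_presented:
  assumes "presented_complex C Q D bd p" "presented_complex C' Q' D' bd p'"
    and QQ': "\<And>n. Q n \<subseteq> Q' n"
    and f: "\<And>x. x \<in> Q n \<Longrightarrow> f (p n x) = p' n x"
    and x: "x \<in> Q n"
  shows "homology_map C' n f (presented_complex.hcls C p n x) = presented_complex.hcls C' p' n x"
proof -
  interpret C: presented_complex C Q D bd p by fact
  interpret C': presented_complex C' Q' D' bd p' by fact
  show ?thesis
    unfolding homology_map_def C.hcls_def C'.hcls_def C.boundaries_eq C'.boundaries_eq
  proof (rule coset_map_presents[OF C.chains C'.chains, where g = "\<lambda>x. x"])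
    show "bd (n + 1) ` Q (n + 1) \<subseteq> Q n" using C.bd_cycle by (auto simp: C.Zc_def)
    show "bd (n + 1) ` Q' (n + 1) \<subseteq> Q' n" using C'.bd_cycle by (auto simp: C'.Zc_def)
    show "\<And>x. x \<in> bd (n + 1) ` Q (n + 1) \<Longrightarrow> x \<in> bd (n + 1) ` Q' (n + 1)" using QQ' by auto
    show "x \<in> Q' n" if "x \<in> Q n" for x using QQ' that by auto
  qed (use C.image_bd_subgroup C'.image_bd_subgroup f x in auto)
qed


section \<open>The abstract Mayer--Vietoris sequence\<close>

text \<open>\<open>split\<close> makes the images of \<open>QA n\<close> and \<open>QB n\<close> in
  \<open>Q n / D n\<close> intersect in the image of \<open>QAB n\<close>, see
  \<open>split_Int\<close>. \<open>small_chains\<close> is where the interior cover will enter; the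
  other conditions come from inclusions between sets of generators.\<close>

locale mayer_vietoris_pair =
  X: presented_complex CX Q D bd pX +
  A: presented_complex CA QA DA bd pA +
  B: presented_complex CB QB DB bd pB +
  AB: presented_complex CAB QAB DAB bd pAB
  for CX :: "'c chain_cplx" and CA :: "'c chain_cplx" and CB :: "'c chain_cplx" and CAB :: "'c chain_cplx"
    and Q QA QB QAB D DA DB DAB :: "int \<Rightarrow> 'q::ab_group_add set" and bd and pX pA pB pAB +
  assumes QA: "\<And>n. QA n \<subseteq> Q n" and QB: "\<And>n. QB n \<subseteq> Q n"
    and QAB: "\<And>n. QAB n = QA n \<inter> QB n"
    and DA: "\<And>n. DA n = D n \<inter> QA n" and DB: "\<And>n. DB n = D n \<inter> QB n"
    and DAB: "\<And>n. DAB n = D n \<inter> QAB n"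
    and split: "\<And>n a b. \<lbrakk>a \<in> QA n; b \<in> QB n; a + b \<in> D n\<rbrakk> \<Longrightarrow> \<exists>u\<in>DA n. \<exists>v\<in>DB n. a + b = u + v"
    and small_chains: "\<And>n c a b e. \<lbrakk>c \<in> Q n; a \<in> QA (n - 1); b \<in> QB (n - 1); bd n c - a - b \<in> D (n - 1)\<rbrakk>
       \<Longrightarrow> \<exists>d\<in>Q (n + 1). \<exists>a\<in>QA n. \<exists>b\<in>QB n. c - bd (n + 1) d - a - b \<in> D n"
begin

lemmas Q_closed = add_subgroup_closed[OF X.Q_subgroup]
lemmas QA_closed = add_subgroup_closed[OF A.Q_subgroup]
lemmas QB_closed = add_subgroup_closed[OF B.Q_subgroup]
lemmas D_closed = add_subgroup_closed[OF X.D_subgroup]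

lemma bd_add: "bd n (x + y) = bd n x + bd n y"
  using X.bd_diff[of n "x + y" y] by (simp add: algebra_simps)

lemma bd_minus: "bd n (- x) = - bd n x"
  using X.bd_diff[of n 0 x] X.bd_0 by simp

lemma bd_bd': "x \<in> Q (n + 1) \<Longrightarrow> bd n (bd (n + 1) x) = 0"
  using X.bd_bd[of x "n + 1"] by simp

lemma bd_Q':
  "x \<in> Q (n + 1) \<Longrightarrow> bd (n + 1) x \<in> Q n"
  "x \<in> QA (n + 1) \<Longrightarrow> bd (n + 1) x \<in> QA n"
  "x \<in> QB (n + 1) \<Longrightarrow> bd (n + 1) x \<in> QB n"
  using X.bd_Q[of x "n + 1"] A.bd_Q[of x "n + 1"] B.bd_Q[of x "n + 1"] by auto

lemma bd_D': "x \<in> D (n + 1) \<Longrightarrow> bd (n + 1) x \<in> D n"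
  using X.bd_D[of x "n + 1"] by simp

text \<open>The relation between a cycle \<open>z\<close> and a representative \<open>w\<close> of the connecting map.\<close>

definition conn :: "int \<Rightarrow> 'q \<Rightarrow> 'q \<Rightarrow> bool" where
  "conn n z w \<longleftrightarrow> w \<in> AB.Zc (n - 1) \<and>
     (\<exists>a\<in>QA n. \<exists>b\<in>QB n. \<exists>d\<in>Q (n + 1).
        z - bd (n + 1) d - a - b \<in> D n \<and> w - bd n a \<in> D (n - 1) \<and> w + bd n b \<in> D (n - 1))"

text \<open>With the degenerate summands moved to the other side, \<open>a - u = v - b\<close> lies
  in both \<open>QA n\<close> and \<open>QB n\<close>; modulo \<open>D n\<close> this common chain
  is \<open>a\<close> and also \<open>- b\<close>.\<close>

lemma split_Int:
  assumes "a \<in> QA n" "b \<in> QB n" "a + b \<in> D n"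
  obtains c where "c \<in> QAB n" "c - a \<in> D n" "c + b \<in> D n"
proof -
  obtain u v where uv: "u \<in> DA n" "v \<in> DB n" "a + b = u + v" using split assms by blast
  have "a - u = v - b" using uv(3) by (simp add: algebra_simps)
  moreover have "a - u \<in> QA n" "v - b \<in> QB n"
    using uv assms QA_closed QB_closed by (auto simp: DA DB)
  ultimately have "a - u \<in> QAB n" by (auto simp: QAB)
  moreover have "a - u - a \<in> D n" using uv(1) D_closed by (simp add: DA)
  moreover have "a - u + b \<in> D n" using uv \<open>a - u = v - b\<close> by (simp add: DB)
  ultimately show thesis using that by blast
qed

text \<open>As \<open>bd (n + 1) a\<close> has boundary 0, the boundary of \<open>w\<close> is that
  of the degenerate chain \<open>w - bd (n + 1) a\<close>.\<close>

lemma QA_QB_Zc_AB: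
  assumes "w \<in> QAB n" "a \<in> QA (n + 1)" "w - bd (n + 1) a \<in> D n"
  shows "w \<in> AB.Zc n"
proof -
  have "bd n w = bd n (w - bd (n + 1) a)"
    using assms(2) QA by (auto simp: X.bd_diff bd_bd' subset_iff)
  then have "bd n w \<in> D (n - 1)" using X.bd_D[OF assms(3)] by simp
  then show ?thesis using assms(1) AB.bd_Q by (auto simp: AB.Zc_def DAB)
qed

text \<open>The zigzag of the connecting map: up to a boundary and degenerate chains
  \<open>z\<close> is \<open>a + b\<close>. Because \<open>z\<close> is a cycle,
  \<open>bd n a\<close> and \<open>- bd n b\<close> agree modulo degenerate chains with a chain
  \<open>w\<close> of the intersection.\<close>

lemma conn_ex:
  assumes "z \<in> X.Zc n"
  obtains w where "conn n z w"
proof -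
  have z: "z \<in> Q n" "bd n z \<in> D (n - 1)" using assms by (auto simp: X.Zc_def)
  \<comment> \<open>The boundary of \<open>z\<close> is degenerate, hence small with zero summands
    in \<open>A\<close> and \<open>B\<close>.\<close>
  then obtain d a b where d: "d \<in> Q (n + 1)" "a \<in> QA n" "b \<in> QB n" "z - bd (n + 1) d - a - b \<in> D n"
    using small_chains[of z n 0 0] QA_closed(1) QB_closed(1) by auto
  have "bd n z - bd n a - bd n b \<in> D (n - 1)"
    using X.bd_D[OF d(4)] d(1) by (simp add: X.bd_diff bd_bd')
  then have "bd n z - (bd n z - bd n a - bd n b) \<in> D (n - 1)" using D_closed z(2) by blast
  then have ab: "bd n a + bd n b \<in> D (n - 1)" by (simp add: algebra_simps)
  obtain w where w: "w \<in> QAB (n - 1)" "w - bd n a \<in> D (n - 1)" "w + bd n b \<in> D (n - 1)"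
    using split_Int[OF A.bd_Q[OF d(2)] B.bd_Q[OF d(3)] ab] by blast
  have "w \<in> AB.Zc (n - 1)" using QA_QB_Zc_AB[of w "n - 1" a] w d by simp
  then have "conn n z w" unfolding conn_def using d w by blast
  then show thesis using that by blast
qed

text \<open>Closure under differences reduces independence of all choices in the zigzag to the case
  of a bounding \<open>z\<close>, treated in \<open>conn_boundary\<close>.\<close>

lemma conn_diff:
  assumes "conn n z w" "conn n z' w'"
  shows "conn n (z - z') (w - w')"
proof -
  obtain a b d where 1: "a \<in> QA n" "b \<in> QB n" "d \<in> Q (n + 1)"
    "z - bd (n + 1) d - a - b \<in> D n" "w - bd n a \<in> D (n - 1)" "w + bd n b \<in> D (n - 1)"
    using assms(1) by (auto simp: conn_def)
  obtain a' b' d' where 2: "a' \<in> QA n" "b' \<in> QB n" "d' \<in> Q (n + 1)"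
    "z' - bd (n + 1) d' - a' - b' \<in> D n" "w' - bd n a' \<in> D (n - 1)" "w' + bd n b' \<in> D (n - 1)"
    using assms(2) by (auto simp: conn_def)
  have "w - w' \<in> AB.Zc (n - 1)"
    using assms add_subgroup_closed[OF AB.Zc_subgroup] by (auto simp: conn_def)
  moreover have "(z - z') - bd (n + 1) (d - d') - (a - a') - (b - b') \<in> D n"
    using D_closed(2)[OF 1(4) 2(4)] by (simp add: X.bd_diff algebra_simps)
  moreover have "(w - w') - bd n (a - a') \<in> D (n - 1)"
    using D_closed(2)[OF 1(5) 2(5)] by (simp add: X.bd_diff algebra_simps)
  moreover have "(w - w') + bd n (b - b') \<in> D (n - 1)"
    using D_closed(2)[OF 1(6) 2(6)] by (simp add: X.bd_diff algebra_simps)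
  moreover have "a - a' \<in> QA n" "b - b' \<in> QB n" "d - d' \<in> Q (n + 1)"
    using 1(1-3) 2(1-3) Q_closed(2) QA_closed(2) QB_closed(2) by auto
  ultimately show ?thesis
    unfolding conn_def by blast
qed

text \<open>The chain \<open>x - d\<close> has boundary \<open>a + b\<close> modulo
  \<open>D n\<close>, so it can itself be split over \<open>A\<close> and \<open>B\<close>. This
  yields a chain \<open>u\<close> of the intersection that equals \<open>- a\<close> up to a
  boundary in \<open>A\<close> and degenerate chains; hence \<open>- u\<close> bounds
  \<open>w\<close> modulo degenerate chains.\<close>

lemma conn_boundary:
  assumes "conn n z w" "z \<in> X.Bc n"
  shows "w \<in> AB.Bc (n - 1)"
proof -
  obtain a b d where 1: "a \<in> QA n" "b \<in> QB n" "d \<in> Q (n + 1)"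
    "z - bd (n + 1) d - a - b \<in> D n" "w - bd n a \<in> D (n - 1)" "w + bd n b \<in> D (n - 1)"
    and w: "w \<in> AB.Zc (n - 1)"
    using assms(1) by (auto simp: conn_def)
  obtain x where x: "x \<in> Q (n + 1)" "z - bd (n + 1) x \<in> D n"
    using assms(2) by (auto simp: X.Bc_def)
  have "bd (n + 1) (x - d) - a - b \<in> D n"
    using D_closed(2)[OF 1(4) x(2)] by (simp add: X.bd_diff algebra_simps)
  \<comment> \<open>\<open>small_chains\<close> one degree higher: the boundary of
    \<open>x - d\<close> is small, with summands \<open>a\<close> and \<open>b\<close>.\<close>
  then obtain y xa xb where y: "y \<in> Q (n + 1 + 1)" "xa \<in> QA (n + 1)" "xb \<in> QB (n + 1)"
      "x - d - bd (n + 1 + 1) y - xa - xb \<in> D (n + 1)"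
    using small_chains[of "x - d" "n + 1" a b] 1 x Q_closed by auto
  have "bd (n + 1) (x - d) - bd (n + 1) xa - bd (n + 1) xb \<in> D n"
    using bd_D'[OF y(4)] bd_bd'[OF y(1)] by (simp add: X.bd_diff)
  from D_closed(2)[OF \<open>bd (n + 1) (x - d) - a - b \<in> D n\<close> this]
  have "(bd (n + 1) xa - a) + (bd (n + 1) xb - b) \<in> D n" by (simp add: algebra_simps)
  moreover have "bd (n + 1) xa - a \<in> QA n" "bd (n + 1) xb - b \<in> QB n"
    using y 1 bd_Q' QA_closed QB_closed by auto
  ultimately obtain u where u: "u \<in> QAB n" "u - (bd (n + 1) xa - a) \<in> D n"
    by (metis split_Int)
  have "bd n u + bd n a \<in> D (n - 1)"
    using X.bd_D[OF u(2)] y(2) QA by (auto simp: X.bd_diff bd_bd' subset_iff)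
  from D_closed(4)[OF 1(5) this] have "w - bd n (- u) \<in> D (n - 1)"
    by (simp add: bd_minus algebra_simps)
  moreover have "w - bd n (- u) \<in> QAB (n - 1)"
    using w u(1) AB.bd_Q add_subgroup_closed[OF AB.Q_subgroup] by (auto simp: AB.Zc_def)
  ultimately show ?thesis
    using u(1) add_subgroup_closed(3)[OF AB.Q_subgroup] by (auto simp: AB.Bc_def DAB)
qed

lemma conn_add:
  assumes "conn n z w" "conn n z' w'"
  shows "conn n (z + z') (w + w')"
proof -
  have "conn n 0 0" using conn_diff[OF assms(1) assms(1)] by simp
  then have "conn n (- z') (- w')" using conn_diff[of n 0 0 z' w'] assms(2) by simp
  then show ?thesis using conn_diff[OF assms(1), of "- z'" "- w'"] by simp
qed

lemma Zc_sub:
  "AB.Zc n \<subseteq> A.Zc n" "AB.Zc n \<subseteq> B.Zc n" "A.Zc n \<subseteq> X.Zc n" "B.Zc n \<subseteq> X.Zc n"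
  using QA QB by (auto simp: AB.Zc_def A.Zc_def B.Zc_def X.Zc_def DAB DA DB QAB subset_iff)

text \<open>A chain bounding \<open>a + b\<close> is \<open>xa + xb\<close> up to a boundary and
  degenerate chains. Then \<open>a - bd (n + 1) xa\<close> and \<open>bd (n + 1) xb - b\<close>
  agree modulo degenerate chains with a chain \<open>c\<close> of the intersection, which is
  homologous to \<open>a\<close> in \<open>A\<close> and to \<open>- b\<close> in
  \<open>B\<close>.\<close>

lemma exact_pair:
  assumes "a \<in> A.Zc n" "b \<in> B.Zc n" "a + b \<in> X.Bc n"
  obtains c where "c \<in> AB.Zc n" "c - a \<in> A.Bc n" "- c - b \<in> B.Bc n"
proof -
  have ab: "a \<in> QA n" "b \<in> QB n" "bd n a \<in> D (n - 1)" "bd n b \<in> D (n - 1)"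
    using assms by (auto simp: A.Zc_def B.Zc_def DA DB)
  obtain x where x: "x \<in> Q (n + 1)" "a + b - bd (n + 1) x \<in> D n"
    using assms(3) by (auto simp: X.Bc_def)
  have "bd (n + 1) x - a - b \<in> D n" using D_closed(3)[OF x(2)] by (simp add: algebra_simps)
  then obtain y xa xb where y: "y \<in> Q (n + 1 + 1)" "xa \<in> QA (n + 1)" "xb \<in> QB (n + 1)"
      "x - bd (n + 1 + 1) y - xa - xb \<in> D (n + 1)"
    using small_chains[of x "n + 1" a b] ab x by auto
  have "bd (n + 1) x - bd (n + 1) xa - bd (n + 1) xb \<in> D n"
    using bd_D'[OF y(4)] bd_bd'[OF y(1)] by (simp add: X.bd_diff)
  from D_closed(4)[OF x(2) this]
  have s: "(a - bd (n + 1) xa) + (b - bd (n + 1) xb) \<in> D n" by (simp add: algebra_simps)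
  have sA: "a - bd (n + 1) xa \<in> QA n" and sB: "b - bd (n + 1) xb \<in> QB n"
    using ab y bd_Q' QA_closed QB_closed by auto
  obtain c where c: "c \<in> QAB n" "c - (a - bd (n + 1) xa) \<in> D n" "c + (b - bd (n + 1) xb) \<in> D n"
    using split_Int[OF sA sB s] by blast
  have "bd n (c - (a - bd (n + 1) xa)) = bd n c - bd n a"
    using y(2) QA by (auto simp: X.bd_diff bd_bd' subset_iff)
  then have "bd n c - bd n a \<in> D (n - 1)" using X.bd_D[OF c(2)] by simp
  then have "bd n c \<in> D (n - 1)" using D_closed(4)[OF _ ab(3)] by fastforce
  then have cZ: "c \<in> AB.Zc n" using c AB.bd_Q by (auto simp: AB.Zc_def DAB)
  have "(c - a) - bd (n + 1) (- xa) \<in> DA n"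
    using c QA_closed(2)[OF _ sA, of c] by (simp add: DA QAB bd_minus algebra_simps)
  then have A: "c - a \<in> A.Bc n" using y QA_closed by (auto simp: A.Bc_def)
  have "- (c + (b - bd (n + 1) xb)) \<in> DB n"
    using c sB QB_closed D_closed by (auto simp: DB QAB simp del: minus_add_distrib)
  then have "(- c - b) - bd (n + 1) (- xb) \<in> DB n"
    by (simp add: bd_minus algebra_simps)
  then have B: "- c - b \<in> B.Bc n" using y QB_closed by (auto simp: B.Bc_def)
  show thesis using that cZ A B by blast
qed

text \<open>The cycles \<open>a\<close> and \<open>b\<close> are themselves the decomposition, and
  their boundaries vanish modulo degenerate chains.\<close>

lemma conn_sum:
  assumes "a \<in> A.Zc n" "b \<in> B.Zc n"
  shows "conn n (a + b) 0"
proof -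
  have ab: "a \<in> QA n" "b \<in> QB n" "bd n a \<in> D (n - 1)" "bd n b \<in> D (n - 1)"
    using assms by (auto simp: A.Zc_def B.Zc_def DA DB)
  show ?thesis
    unfolding conn_def
  proof (intro conjI bexI)
    show "0 \<in> AB.Zc (n - 1)" using add_subgroup_closed(1)[OF AB.Zc_subgroup] .
    show "a + b - bd (n + 1) 0 - a - b \<in> D n" using D_closed(1) X.bd_0 by simp
  qed (use ab D_closed Q_closed in auto)
qed

text \<open>If \<open>u\<close> in the intersection bounds \<open>w\<close> modulo degenerate
  chains, then \<open>a - u\<close> and \<open>b + u\<close> are cycles with the same sum as
  \<open>a\<close> and \<open>b\<close>.\<close>

lemma exact_X:
  assumes z: "z \<in> X.Zc n" and "conn n z w" "w \<in> AB.Bc (n - 1)"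
  obtains a b where "a \<in> A.Zc n" "b \<in> B.Zc n" "z - (a + b) \<in> X.Bc n"
proof -
  obtain a b d where 1: "a \<in> QA n" "b \<in> QB n" "d \<in> Q (n + 1)"
    "z - bd (n + 1) d - a - b \<in> D n" "w - bd n a \<in> D (n - 1)" "w + bd n b \<in> D (n - 1)"
    using assms(2) by (auto simp: conn_def)
  obtain u where u: "u \<in> QA n" "u \<in> QB n" "w - bd n u \<in> D (n - 1)"
    using assms(3) by (auto simp: AB.Bc_def DAB QAB)
  have "bd n (a - u) \<in> D (n - 1)"
    using D_closed(2)[OF u(3) 1(5)] by (simp add: X.bd_diff)
  then have A: "a - u \<in> A.Zc n" using 1 u QA_closed A.bd_Q by (auto simp: A.Zc_def DA)
  have "bd n (b + u) \<in> D (n - 1)"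
    using D_closed(2)[OF 1(6) u(3)] by (simp add: bd_add algebra_simps)
  then have B: "b + u \<in> B.Zc n" using 1 u QB_closed B.bd_Q by (auto simp: B.Zc_def DB)
  have "z - ((a - u) + (b + u)) - bd (n + 1) d \<in> D n" using 1(4) by (simp add: algebra_simps)
  then have "z - ((a - u) + (b + u)) \<in> X.Bc n" using 1(3) by (auto simp: X.Bc_def)
  then show thesis using that A B by blast
qed

text \<open>Modulo degenerate chains, the summand \<open>a\<close> of the decomposition bounds
  \<open>w\<close> in \<open>A\<close>, and the summand \<open>b\<close> bounds \<open>- w\<close>
  in \<open>B\<close>.\<close>

lemma conn_imp_boundary:
  assumes "conn n z w"
  shows "w \<in> A.Bc (n - 1)" "- w \<in> B.Bc (n - 1)"
proof -
  obtain a b where 1: "a \<in> QA n" "b \<in> QB n" "w - bd n a \<in> D (n - 1)" "w + bd n b \<in> D (n - 1)"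
    and w: "w \<in> QAB (n - 1)"
    using assms by (auto simp: conn_def AB.Zc_def)
  have "w - bd n a \<in> DA (n - 1)" using 1 w A.bd_Q QA_closed by (auto simp: DA QAB)
  then show "w \<in> A.Bc (n - 1)" using 1 by (auto simp: A.Bc_def)
  have "- (w + bd n b) \<in> DB (n - 1)" using 1 w B.bd_Q QB_closed D_closed by (auto simp: DB QAB simp del: minus_add_distrib)
  then have "- w - bd n b \<in> DB (n - 1)" by simp
  then show "- w \<in> B.Bc (n - 1)" using 1 by (auto simp: B.Bc_def)
qed

text \<open>Chains bounding \<open>w\<close> in \<open>A\<close> and \<open>- w\<close> in
  \<open>B\<close> add up to a cycle of \<open>X\<close>, and they are its decomposition.\<close>

lemma exact_AB:
  assumes "w \<in> AB.Zc (n - 1)" "w \<in> A.Bc (n - 1)" "- w \<in> B.Bc (n - 1)"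
  obtains z where "z \<in> X.Zc n" "conn n z w"
proof -
  obtain a where a: "a \<in> QA n" "w - bd n a \<in> D (n - 1)"
    using assms(2) by (auto simp: A.Bc_def DA)
  obtain b where b: "b \<in> QB n" "- w - bd n b \<in> D (n - 1)"
    using assms(3) by (auto simp: B.Bc_def DB)
  have b': "w + bd n b \<in> D (n - 1)" using D_closed(3)[OF b(2)] by (simp add: add.commute)
  have "bd n (a + b) \<in> D (n - 1)"
    using D_closed(2)[OF b' a(2)] by (simp add: bd_add algebra_simps)
  then have "a + b \<in> X.Zc n" using a b QA QB Q_closed(4)[of a n b] by (auto simp: X.Zc_def)
  moreover have "conn n (a + b) w"
    unfolding conn_def
  proof (intro conjI bexI)
    show "a + b - bd (n + 1) 0 - a - b \<in> D n" using D_closed(1) X.bd_0 by simp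
  qed (use a b b' assms(1) Q_closed(1) in auto)
  ultimately show thesis using that by blast
qed


section \<open>The connecting homomorphism on homology classes\<close>

definition delta :: "int \<Rightarrow> 'c set \<Rightarrow> 'c set" where
  "delta n h = AB.hcls (n - 1) (SOME w. \<exists>z\<in>X.Zc n. X.hcls n z = h \<and> conn n z w)"

lemmas hX = X.presents_homology and hA = A.presents_homology
  and hB = B.presents_homology and hAB = AB.presents_homology

lemma conn_Zc: "conn n z w \<Longrightarrow> w \<in> AB.Zc (n - 1)"
  by (simp add: conn_def)

text \<open>The choice in \<open>delta\<close> picks some cycle of the class together with some
  related \<open>w\<close>; by \<open>conn_diff\<close> and \<open>conn_boundary\<close> another
  such pair changes \<open>w\<close> only by a boundary.\<close>

lemma delta_eq:
  assumes "z \<in> X.Zc n" "conn n z w"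
  shows "delta n (X.hcls n z) = AB.hcls (n - 1) w"
proof -
  let ?P = "\<lambda>w'. \<exists>z'\<in>X.Zc n. X.hcls n z' = X.hcls n z \<and> conn n z' w'"
  have "?P (SOME w. ?P w)" by (rule someI[of ?P w]) (use assms in blast)
  then obtain z' where z': "z' \<in> X.Zc n" "X.hcls n z' = X.hcls n z" "conn n z' (SOME w. ?P w)"
    by blast
  have "z' - z \<in> X.Bc n" using z' assms(1) presents_eq_iff[OF hX] by blast
  then have "(SOME w. ?P w) - w \<in> AB.Bc (n - 1)"
    using conn_boundary conn_diff[OF z'(3) assms(2)] by blast
  then show ?thesis
    unfolding delta_def using presents_eq_iff[OF hAB] conn_Zc z'(3) assms(2) by blast
qed

lemma group_hom_delta: "group_hom (homology CX n) (homology CAB (n - 1)) (delta n)"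
proof (intro group_hom.intro group_hom_axioms.intro homI presents_group(1)[OF hX] presents_group(1)[OF hAB])
  fix x y assume "x \<in> carrier (homology CX n)" "y \<in> carrier (homology CX n)"
  then obtain u v where u: "u \<in> X.Zc n" "x = X.hcls n u" and v: "v \<in> X.Zc n" "y = X.hcls n v"
    by (auto simp: presents_carrier[OF hX])
  obtain r s where r: "conn n u r" and s: "conn n v s" using conn_ex u v by metis
  show "delta n x \<in> carrier (homology CAB (n - 1))"
    using delta_eq[OF u(1) r] u(2) presents_mem[OF hAB conn_Zc[OF r]] by simp
  have "delta n (X.hcls n (u + v)) = AB.hcls (n - 1) (r + s)"
    using delta_eq conn_add[OF r s] add_subgroup_closed(4)[OF X.Zc_subgroup u(1) v(1)] by blast
  then show "delta n (x \<otimes>\<^bsub>homology CX n\<^esub> y) = delta n x \<otimes>\<^bsub>homology CAB (n - 1)\<^esub> delta n y"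
    using u v delta_eq[OF u(1) r] delta_eq[OF v(1) s] presents_add[OF hX u(1) v(1)]
      presents_add[OF hAB conn_Zc[OF r] conn_Zc[OF s]] by simp
qed

section \<open>Exactness at the three kinds of groups\<close>

context
  fixes iA iB jA jB :: "int \<Rightarrow> 'c set \<Rightarrow> 'c set"
  assumes iA: "\<And>n x. x \<in> AB.Zc n \<Longrightarrow> iA n (AB.hcls n x) = A.hcls n x"
    and iB: "\<And>n x. x \<in> AB.Zc n \<Longrightarrow> iB n (AB.hcls n x) = B.hcls n x"
    and jA: "\<And>n x. x \<in> A.Zc n \<Longrightarrow> jA n (A.hcls n x) = X.hcls n x"
    and jB: "\<And>n x. x \<in> B.Zc n \<Longrightarrow> jB n (B.hcls n x) = X.hcls n x"
begin

abbreviation "phi n z \<equiv> (iA n z, inv\<^bsub>homology CB n\<^esub> (iB n z))"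
abbreviation "psi n uv \<equiv> (case uv of (u, v) \<Rightarrow> jA n u \<otimes>\<^bsub>homology CX n\<^esub> jB n v)"

lemma phi_eq: "x \<in> AB.Zc n \<Longrightarrow> phi n (AB.hcls n x) = (A.hcls n x, B.hcls n (- x))"
  using iA iB subsetD[OF Zc_sub(2)] presents_minus[OF hB] by simp

lemma psi_eq:
  "a \<in> A.Zc n \<Longrightarrow> b \<in> B.Zc n \<Longrightarrow> psi n (A.hcls n a, B.hcls n b) = X.hcls n (a + b)"
  using jA jB Zc_sub(3,4) presents_add[OF hX] by (auto simp: subset_iff)

lemma group_hom_phi:
  "group_hom (homology CAB n) (homology CA n \<times>\<times> homology CB n) (phi n)"
proof (intro group_hom.intro group_hom_axioms.intro homI DirProd_group
    presents_group(1)[OF hA] presents_group(1)[OF hB] presents_group(1)[OF hAB])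
  fix x y assume "x \<in> carrier (homology CAB n)" "y \<in> carrier (homology CAB n)"
  then obtain u v where u: "u \<in> AB.Zc n" "x = AB.hcls n u" and v: "v \<in> AB.Zc n" "y = AB.hcls n v"
    by (auto simp: presents_carrier[OF hAB])
  have A: "u \<in> A.Zc n" "v \<in> A.Zc n" and B: "- u \<in> B.Zc n" "- v \<in> B.Zc n"
    using u v Zc_sub add_subgroup_closed(3)[OF B.Zc_subgroup] by (auto simp: subset_iff)
  show "phi n x \<in> carrier (homology CA n \<times>\<times> homology CB n)"
    unfolding u(2) phi_eq[OF u(1)] using A B presents_mem[OF hA] presents_mem[OF hB] by simp
  have uv: "u + v \<in> AB.Zc n" using add_subgroup_closed(4)[OF AB.Zc_subgroup u(1) v(1)] .
  have "B.hcls n (- (u + v)) = B.hcls n (- u + - v)" by simp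
  then show "phi n (x \<otimes>\<^bsub>homology CAB n\<^esub> y) = phi n x \<otimes>\<^bsub>homology CA n \<times>\<times> homology CB n\<^esub> phi n y"
    unfolding u(2) v(2) presents_add[OF hAB u(1) v(1), symmetric] phi_eq[OF u(1)] phi_eq[OF v(1)] phi_eq[OF uv]
    by (simp only: mult_DirProd presents_add[OF hA A] presents_add[OF hB B])
qed

lemma group_hom_psi:
  "group_hom (homology CA n \<times>\<times> homology CB n) (homology CX n) (psi n)"
proof (intro group_hom.intro group_hom_axioms.intro homI DirProd_group
    presents_group(1)[OF hA] presents_group(1)[OF hB] presents_group(1)[OF hX])
  fix x y
  assume "x \<in> carrier (homology CA n \<times>\<times> homology CB n)" "y \<in> carrier (homology CA n \<times>\<times> homology CB n)"
  then obtain a b c d where ab: "a \<in> A.Zc n" "b \<in> B.Zc n" "x = (A.hcls n a, B.hcls n b)"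
    and cd: "c \<in> A.Zc n" "d \<in> B.Zc n" "y = (A.hcls n c, B.hcls n d)"
    by (auto simp: presents_carrier[OF hA] presents_carrier[OF hB])
  have X: "a + b \<in> X.Zc n" "c + d \<in> X.Zc n"
    using ab cd Zc_sub add_subgroup_closed(4)[OF X.Zc_subgroup] by (auto simp: subset_iff)
  have ac: "a + c \<in> A.Zc n" and bd: "b + d \<in> B.Zc n"
    using ab cd add_subgroup_closed(4)[OF A.Zc_subgroup] add_subgroup_closed(4)[OF B.Zc_subgroup] by auto
  show "psi n x \<in> carrier (homology CX n)"
    unfolding ab(3) psi_eq[OF ab(1,2)] using X presents_mem[OF hX] by simp
  have "(a + c) + (b + d) = (a + b) + (c + d)" by (simp add: algebra_simps)
  then show "psi n (x \<otimes>\<^bsub>homology CA n \<times>\<times> homology CB n\<^esub> y) = psi n x \<otimes>\<^bsub>homology CX n\<^esub> psi n y"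
    unfolding ab(3) cd(3) mult_DirProd presents_add[OF hA ab(1) cd(1), symmetric]
      presents_add[OF hB ab(2) cd(2), symmetric] psi_eq[OF ab(1,2)] psi_eq[OF cd(1,2)] psi_eq[OF ac bd]
    by (simp only: presents_add[OF hX X])
qed

lemma exact_phi_psi:
  "exact_at (homology CAB n) (phi n) (homology CA n \<times>\<times> homology CB n) (psi n) (homology CX n)"
proof -
  have "phi n ` AB.hcls n ` AB.Zc n = kernel (homology CA n \<times>\<times> homology CB n) (homology CX n) (psi n)"
  proof (intro equalityI subsetI)
    fix h assume "h \<in> phi n ` AB.hcls n ` AB.Zc n"
    then obtain x where x: "x \<in> AB.Zc n" "h = (A.hcls n x, B.hcls n (- x))" using phi_eq by auto
    have xAB: "x \<in> A.Zc n" "- x \<in> B.Zc n"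
      using x Zc_sub add_subgroup_closed(3)[OF B.Zc_subgroup] by (auto simp: subset_iff)
    show "h \<in> kernel (homology CA n \<times>\<times> homology CB n) (homology CX n) (psi n)"
      unfolding kernel_def x(2)
      using xAB psi_eq[OF xAB] presents_zero[OF hX] presents_mem[OF hA] presents_mem[OF hB] by simp
  next
    fix h assume h: "h \<in> kernel (homology CA n \<times>\<times> homology CB n) (homology CX n) (psi n)"
    then obtain a b where ab: "a \<in> A.Zc n" "b \<in> B.Zc n" "h = (A.hcls n a, B.hcls n b)"
      by (auto simp: kernel_def presents_carrier[OF hA] presents_carrier[OF hB])
    have "a + b \<in> X.Zc n"
      using ab Zc_sub add_subgroup_closed(4)[OF X.Zc_subgroup] by (auto simp: subset_iff)
    moreover have "X.hcls n (a + b) = \<one>\<^bsub>homology CX n\<^esub>"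
      using h psi_eq[OF ab(1,2)] by (simp add: kernel_def ab(3))
    ultimately have "a + b \<in> X.Bc n" using presents_eq_one_iff[OF hX] by simp
    then obtain c where c: "c \<in> AB.Zc n" "c - a \<in> A.Bc n" "- c - b \<in> B.Bc n"
      using exact_pair ab by blast
    have cAB: "c \<in> A.Zc n" "- c \<in> B.Zc n"
      using c Zc_sub add_subgroup_closed(3)[OF B.Zc_subgroup] by (auto simp: subset_iff)
    have "h = phi n (AB.hcls n c)"
      unfolding phi_eq[OF c(1)] ab(3)
      using presents_eq_iff[OF hA cAB(1) ab(1)] presents_eq_iff[OF hB cAB(2) ab(2)] c by simp
    then show "h \<in> phi n ` AB.hcls n ` AB.Zc n" using c(1) by blast
  qed
  then show ?thesis
    using group_hom_phi group_hom_psi by (simp add: exact_at_def presents_carrier[OF hAB])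
qed

lemma exact_psi_delta:
  "exact_at (homology CA n \<times>\<times> homology CB n) (psi n) (homology CX n) (delta n) (homology CAB (n - 1))"
proof -
  have "psi n ` (A.hcls n ` A.Zc n \<times> B.hcls n ` B.Zc n) = kernel (homology CX n) (homology CAB (n - 1)) (delta n)"
  proof (intro equalityI subsetI)
    fix h assume "h \<in> psi n ` (A.hcls n ` A.Zc n \<times> B.hcls n ` B.Zc n)"
    then obtain a b where ab: "a \<in> A.Zc n" "b \<in> B.Zc n" "h = X.hcls n (a + b)" using psi_eq by auto
    have "a + b \<in> X.Zc n"
      using ab Zc_sub add_subgroup_closed(4)[OF X.Zc_subgroup] by (auto simp: subset_iff)
    then show "h \<in> kernel (homology CX n) (homology CAB (n - 1)) (delta n)"
      using ab delta_eq[OF _ conn_sum[OF ab(1,2)]] presents_zero[OF hAB] presents_mem[OF hX]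
      by (simp add: kernel_def)
  next
    fix h assume h: "h \<in> kernel (homology CX n) (homology CAB (n - 1)) (delta n)"
    then obtain z where z: "z \<in> X.Zc n" "h = X.hcls n z"
      by (auto simp: kernel_def presents_carrier[OF hX])
    obtain w where w: "conn n z w" using conn_ex z by blast
    have "AB.hcls (n - 1) w = \<one>\<^bsub>homology CAB (n - 1)\<^esub>"
      using h delta_eq[OF z(1) w] z(2) by (simp add: kernel_def)
    then have "w \<in> AB.Bc (n - 1)" using presents_eq_one_iff[OF hAB conn_Zc[OF w]] by simp
    then obtain a b where ab: "a \<in> A.Zc n" "b \<in> B.Zc n" "z - (a + b) \<in> X.Bc n"
      using exact_X z(1) w by blast
    have "a + b \<in> X.Zc n"
      using ab Zc_sub add_subgroup_closed(4)[OF X.Zc_subgroup] by (auto simp: subset_iff)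
    then have "h = psi n (A.hcls n a, B.hcls n b)"
      using psi_eq[OF ab(1,2)] presents_eq_iff[OF hX z(1)] ab(3) z(2) by simp
    then show "h \<in> psi n ` (A.hcls n ` A.Zc n \<times> B.hcls n ` B.Zc n)" using ab by blast
  qed
  then show ?thesis
    using group_hom_psi group_hom_delta
    by (simp add: exact_at_def presents_carrier[OF hA] presents_carrier[OF hB])
qed

lemma exact_delta_phi:
  "exact_at (homology CX n) (delta n) (homology CAB (n - 1)) (phi (n - 1))
     (homology CA (n - 1) \<times>\<times> homology CB (n - 1))"
proof -
  have ker: "x \<in> AB.Zc m \<Longrightarrow> phi m (AB.hcls m x) = \<one>\<^bsub>homology CA m \<times>\<times> homology CB m\<^esub> \<longleftrightarrow>
      x \<in> A.Bc m \<and> - x \<in> B.Bc m" for x m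
    unfolding phi_eq
    using presents_eq_one_iff[OF hA] presents_eq_one_iff[OF hB] Zc_sub
      add_subgroup_closed(3)[OF B.Zc_subgroup] by (auto simp: subset_iff)
  have "delta n ` X.hcls n ` X.Zc n =
      kernel (homology CAB (n - 1)) (homology CA (n - 1) \<times>\<times> homology CB (n - 1)) (phi (n - 1))"
  proof (intro equalityI subsetI)
    fix h assume "h \<in> delta n ` X.hcls n ` X.Zc n"
    then obtain z where z: "z \<in> X.Zc n" "h = delta n (X.hcls n z)" by blast
    obtain w where w: "conn n z w" using conn_ex z by blast
    then show "h \<in> kernel (homology CAB (n - 1)) (homology CA (n - 1) \<times>\<times> homology CB (n - 1)) (phi (n - 1))"
      unfolding z(2) delta_eq[OF z(1) w] kernel_def
      using ker[OF conn_Zc[OF w]] conn_imp_boundary[OF w] presents_mem[OF hAB conn_Zc[OF w]] by simp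
  next
    fix h assume h: "h \<in> kernel (homology CAB (n - 1)) (homology CA (n - 1) \<times>\<times> homology CB (n - 1)) (phi (n - 1))"
    then obtain w where w: "w \<in> AB.Zc (n - 1)" "h = AB.hcls (n - 1) w"
      by (auto simp: kernel_def presents_carrier[OF hAB])
    then have "w \<in> A.Bc (n - 1) \<and> - w \<in> B.Bc (n - 1)" using h ker[OF w(1)] by (simp add: kernel_def)
    then obtain z where "z \<in> X.Zc n" "conn n z w" using exact_AB w(1) by blast
    then show "h \<in> delta n ` X.hcls n ` X.Zc n" using delta_eq w(2) by (metis imageI)
  qed
  then show ?thesis
    using group_hom_delta group_hom_phi by (simp add: exact_at_def presents_carrier[OF hX])
qed

end

end


section \<open>Free chains modulo degenerate ones\<close>

abbreviation free_chains :: "'s set \<Rightarrow> ('s \<Rightarrow>\<^sub>0 int) set" where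
  "free_chains S \<equiv> {c. Poly_Mapping.keys c \<subseteq> S}"

lemma free_chains_subgroup: "add_subgroup (free_chains S)"
  using keys_diff by (fastforce simp: add_subgroup_def)

lemmas free_chains_closed = add_subgroup_closed[OF free_chains_subgroup, simplified]

lemma free_chains_cmul: "c \<in> free_chains S \<Longrightarrow> frag_cmul a c \<in> free_chains S"
  using keys_cmul[of a c] by blast

lemma free_chains_extend:
  assumes "c \<in> free_chains S" "\<And>s. s \<in> S \<Longrightarrow> b s \<in> free_chains S'"
  shows "frag_extend b c \<in> free_chains S'"
  using assms keys_frag_extend[of b c] by blast

lemma free_chains_split:
  assumes "c \<in> free_chains (S \<union> S')"
  obtains d e where "d \<in> free_chains S" "e \<in> free_chains S'" "c = d + e"
proof -
  have "Poly_Mapping.keys c \<subseteq> S \<union> S'" using assms by simp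
  then obtain d e where "Poly_Mapping.keys d \<subseteq> S" "Poly_Mapping.keys e \<subseteq> S'" "d + e = c"
    by (rule frag_split)
  then show thesis using that[of d e] by simp
qed

lemma presents_free_Abelian_group:
  "presents (free_Abelian_group S) (free_chains S) (free_chains {}) (\<lambda>c. c)"
  using abelian_free_Abelian_group[of S] free_chains_subgroup[of S]
  by (simp add: presents_def) (simp add: free_Abelian_group_def)

text \<open>This turns the subgroup \<open>cube_D\<close>, generated by degenerate cubes, into the
  chains supported on degenerate cubes.\<close>

lemma generate_frag_of:
  assumes "T \<subseteq> S"
  shows "generate (free_Abelian_group S) (frag_of ` T) = free_chains T"
proof
  interpret group "free_Abelian_group S" by simp
  have "subgroup ((\<lambda>c. c) ` free_chains T) (free_Abelian_group S)"
    by (rule presents_subgroup_image[OF presents_free_Abelian_group free_chains_subgroup])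
      (use assms in auto)
  then have "subgroup (free_chains T) (free_Abelian_group S)" by (simp only: image_ident)
  then show "generate (free_Abelian_group S) (frag_of ` T) \<subseteq> free_chains T"
    by (rule generate_subgroup_incl[rotated]) auto
  have "frag_of ` T \<subseteq> carrier (free_Abelian_group S)" using assms by auto
  then have sub: "subgroup (generate (free_Abelian_group S) (frag_of ` T)) (free_Abelian_group S)"
    by (rule generate_is_subgroup)
  have "c \<in> generate (free_Abelian_group S) (frag_of ` T)" if "Poly_Mapping.keys c \<subseteq> T" for c
    using that
  proof (induction c rule: frag_induction)
    case zero
    show ?case using subgroup.one_closed[OF sub] by simp
  next
    case (one x)
    then show ?case by (intro generate.incl imageI)
  next
    case (diff x y)
    have "Poly_Mapping.keys y \<subseteq> S"
      using subgroup.mem_carrier[OF sub diff(2)] by (simp only: carrier_free_Abelian_group_iff)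
    then have "x - y = x \<otimes>\<^bsub>free_Abelian_group S\<^esub> inv\<^bsub>free_Abelian_group S\<^esub> y" by simp
    then show ?case
      using subgroup.m_closed[OF sub diff(1) subgroup.m_inv_closed[OF sub diff(2)]] by (simp only:)
  qed
  then show "free_chains T \<subseteq> generate (free_Abelian_group S) (frag_of ` T)" by blast
qed

lemma presents_free_Mod:
  assumes "T \<subseteq> S"
  shows "presents (free_Abelian_group S Mod free_chains T) (free_chains S) (free_chains T)
           (\<lambda>c. free_chains T #>\<^bsub>free_Abelian_group S\<^esub> c)"
proof -
  have "free_chains T \<subseteq> free_chains S" using assms by auto
  from presents_Mod[OF presents_free_Abelian_group free_chains_subgroup this]
  have "presents (free_Abelian_group S Mod free_chains T) (free_chains S)
      {x \<in> free_chains S. \<exists>m\<in>free_chains T. x - m \<in> free_chains {}}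
      (\<lambda>c. free_chains T #>\<^bsub>free_Abelian_group S\<^esub> c)" by (simp only: image_ident)
  then show ?thesis
  proof (rule presents_cong)
    have "(\<exists>m\<in>free_chains T. x - m \<in> free_chains {}) \<longleftrightarrow> x \<in> free_chains T" for x
      by simp
    then show "{x \<in> free_chains S. \<exists>m\<in>free_chains T. x - m \<in> free_chains {}} \<inter> free_chains S =
        free_chains T \<inter> free_chains S" by blast
  qed simp
qed

text \<open>\<open>S Y n\<close> is the set of singular \<open>n\<close>-simplices or \<open>n\<close>-cubes in \<open>Y\<close>, with model \<open>M n\<close>, and
  \<open>T Y n\<close> the set of degenerate ones.\<close>

locale singular_theory =
  fixes S T :: "'a cspace \<Rightarrow> int \<Rightarrow> ('m \<Rightarrow> 'a) set" and M :: "int \<Rightarrow> 'm set"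
    and b :: "int \<Rightarrow> ('m \<Rightarrow> 'a) \<Rightarrow> ('m \<Rightarrow> 'a) \<Rightarrow>\<^sub>0 int"
    and C :: "'a cspace \<Rightarrow> 'c chain_cplx" and inc :: "'a cspace \<Rightarrow> int \<Rightarrow> 'c \<Rightarrow> 'c"
    and p :: "'a cspace \<Rightarrow> int \<Rightarrow> (('m \<Rightarrow> 'a) \<Rightarrow>\<^sub>0 int) \<Rightarrow> 'c"
  assumes S_sub: "\<And>X U n. \<lbrakk>closure_space X; U \<subseteq> points X\<rbrakk> \<Longrightarrow>
      S (csubspace X U) n = {\<sigma> \<in> S X n. \<sigma> ` M n \<subseteq> U}"
    and T_sub: "\<And>X U n. \<lbrakk>closure_space X; U \<subseteq> points X\<rbrakk> \<Longrightarrow>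
      T (csubspace X U) n = T X n \<inter> S (csubspace X U) n"
    and T_S: "\<And>Y n. closure_space Y \<Longrightarrow> T Y n \<subseteq> S Y n"
    and b_S: "\<And>Y n \<sigma>. \<lbrakk>closure_space Y; \<sigma> \<in> S Y n\<rbrakk> \<Longrightarrow> b n \<sigma> \<in> free_chains (S Y (n - 1))"
    and b_T: "\<And>Y n \<sigma>. \<lbrakk>closure_space Y; \<sigma> \<in> T Y n\<rbrakk> \<Longrightarrow> b n \<sigma> \<in> free_chains (T Y (n - 1))"
    and b_b: "\<And>Y n \<sigma>. \<lbrakk>closure_space Y; \<sigma> \<in> S Y n\<rbrakk> \<Longrightarrow> frag_extend (b (n - 1)) (b n \<sigma>) = 0"
    and chains: "\<And>Y n. closure_space Y \<Longrightarrow>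
      presents (chains (C Y) n) (free_chains (S Y n)) (free_chains (T Y n)) (p Y n)"
    and bdry: "\<And>Y n c. \<lbrakk>closure_space Y; c \<in> free_chains (S Y n)\<rbrakk> \<Longrightarrow>
      bdry (C Y) n (p Y n c) = p Y (n - 1) (frag_extend (b n) c)"
    and inc: "\<And>Y Z n c. \<lbrakk>closure_space Y; closure_space Z; S Z n \<subseteq> S Y n; T Z n \<subseteq> T Y n;
      c \<in> free_chains (S Z n)\<rbrakk> \<Longrightarrow> inc Y n (p Z n c) = p Y n c"
begin

abbreviation bd :: "int \<Rightarrow> (('m \<Rightarrow> 'a) \<Rightarrow>\<^sub>0 int) \<Rightarrow> (('m \<Rightarrow> 'a) \<Rightarrow>\<^sub>0 int)" where
  "bd n \<equiv> frag_extend (b n)"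

lemma bd_bd: "\<lbrakk>closure_space Y; c \<in> free_chains (S Y n)\<rbrakk> \<Longrightarrow> bd (n - 1) (bd n c) = 0"
  by (simp, erule frag_induction) (auto simp: b_b frag_extend_diff)

lemma presented_complex:
  assumes Y: "closure_space Y"
  shows "presented_complex (C Y) (\<lambda>n. free_chains (S Y n)) (\<lambda>n. free_chains (T Y n)) bd (p Y)"
proof
  show "free_chains (T Y n) \<subseteq> free_chains (S Y n)" for n
    using T_S[OF Y, of n] by auto
  show "bd n x \<in> free_chains (S Y (n - 1))" if "x \<in> free_chains (S Y n)" for n x
    using that b_S[OF Y] by (rule free_chains_extend)
  show "bd n x \<in> free_chains (T Y (n - 1))" if "x \<in> free_chains (T Y n)" for n x
    using that b_T[OF Y] by (rule free_chains_extend)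
qed (simp_all add: chains[OF Y] bdry[OF Y] frag_extend_diff bd_bd[OF Y] del: mem_Collect_eq)

context
  fixes X :: "'a cspace" and A B :: "'a set"
  assumes X: "closure_space X" and A: "A \<subseteq> points X" and B: "B \<subseteq> points X"
begin

definition small :: "int \<Rightarrow> ('m \<Rightarrow> 'a) set" where
  "small n = S (csubspace X A) n \<union> S (csubspace X B) n \<union> T X n"

lemma small_split:
  assumes "c \<in> free_chains (small n)"
  obtains a a' e where "a \<in> free_chains (S (csubspace X A) n)" "a' \<in> free_chains (S (csubspace X B) n)"
    "e \<in> free_chains (T X n)" "c = a + a' + e"
proof -
  obtain d e where d: "d \<in> free_chains (S (csubspace X A) n \<union> S (csubspace X B) n)"
    and e: "e \<in> free_chains (T X n)" "c = d + e"
    using assms unfolding small_def by (rule free_chains_split)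
  obtain a a' where "a \<in> free_chains (S (csubspace X A) n)" "a' \<in> free_chains (S (csubspace X B) n)"
    "d = a + a'" using d by (rule free_chains_split)
  then show thesis using that e by blast
qed

lemma small_intros:
  "a \<in> free_chains (S (csubspace X A) n) \<Longrightarrow> a \<in> free_chains (small n)"
  "a \<in> free_chains (S (csubspace X B) n) \<Longrightarrow> a \<in> free_chains (small n)"
  "a \<in> free_chains (T X n) \<Longrightarrow> a \<in> free_chains (small n)"
  by (auto simp: small_def)

lemma mayer_vietoris_small:
  assumes small: "\<And>n c. \<lbrakk>c \<in> free_chains (S X n); bd n c \<in> free_chains (small (n - 1))\<rbrakk> \<Longrightarrow>
    \<exists>d \<in> free_chains (S X (n + 1)). c - bd (n + 1) d \<in> free_chains (small n)"
  shows "mayer_vietoris C inc X A B"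
proof -
  let ?A = "csubspace X A" and ?B = "csubspace X B" and ?AB = "csubspace X (A \<inter> B)"
  have AB: "A \<inter> B \<subseteq> points X" using A by blast
  note cs = closure_space_csubspace[OF X A] closure_space_csubspace[OF X B] closure_space_csubspace[OF X AB]
  note SS = S_sub[OF X A] S_sub[OF X B] S_sub[OF X AB]
  note TT = T_sub[OF X A] T_sub[OF X B] T_sub[OF X AB]
  interpret pX: presented_complex "C X" "\<lambda>n. free_chains (S X n)" "\<lambda>n. free_chains (T X n)" bd "p X"
    by (rule presented_complex[OF X])
  interpret pA: presented_complex "C ?A" "\<lambda>n. free_chains (S ?A n)" "\<lambda>n. free_chains (T ?A n)" bd "p ?A"
    by (rule presented_complex[OF cs(1)])
  interpret pB: presented_complex "C ?B" "\<lambda>n. free_chains (S ?B n)" "\<lambda>n. free_chains (T ?B n)" bd "p ?B"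
    by (rule presented_complex[OF cs(2)])
  interpret pAB: presented_complex "C ?AB" "\<lambda>n. free_chains (S ?AB n)" "\<lambda>n. free_chains (T ?AB n)" bd "p ?AB"
    by (rule presented_complex[OF cs(3)])
  interpret MV: mayer_vietoris_pair "C X" "C ?A" "C ?B" "C ?AB"
    "\<lambda>n. free_chains (S X n)" "\<lambda>n. free_chains (S ?A n)" "\<lambda>n. free_chains (S ?B n)" "\<lambda>n. free_chains (S ?AB n)"
    "\<lambda>n. free_chains (T X n)" "\<lambda>n. free_chains (T ?A n)" "\<lambda>n. free_chains (T ?B n)" "\<lambda>n. free_chains (T ?AB n)"
    bd "p X" "p ?A" "p ?B" "p ?AB"
  proof (intro mayer_vietoris_pair.intro mayer_vietoris_pair_axioms.intro presented_complex X cs)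
    fix n a a' assume a: "a \<in> free_chains (S ?A n)" "a' \<in> free_chains (S ?B n)" "a + a' \<in> free_chains (T X n)"
    \<comment> \<open>A generator occurring in the sum is degenerate in \<open>X\<close> and lies in
      \<open>A\<close> or in \<open>B\<close>, hence is degenerate there. So the sum can be split by
      its support, whatever cancels between \<open>a\<close> and \<open>a'\<close>.\<close>
    have "Poly_Mapping.keys (a + a') \<subseteq> S ?A n \<union> S ?B n" using a keys_add[of a a'] by auto
    then have "a + a' \<in> free_chains (T ?A n \<union> T ?B n)" using a(3) by (auto simp: TT)
    then show "\<exists>u\<in>free_chains (T ?A n). \<exists>v\<in>free_chains (T ?B n). a + a' = u + v"
      by (rule free_chains_split) blast
  next
    fix n c a a'
    assume c: "c \<in> free_chains (S X n)" and a: "a \<in> free_chains (S ?A (n - 1))"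
      "a' \<in> free_chains (S ?B (n - 1))" "bd n c - a - a' \<in> free_chains (T X (n - 1))"
    have "bd n c = (bd n c - a - a') + a + a'" by simp
    also have "\<dots> \<in> free_chains (small (n - 1))"
      by (intro add_subgroup_closed(4)[OF free_chains_subgroup]
          small_intros(1)[OF a(1)] small_intros(2)[OF a(2)] small_intros(3)[OF a(3)])
    finally obtain d where d: "d \<in> free_chains (S X (n + 1))" "c - bd (n + 1) d \<in> free_chains (small n)"
      using small[OF c] by blast
    obtain x x' e where x: "x \<in> free_chains (S ?A n)" "x' \<in> free_chains (S ?B n)"
      and e: "e \<in> free_chains (T X n)" "c - bd (n + 1) d = x + x' + e"
      using d(2) by (rule small_split)
    have "c - bd (n + 1) d - x - x' \<in> free_chains (T X n)" using e by simp
    with d(1) x show "\<exists>d\<in>free_chains (S X (n + 1)). \<exists>a\<in>free_chains (S ?A n). \<exists>b\<in>free_chains (S ?B n).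
        c - bd (n + 1) d - a - b \<in> free_chains (T X n)"
      by (intro bexI)
  qed (simp add: SS TT, blast)+
  let ?i = "\<lambda>Y n. homology_map (C Y) n (inc Y n)"
  have hm: "?i Y n (presented_complex.hcls (C Z) (p Z) n x) = presented_complex.hcls (C Y) (p Y) n x"
    if "closure_space Y" "closure_space Z" "\<And>n. S Z n \<subseteq> S Y n" "\<And>n. T Z n \<subseteq> T Y n"
      "x \<in> free_chains (S Z n)" for Y Z n x
  proof (rule homology_map_presented[OF presented_complex[OF that(2)] presented_complex[OF that(1)]])
    show "free_chains (S Z n) \<subseteq> free_chains (S Y n)" for n using that(3)[of n] by blast
  qed (use that(5) inc[OF that(1-4)] in simp_all)
  have S_le: "S ?AB n \<subseteq> S ?A n" "S ?AB n \<subseteq> S ?B n" "S ?A n \<subseteq> S X n" "S ?B n \<subseteq> S X n" for n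
    unfolding SS by blast+
  have T_le: "T ?AB n \<subseteq> T ?A n" "T ?AB n \<subseteq> T ?B n" "T ?A n \<subseteq> T X n" "T ?B n \<subseteq> T X n" for n
    unfolding TT using S_le[of n] by blast+
  have Zc: "x \<in> pAB.Zc n \<Longrightarrow> x \<in> free_chains (S ?AB n)" "x \<in> pA.Zc n \<Longrightarrow> x \<in> free_chains (S ?A n)"
    "x \<in> pB.Zc n \<Longrightarrow> x \<in> free_chains (S ?B n)" for x n
    unfolding pAB.Zc_def pA.Zc_def pB.Zc_def by blast+
  have AB_A: "?i ?A n (pAB.hcls n x) = pA.hcls n x" if "x \<in> pAB.Zc n" for n x
    by (rule hm[OF cs(1,3) S_le(1) T_le(1) Zc(1)[OF that]])
  have AB_B: "?i ?B n (pAB.hcls n x) = pB.hcls n x" if "x \<in> pAB.Zc n" for n x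
    by (rule hm[OF cs(2,3) S_le(2) T_le(2) Zc(1)[OF that]])
  have A_X: "?i X n (pA.hcls n x) = pX.hcls n x" if "x \<in> pA.Zc n" for n x
    by (rule hm[OF X cs(1) S_le(3) T_le(3) Zc(2)[OF that]])
  have B_X: "?i X n (pB.hcls n x) = pX.hcls n x" if "x \<in> pB.Zc n" for n x
    by (rule hm[OF X cs(2) S_le(4) T_le(4) Zc(3)[OF that]])
  show ?thesis
    unfolding mayer_vietoris_def Let_def
    using MV.exact_phi_psi[of "?i ?A" "?i ?B" "?i X" "?i X", OF AB_A AB_B A_X B_X]
      MV.exact_psi_delta[of "?i ?A" "?i ?B" "?i X" "?i X", OF AB_A AB_B A_X B_X]
      MV.exact_delta_phi[of "?i ?A" "?i ?B" "?i X" "?i X", OF AB_A AB_B A_X B_X]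
    by (intro exI[of _ MV.delta] allI conjI)
qed

lemma mayer_vietoris_all_small:
  assumes "\<And>n. S X n \<subseteq> S (csubspace X A) n \<union> S (csubspace X B) n"
  shows "mayer_vietoris C inc X A B"
proof (rule mayer_vietoris_small)
  fix n c assume "c \<in> free_chains (S X n)"
  then have "c - bd (n + 1) 0 \<in> free_chains (small n)" using assms by (auto simp: small_def)
  then show "\<exists>d \<in> free_chains (S X (n + 1)). c - bd (n + 1) d \<in> free_chains (small n)"
    by (intro bexI[of _ 0]) auto
qed

text \<open>\<open>h_S\<close> is assumed for every \<open>Y\<close> since it is applied to the
  subspaces \<open>A\<close> and \<open>B\<close>, whereas \<open>sd\<close> is only required to
  preserve chains of \<open>X\<close>. \<open>shrink\<close> asks for all large \<open>m\<close>, so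
  that one number of subdivisions serves all generators of a chain.\<close>

lemma mayer_vietoris_subdivision:
  fixes sd h :: "int \<Rightarrow> ('m \<Rightarrow> 'a) \<Rightarrow> ('m \<Rightarrow> 'a) \<Rightarrow>\<^sub>0 int"
  assumes sd: "\<And>n \<sigma>. \<sigma> \<in> S X n \<Longrightarrow> sd n \<sigma> \<in> free_chains (S X n)"
    and h_S: "\<And>Y n \<sigma>. \<lbrakk>closure_space Y; \<sigma> \<in> S Y n\<rbrakk> \<Longrightarrow> h n \<sigma> \<in> free_chains (S Y (n + 1))"
    and h_T: "\<And>n \<sigma>. \<sigma> \<in> T X n \<Longrightarrow> h n \<sigma> \<in> free_chains (T X (n + 1))"
    and homotopy: "\<And>n \<sigma>. \<sigma> \<in> S X n \<Longrightarrow>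
      bd (n + 1) (h n \<sigma>) + frag_extend (h (n - 1)) (b n \<sigma>) - (sd n \<sigma> - frag_of \<sigma>) \<in> free_chains (T X n)"
    and shrink: "\<And>n \<sigma>. \<sigma> \<in> S X n \<Longrightarrow>
      \<exists>k. \<forall>m\<ge>k. (frag_extend (sd n) ^^ m) (frag_of \<sigma>) \<in> free_chains (small n)"
  shows "mayer_vietoris C inc X A B"
proof (rule mayer_vietoris_small)
  fix n c assume c: "c \<in> free_chains (S X n)" and bc: "bd n c \<in> free_chains (small (n - 1))"
  let ?S = "\<lambda>n. frag_extend (sd n)" and ?H = "\<lambda>n. frag_extend (h n)"
  note csA = closure_space_csubspace[OF X A] and csB = closure_space_csubspace[OF X B]
  have b_small: "bd m c \<in> free_chains (small (m - 1))" if "c \<in> free_chains (small m)" for m c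
    using that
    by (rule free_chains_extend)
      (use b_S[OF csA, of _ m] b_S[OF csB, of _ m] b_T[OF X, of _ m] in \<open>auto simp: small_def\<close>)
  have h_small: "?H m c \<in> free_chains (small (m + 1))" if "c \<in> free_chains (small m)" for m c
    using that
    by (rule free_chains_extend)
      (use h_S[OF csA, of _ m] h_S[OF csB, of _ m] h_T[of _ m] in \<open>auto simp: small_def\<close>)
  have S_n: "(?S n ^^ k) c \<in> free_chains (S X n)" for k
  proof (induction k)
    case (Suc k)
    then show ?case using free_chains_extend[OF _ sd] by simp
  qed (use c in simp)
  have homotopy': "bd (n + 1) (?H n u) + ?H (n - 1) (bd n u) - (?S n u - u) \<in> free_chains (T X n)"
    if "u \<in> free_chains (S X n)" for u
    using that unfolding mem_Collect_eq
  proof (induction u rule: frag_induction)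
    case (one x)
    then show ?case using homotopy by simp
  next
    case (diff u v)
    have "bd (n + 1) (?H n (u - v)) + ?H (n - 1) (bd n (u - v)) - (?S n (u - v) - (u - v)) =
      (bd (n + 1) (?H n u) + ?H (n - 1) (bd n u) - (?S n u - u)) -
      (bd (n + 1) (?H n v) + ?H (n - 1) (bd n v) - (?S n v - v))"
      by (simp add: frag_extend_diff algebra_simps)
    then show ?case using free_chains_closed(2)[OF diff] by (simp only:)
  qed auto
  have step: "\<exists>d \<in> free_chains (S X (n + 1)). c - bd (n + 1) d - (?S n ^^ k) c \<in> free_chains (small n)" for k
  proof (induction k)
    case 0
    then show ?case by (intro bexI[of _ 0]) auto
  next
    case (Suc k)
    then obtain d where d: "d \<in> free_chains (S X (n + 1))"
      "c - bd (n + 1) d - (?S n ^^ k) c \<in> free_chains (small n)" by blast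
    define u where "u = (?S n ^^ k) c"
    have u: "u \<in> free_chains (S X n)" using S_n by (simp add: u_def)
    \<comment> \<open>The boundary of \<open>u\<close> is small because that of \<open>c\<close> is,
      and \<open>c - u\<close> is a boundary plus a small chain.\<close>
    have "bd n c - bd n u \<in> free_chains (small (n - 1))"
      using b_small[OF d(2)] bd_bd[OF X d(1)] by (simp add: frag_extend_diff u_def)
    from add_subgroup_closed(2)[OF free_chains_subgroup bc this]
    have "bd n u \<in> free_chains (small (n - 1))" by simp
    then have 1: "?H (n - 1) (bd n u) \<in> free_chains (small n)" using h_small[of "bd n u" "n - 1"] by (simp del: mem_Collect_eq)
    have 2: "?H n u \<in> free_chains (S X (n + 1))" using u by (rule free_chains_extend) (rule h_S[OF X])
    \<comment> \<open>The homotopy formula at \<open>u\<close> trades \<open>u\<close> for its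
      subdivision; the chain whose boundary is subtracted becomes \<open>d - ?H n u\<close>.\<close>
    have "(c - bd (n + 1) d - u)
       + ((bd (n + 1) (?H n u) + ?H (n - 1) (bd n u) - (?S n u - u)) - ?H (n - 1) (bd n u))
       \<in> free_chains (small n)"
      using add_subgroup_closed(4)[OF free_chains_subgroup d(2)
          add_subgroup_closed(2)[OF free_chains_subgroup small_intros(3)[OF homotopy'[OF u]] 1]]
      unfolding u_def[symmetric] .
    also have "(c - bd (n + 1) d - u)
       + ((bd (n + 1) (?H n u) + ?H (n - 1) (bd n u) - (?S n u - u)) - ?H (n - 1) (bd n u))
       = c - bd (n + 1) (d - ?H n u) - (?S n ^^ Suc k) c"
      by (simp add: frag_extend_diff u_def algebra_simps)
    finally show ?case
      using add_subgroup_closed(2)[OF free_chains_subgroup d(1) 2] by blast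
  qed
  have "\<exists>k. \<forall>m\<ge>k. (?S n ^^ m) c \<in> free_chains (small n)"
    using c unfolding mem_Collect_eq
  proof (induction c rule: frag_induction)
    case zero
    have "(?S n ^^ m) 0 = 0" for m by (induction m) auto
    then show ?case by simp
  next
    case (one x)
    then show ?case using shrink by simp
  next
    case (diff u v)
    have "(?S n ^^ m) (u - v) = (?S n ^^ m) u - (?S n ^^ m) v" for m
      by (induction m) (auto simp: frag_extend_diff)
    moreover obtain k l where "\<forall>m\<ge>k. Poly_Mapping.keys ((?S n ^^ m) u) \<subseteq> small n"
      "\<forall>m\<ge>l. Poly_Mapping.keys ((?S n ^^ m) v) \<subseteq> small n" using diff by blast
    ultimately show ?case
      by (intro exI[of _ "max k l"]) (simp add: free_chains_closed(2))
  qed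
  then obtain k where k: "(?S n ^^ k) c \<in> free_chains (small n)" by blast
  obtain d where d: "d \<in> free_chains (S X (n + 1))"
    "c - bd (n + 1) d - (?S n ^^ k) c \<in> free_chains (small n)" using step by blast
  show "\<exists>d \<in> free_chains (S X (n + 1)). c - bd (n + 1) d \<in> free_chains (small n)"
    using add_subgroup_closed(4)[OF free_chains_subgroup d(2) k] d(1) by auto
qed

end

end


section \<open>Continuous maps of closure spaces\<close>

lemma closure_space_cl_subset: "closure_space X \<Longrightarrow> A \<subseteq> points X \<Longrightarrow> cl X A \<subseteq> points X"
  by (simp add: closure_space_def)

lemma ccontinuous_in_points: "ccontinuous X Y f \<Longrightarrow> x \<in> points X \<Longrightarrow> f x \<in> points Y"
  by (auto simp: ccontinuous_def)

lemma ccontinuous_cong: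
  assumes "closure_space X" "\<And>x. x \<in> points X \<Longrightarrow> f x = g x" "ccontinuous X Y f"
  shows "ccontinuous X Y g"
proof -
  have "g ` A = f ` A" if "A \<subseteq> points X" for A
    using assms(2) that by (intro image_cong) auto
  moreover have "g \<in> points X \<rightarrow> points Y"
    using assms(2,3) by (simp add: ccontinuous_def Pi_iff)
  ultimately show ?thesis
    using assms(3) closure_space_cl_subset[OF assms(1)] by (simp add: ccontinuous_def)
qed

lemma ccontinuous_restrict:
  "closure_space X \<Longrightarrow> ccontinuous X Y f \<Longrightarrow> ccontinuous X Y (restrict f (points X))"
  by (erule ccontinuous_cong[rotated 2]) auto

lemma ccontinuous_compose:
  assumes "ccontinuous X Y f" "ccontinuous Y Z g"
  shows "ccontinuous X Z (g \<circ> f)"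
proof -
  have "(g \<circ> f) ` cl X A \<subseteq> cl Z ((g \<circ> f) ` A)" if A: "A \<subseteq> points X" for A
  proof -
    have fA: "f ` A \<subseteq> points Y" using assms(1) A by (auto simp: ccontinuous_def)
    have "f ` cl X A \<subseteq> cl Y (f ` A)" using assms(1) A by (simp add: ccontinuous_def)
    then have "(g \<circ> f) ` cl X A \<subseteq> g ` cl Y (f ` A)"
      unfolding image_comp[symmetric] by (rule image_mono)
    also have "\<dots> \<subseteq> cl Z (g ` f ` A)" using assms(2) fA by (simp add: ccontinuous_def)
    finally show ?thesis by (simp add: image_comp)
  qed
  then show ?thesis using assms by (auto simp: ccontinuous_def)
qed

lemma ccontinuous_csubspace_iff:
  assumes "closure_space D" "U \<subseteq> points X"
  shows "ccontinuous D (csubspace X U) f \<longleftrightarrow> ccontinuous D X f \<and> f ` points D \<subseteq> U"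
proof
  assume "ccontinuous D (csubspace X U) f"
  then show "ccontinuous D X f \<and> f ` points D \<subseteq> U"
    using assms(2) by (auto simp: ccontinuous_def csubspace_def)
next
  assume "ccontinuous D X f \<and> f ` points D \<subseteq> U"
  moreover from this have "f ` cl D A \<subseteq> U" if "A \<subseteq> points D" for A
    using closure_space_cl_subset[OF assms(1) that] by blast
  ultimately show "ccontinuous D (csubspace X U) f"
    by (auto simp: ccontinuous_def csubspace_def)
qed

text \<open>If \<open>x\<close> were in the closure of the complement of the preimage,
  \<open>f x\<close> would be in the closure of the complement of \<open>V\<close>, which misses the
  interior of \<open>V\<close>.\<close>

lemma ccontinuous_nhood:
  assumes X: "closure_space X" and f: "ccontinuous D X f" and x: "x \<in> points D" and V: "nhood X (f x) V"
  shows "nhood D x {y \<in> points D. f y \<in> V}"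
proof -
  let ?W = "points D - {y \<in> points D. f y \<in> V}"
  have "f ` ?W \<subseteq> points X - V" using f by (auto simp: ccontinuous_def)
  then have "cl X (f ` ?W) \<subseteq> cl X (points X - V)" by (intro closure_space_mono[OF X]) auto
  moreover have "f ` cl D ?W \<subseteq> cl X (f ` ?W)" using f by (auto simp: ccontinuous_def)
  moreover have "f x \<notin> cl X (points X - V)" using V by (auto simp: nhood_def cinterior_def)
  ultimately have "x \<notin> cl D ?W" by blast
  then show ?thesis using x by (auto simp: nhood_def cinterior_def)
qed

lemma ccontinuous_cspace_of_iff:
  "ccontinuous (cspace_of S) (cspace_of T) f \<longleftrightarrow> continuous_map S T f"
proof
  assume L: "ccontinuous (cspace_of S) (cspace_of T) f"
  have "f ` (S closure_of A) \<subseteq> T closure_of f ` A" for A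
  proof -
    \<comment> \<open>\<open>ccontinuous\<close> speaks only of subsets of the space, while
      \<open>closure_of\<close> ignores the points of \<open>A\<close> outside it.\<close>
    have "f ` (S closure_of (topspace S \<inter> A)) \<subseteq> T closure_of f ` (topspace S \<inter> A)"
      using L by (simp add: ccontinuous_def cspace_of_def)
    also have "\<dots> \<subseteq> T closure_of f ` A" by (intro closure_of_mono) auto
    finally show ?thesis by (simp only: closure_of_restrict[symmetric])
  qed
  then show "continuous_map S T f" by (simp add: continuous_map_eq_image_closure_subset image_subset_iff_funcset)
next
  assume R: "continuous_map S T f"
  then show "ccontinuous (cspace_of S) (cspace_of T) f"
    using continuous_map_image_closure_subset[OF R] continuous_map_funspace[OF R]
    by (simp add: ccontinuous_def cspace_of_def)
qed

lemma interior_cover_nhood: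
  assumes "interior_cover X {A, B}" "x \<in> points X"
  shows "nhood X x A \<or> nhood X x B"
  using assms by (auto simp: interior_cover_def nhood_def)

text \<open>Whichever of \<open>A\<close> and \<open>B\<close> is a neighborhood of
  \<open>f x\<close> has a neighborhood of \<open>x\<close> as preimage, and the only neighborhood
  of \<open>x\<close> is the whole model.\<close>

lemma ccontinuous_image_in_cover:
  assumes "closure_space X" "interior_cover X {A, B}" "ccontinuous D X f"
    and x: "x \<in> points D" "\<And>V. nhood D x V \<Longrightarrow> points D \<subseteq> V"
  shows "f ` points D \<subseteq> A \<or> f ` points D \<subseteq> B"
proof -
  have "f ` points D \<subseteq> V" if "nhood X (f x) V" for V
    using x(2)[OF ccontinuous_nhood[OF assms(1,3) x(1) that]] by auto
  then show ?thesis
    using interior_cover_nhood[OF assms(2) ccontinuous_in_points[OF assms(3) x(1)]] by blast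
qed


section \<open>Iterated boundaries\<close>

text \<open>The term at \<open>(x, i)\<close> with \<open>i < x\<close> cancels against the term at
  \<open>(i, x - 1)\<close>: the two faces are equal and the exponents differ by one. Both the
  simplicial and the cubical boundary square to zero in this way.\<close>

lemma iterated_faces_sum:
  fixes g :: "nat \<Rightarrow> nat \<Rightarrow> 's \<Rightarrow>\<^sub>0 int"
  assumes g: "\<And>i j. i \<le> j \<Longrightarrow> j \<le> n \<Longrightarrow> g i (Suc j) = g j i"
  shows "(\<Sum>x\<le>Suc n. \<Sum>i\<le>n. frag_cmul ((-1) ^ (x + i)) (g i x)) = 0"
proof -
  let ?F = "\<lambda>(x, i). frag_cmul ((-1) ^ (x + i)) (g i x)"
  let ?L = "{(x, i). x \<le> Suc n \<and> i \<le> n \<and> i < x}" and ?R = "{(x, i). x \<le> Suc n \<and> i \<le> n \<and> x \<le> i}"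
  have fin: "finite ?L" "finite ?R"
    by (rule finite_subset[of _ "{..Suc n} \<times> {..n}"], auto)+
  have "sum ?F ?L = (\<Sum>p\<in>?R. - ?F p)"
  proof (rule sum.reindex_bij_witness[of _ "\<lambda>(x, i). (Suc i, x)" "\<lambda>(x, i). (i, x - 1)"])
    fix p assume p: "p \<in> ?L"
    then obtain x i where "p = (x, i)" "x \<le> Suc n" "i < x" by auto
    moreover then obtain j where "x = Suc j" by (cases x) auto
    moreover have "g i (Suc j) = g j i" if "x = Suc j" for j
      using g[of i j] calculation that by simp
    ultimately show "- ?F (case p of (x, i) \<Rightarrow> (i, x - 1)) = ?F p"
      by (simp add: add.commute)
  qed auto
  moreover have "sum ?F (?L \<union> ?R) = sum ?F ?L + sum ?F ?R"
    by (rule sum.union_disjoint[OF fin]) auto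
  ultimately have "sum ?F (?L \<union> ?R) = 0" by (simp only: sum_negf ab_left_minus)
  moreover have "?L \<union> ?R = {..Suc n} \<times> {..n}" by auto
  ultimately show ?thesis by (simp add: sum.cartesian_product)
qed


section \<open>Singular simplices\<close>

text \<open>What the three families of model simplices share; \<open>d_d\<close> is the cosimplicial
  identity.\<close>

locale simplicial_model =
  fixes D :: "nat \<Rightarrow> 'p cspace" and d :: "nat \<Rightarrow> 'p \<Rightarrow> 'p"
  assumes D: "\<And>n. closure_space (D n)"
    and d: "\<And>n i. i \<le> Suc n \<Longrightarrow> ccontinuous (D n) (D (Suc n)) (d i)"
    and d_d: "\<And>n i j x. \<lbrakk>x \<in> points (D n); i \<le> j\<rbrakk> \<Longrightarrow> d (Suc j) (d i x) = d i (d j x)"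
begin

lemma face_in_simplices:
  assumes "\<sigma> \<in> singular_simplices D Y n" "n > 0" "i \<le> nat n"
  shows "restrict (\<sigma> \<circ> d i) (points (D (nat n - 1))) \<in> singular_simplices D Y (n - 1)"
proof -
  have n: "nat n = Suc (nat n - 1)" "nat (n - 1) = nat n - 1" using assms by auto
  have "ccontinuous (D (nat n - 1)) (D (nat n)) (d i)"
    using d[of i "nat n - 1"] assms n by simp
  then have "ccontinuous (D (nat n - 1)) Y (\<sigma> \<circ> d i)"
    using assms by (auto simp: singular_simplices_def intro: ccontinuous_compose)
  then show ?thesis
    using assms(2) n ccontinuous_restrict[OF D] by (auto simp: singular_simplices_def)
qed

lemma simplex_bdry_in_chains:
  assumes "\<sigma> \<in> singular_simplices D Y n"
  shows "simplex_bdry D d n \<sigma> \<in> free_chains (singular_simplices D Y (n - 1))"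
proof (cases "n > 0")
  case True
  then show ?thesis
    using face_in_simplices[OF assms]
    by (auto simp: simplex_bdry_def dest!: subsetD[OF keys_sum])
qed (simp add: simplex_bdry_def)

lemma simplex_bdry_bdry: "frag_extend (simplex_bdry D d (n - 1)) (simplex_bdry D d n \<sigma>) = 0"
proof (cases "n \<le> 1")
  case True
  then show ?thesis by (intro frag_extend_eq_0) (simp add: simplex_bdry_def)
next
  case False
  define m where "m = nat n - 2"
  have n: "nat n = Suc (Suc m)" "nat (n - 1) = Suc m" "\<not> n \<le> 0" "\<not> n - 1 \<le> 0"
    using False by (auto simp: m_def)
  let ?g = "\<lambda>i x. restrict (restrict (\<sigma> \<circ> d x) (points (D (Suc m))) \<circ> d i) (points (D m))"
  \<comment> \<open>Faces are restricted to stay extensional; since \<open>d\<close> maps models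
    into models, the inner restriction disappears.\<close>
  have g: "?g i (Suc j) = ?g j i" if "i \<le> j" "j \<le> Suc m" for i j
  proof
    fix t
    show "?g i (Suc j) t = ?g j i t"
      using ccontinuous_in_points[OF d, of i m t] ccontinuous_in_points[OF d, of j m t] d_d[of t m i j] that
      by auto
  qed
  have "frag_extend (simplex_bdry D d (n - 1)) (simplex_bdry D d n \<sigma>) =
      (\<Sum>x\<le>Suc (Suc m). \<Sum>i\<le>Suc m. frag_cmul ((-1) ^ (x + i)) (frag_of (?g i x)))"
    using n by (simp add: simplex_bdry_def frag_extend_sum frag_extend_cmul frag_cmul_sum power_add
        del: sum.atMost_Suc)
  also have "\<dots> = 0" by (rule iterated_faces_sum) (simp only: g)
  finally show ?thesis .
qed

text \<open>No simplex counts as degenerate: the denominator \<open>free_chains {}\<close> is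
  trivial, and chains represent themselves.\<close>

sublocale singular_theory "singular_simplices D" "\<lambda>_ _. {}" "\<lambda>n. points (D (nat n))"
  "simplex_bdry D d" "simplicial_cplx D d" simplicial_incl "\<lambda>_ _ c. c"
proof
  show "singular_simplices D (csubspace X U) n = {\<sigma> \<in> singular_simplices D X n. \<sigma> ` points (D (nat n)) \<subseteq> U}"
    if "U \<subseteq> points X" for X :: "'a cspace" and U n
    using ccontinuous_csubspace_iff[OF D that] by (auto simp: singular_simplices_def)
qed (use simplex_bdry_in_chains simplex_bdry_bdry presents_free_Abelian_group in
    \<open>simp_all add: simplicial_cplx_def simplicial_incl_def\<close>)

lemma mayer_vietoris_simplicial_focal:
  assumes X: "closure_space X" and cover: "interior_cover X {A, B}"
    and focal: "\<And>n. \<exists>x\<in>points (D n). \<forall>V. nhood (D n) x V \<longrightarrow> points (D n) \<subseteq> V"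
  shows "mayer_vietoris (simplicial_cplx D d) simplicial_incl X A B"
proof (rule mayer_vietoris_all_small[OF X])
  show "A \<subseteq> points X" "B \<subseteq> points X" using cover by (auto simp: interior_cover_def)
  then have S: "singular_simplices D (csubspace X U) n = {\<sigma> \<in> singular_simplices D X n. \<sigma> ` points (D (nat n)) \<subseteq> U}"
    if "U \<in> {A, B}" for U n
    using S_sub[OF X] that by blast
  show "singular_simplices D X n \<subseteq> singular_simplices D (csubspace X A) n \<union> singular_simplices D (csubspace X B) n" for n
  proof
    fix \<sigma> assume \<sigma>: "\<sigma> \<in> singular_simplices D X n"
    then have "ccontinuous (D (nat n)) X \<sigma>" by (simp add: singular_simplices_def split: if_splits)
    moreover obtain x where "x \<in> points (D (nat n))" "\<And>V. nhood (D (nat n)) x V \<Longrightarrow> points (D (nat n)) \<subseteq> V"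
      using focal by blast
    ultimately have "\<sigma> ` points (D (nat n)) \<subseteq> A \<or> \<sigma> ` points (D (nat n)) \<subseteq> B"
      by (rule ccontinuous_image_in_cover[OF X cover])
    then show "\<sigma> \<in> singular_simplices D (csubspace X A) n \<union> singular_simplices D (csubspace X B) n"
      using \<sigma> S by blast
  qed
qed

end

section \<open>The indiscrete simplices and the ordered simplices\<close>

lemma vertex_face_vertex_face: "i \<le> j \<Longrightarrow> vertex_face (Suc j) (vertex_face i x) = vertex_face i (vertex_face j x)"
  by (simp add: vertex_face_def)

lemma ccontinuous_into_indiscrete:
  assumes "closure_space X" "f \<in> points X \<rightarrow> S"
  shows "ccontinuous X (indiscrete S) f"
proof -
  have "f ` cl X A \<subseteq> cl (indiscrete S) (f ` A)" if "A \<subseteq> points X" for A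
  proof (cases "A = {}")
    case True
    then show ?thesis using assms(1) by (simp add: closure_space_def)
  next
    case False
    then show ?thesis
      using closure_space_cl_subset[OF assms(1) that] assms(2) by (auto simp: indiscrete_def)
  qed
  then show ?thesis using assms(2) by (simp add: ccontinuous_def indiscrete_def)
qed

text \<open>The closure of a set consists of the vertices above one of its elements, so monotone
  maps are continuous.\<close>

lemma ccontinuous_simplex_plus:
  assumes "f \<in> {..n} \<rightarrow> {..m}" "mono f"
  shows "ccontinuous (simplex_plus n) (simplex_plus m) f"
proof -
  have "f j \<in> {k \<in> {..m}. \<exists>l\<in>f ` A. l \<le> k}" if "j \<le> n" "i \<in> A" "i \<le> j" for A i j
    using assms(1) monoD[OF assms(2) that(3)] that by auto
  then show ?thesis
    using assms(1) by (auto simp: ccontinuous_def simplex_plus_def)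
qed

lemma mono_vertex_face: "mono (vertex_face i)"
  by (rule monoI) (simp add: vertex_face_def)

lemma vertex_face_in: "i \<le> Suc n \<Longrightarrow> vertex_face i \<in> {..n} \<rightarrow> {..Suc n}"
  by (auto simp: vertex_face_def)

interpretation simplex_one: simplicial_model simplex_one vertex_face
proof
  show "ccontinuous (simplex_one n) (simplex_one (Suc n)) (vertex_face i)" if "i \<le> Suc n" for n i
    unfolding simplex_one_def[of "Suc n"]
    by (rule ccontinuous_into_indiscrete[OF closure_space_simplex(2)])
      (use vertex_face_in[OF that] in \<open>simp add: simplex_one_def indiscrete_def\<close>)
qed (simp_all add: closure_space_simplex vertex_face_vertex_face)

interpretation simplex_plus: simplicial_model simplex_plus vertex_face
  by unfold_locales
    (simp_all add: closure_space_simplex vertex_face_vertex_face ccontinuous_simplex_plus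
      vertex_face_in mono_vertex_face)

text \<open>A nonempty complement of \<open>V\<close> has everything as its closure, so
  \<open>V\<close> has interior points only if it is the whole simplex.\<close>

lemma simplex_one_focal: "nhood (simplex_one n) 0 V \<Longrightarrow> points (simplex_one n) \<subseteq> V"
  by (auto simp: nhood_def cinterior_def simplex_one_def indiscrete_def split: if_splits)

text \<open>The last vertex lies in the closure of every nonempty set, so it is interior only to the
  whole simplex.\<close>

lemma simplex_plus_focal: "nhood (simplex_plus n) n V \<Longrightarrow> points (simplex_plus n) \<subseteq> V"
  by (auto simp: nhood_def cinterior_def simplex_plus_def)


section \<open>Barycentric subdivision\<close>

lemma nhood_cspace_of_iff:
  "nhood (cspace_of T) x V \<longleftrightarrow> V \<subseteq> topspace T \<and> x \<in> T interior_of V"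
  by (simp add: nhood_def cinterior_def cspace_of_def interior_of_closure_of)

lemma simplical_face_simplical_face:
  "i \<le> j \<Longrightarrow> simplical_face (Suc j) (simplical_face i x) = simplical_face i (simplical_face j x)"
  by (rule ext) (auto simp: simplical_face_def)

text \<open>The map is the \<open>i\<close>-th face of the identity singular simplex, and faces of
  singular simplices are continuous.\<close>

lemma continuous_map_simplical_face:
  assumes "i \<le> Suc n"
  shows "continuous_map (subtopology (powertop_real UNIV) (standard_simplex n))
    (subtopology (powertop_real UNIV) (standard_simplex (Suc n))) (simplical_face i)"
proof -
  let ?T = "\<lambda>n. subtopology (powertop_real UNIV) (standard_simplex n)"
  have "singular_simplex (Suc n) (?T (Suc n)) (restrict id (standard_simplex (Suc n)))"
    by (rule simplicial_imp_singular_simplex) simp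
  from singular_simplex_singular_face[OF this, of i] assms
  have "continuous_map (?T n) (?T (Suc n)) (singular_face (Suc n) i id)"
    by (simp add: singular_simplex_def)
  then show ?thesis
    by (rule continuous_map_eq) (simp add: singular_face_def)
qed

interpretation simplex_I: simplicial_model simplex_I simplical_face
proof
  show "ccontinuous (simplex_I n) (simplex_I (Suc n)) (simplical_face i)" if "i \<le> Suc n" for n i
    using continuous_map_simplical_face[OF that] by (simp add: simplex_I_def ccontinuous_cspace_of_iff)
qed (simp_all add: closure_space_simplex simplical_face_simplical_face)

abbreviation simplex_topology :: "nat \<Rightarrow> (nat \<Rightarrow> real) topology" where
  "simplex_topology n \<equiv> subtopology (powertop_real UNIV) (standard_simplex n)"

abbreviation identity_simplex :: "nat \<Rightarrow> (nat \<Rightarrow> real) chain" where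
  "identity_simplex n \<equiv> frag_of (restrict id (standard_simplex n))"

lemma identity_simplex_chain: "simplicial_chain n (standard_simplex n) (identity_simplex n)"
  by simp

lemma points_simplex_I: "points (simplex_I n) = standard_simplex n"
  by (simp add: simplex_I_def cspace_of_def)

lemma simplex_bdry_I: "frag_extend (simplex_bdry simplex_I simplical_face n) = chain_boundary (nat n)"
proof
  fix c :: "'a chain"
  show "frag_extend (simplex_bdry simplex_I simplical_face n) c = chain_boundary (nat n) c"
  proof (cases "n \<le> 0")
    case True
    then have "frag_extend (simplex_bdry simplex_I simplical_face n) c = 0"
      by (intro frag_extend_eq_0) (simp add: simplex_bdry_def)
    then show ?thesis using True by (simp add: chain_boundary_def)
  next
    case False
    then show ?thesis
      unfolding chain_boundary_def
      by (simp, intro frag_extend_eq) (simp add: simplex_bdry_def singular_face_def points_simplex_I)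
  qed
qed

lemma simplex_map_in_simplices:
  assumes \<sigma>: "\<sigma> \<in> singular_simplices simplex_I Y (int n)" and f: "singular_simplex m (simplex_topology n) f"
  shows "simplex_map m \<sigma> f \<in> singular_simplices simplex_I Y (int m)"
proof -
  have "ccontinuous (simplex_I m) (simplex_I n) f"
    using f by (simp add: simplex_I_def ccontinuous_cspace_of_iff singular_simplex_def)
  then have "ccontinuous (simplex_I m) Y (\<sigma> \<circ> f)"
    using \<sigma> by (auto simp: singular_simplices_def intro: ccontinuous_compose)
  then show ?thesis
    using ccontinuous_restrict[OF closure_space_simplex(1)]
    by (auto simp: singular_simplices_def simplex_map_def points_simplex_I[symmetric])
qed

lemma keys_chain_map: "Poly_Mapping.keys (chain_map m \<sigma> c) \<subseteq> simplex_map m \<sigma> ` Poly_Mapping.keys c"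
  unfolding chain_map_def using keys_frag_extend[of "frag_of \<circ> simplex_map m \<sigma>" c] by auto

lemma chain_map_in_chains:
  assumes "\<sigma> \<in> singular_simplices simplex_I Y (int n)" "singular_chain m (simplex_topology n) c"
  shows "chain_map m \<sigma> c \<in> free_chains (singular_simplices simplex_I Y (int m))"
  using keys_chain_map[of m \<sigma> c] simplex_map_in_simplices[OF assms(1)] assms(2)
  unfolding singular_chain_def by blast

text \<open>The library's chain homotopy \<open>subd\<close> is evaluated on the identity simplex
  and pushed forward along \<open>\<sigma>\<close>. The target has no topology, so the geometry
  takes place in the standard simplex; and since \<open>\<sigma>\<close> is only precomposed, the
  result stays in every subspace that contains its image.\<close>

definition subdivision_homotopy :: "nat \<Rightarrow> ((nat \<Rightarrow> real) \<Rightarrow> 'a) \<Rightarrow> 'a chain" where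
  "subdivision_homotopy n \<sigma> = chain_map (Suc n) \<sigma> (subd n (identity_simplex n))"

lemma subd_identity_chain: "singular_chain (Suc n) (simplex_topology n) (subd n (identity_simplex n))"
  by (intro simplicial_imp_singular_chain chain_homotopic_simplicial_subdivision2 identity_simplex_chain)

lemma chain_map_identity:
  assumes "\<sigma> \<in> extensional (standard_simplex n)"
  shows "chain_map n \<sigma> (identity_simplex n) = frag_of \<sigma>"
proof -
  have "restrict (\<sigma> \<circ> restrict id (standard_simplex n)) (standard_simplex n) = \<sigma>"
    using assms by (intro extensionalityI[of _ "standard_simplex n"]) auto
  then show ?thesis by (simp add: simplex_map_def)
qed

text \<open>\<open>subd\<close> commutes with the affine face inclusion, so the homotopy on a face
  of the identity simplex, pushed forward along \<open>\<sigma>\<close>, is the homotopy of that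
  face of \<open>\<sigma>\<close>.\<close>

lemma chain_map_subd_face:
  assumes k: "k \<le> Suc n"
  shows "chain_map (Suc n) \<sigma> (subd n (frag_of (singular_face (Suc n) k id))) =
    subdivision_homotopy n (singular_face (Suc n) k \<sigma>)"
proof -
  let ?f = "singular_face (Suc n) k id :: (nat \<Rightarrow> real) \<Rightarrow> nat \<Rightarrow> real"
  have "simplicial_simplex (Suc n) (standard_simplex (Suc n)) (restrict id (standard_simplex (Suc n)))"
    by simp
  then have f: "simplicial_simplex n (standard_simplex (Suc n)) ?f"
    using simplicial_simplex_singular_face[of "Suc n" _ _ k] k by fastforce
  have "simplex_map n ?f (restrict id (standard_simplex n)) = ?f"
    by (auto simp: simplex_map_def singular_face_def)
  then have "subd n (frag_of ?f) = chain_map (Suc n) ?f (subd n (identity_simplex n))"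
    using chain_homotopic_simplicial_subdivision1[OF identity_simplex_chain f] by simp
  then have "chain_map (Suc n) \<sigma> (subd n (frag_of ?f)) = chain_map (Suc n) (\<sigma> \<circ> ?f) (subd n (identity_simplex n))"
    by (simp add: chain_map_compose)
  also have "\<dots> = subdivision_homotopy n (singular_face (Suc n) k \<sigma>)"
    unfolding subdivision_homotopy_def
    by (rule chain_map_eq[OF subd_identity_chain]) (simp add: singular_face_def)
  finally show ?thesis .
qed

text \<open>The library's formula for \<open>subd\<close> on the identity simplex, pushed forward
  along \<open>\<sigma>\<close>. For \<open>n = 0\<close> the truncated \<open>n - 1\<close> is
  harmless because the boundary vanishes.\<close>

lemma subdivision_homotopy:
  assumes \<sigma>: "\<sigma> \<in> extensional (standard_simplex n)"
  shows "chain_boundary (Suc n) (subdivision_homotopy n \<sigma>)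
      + frag_extend (subdivision_homotopy (n - 1)) (chain_boundary n (frag_of \<sigma>))
    = singular_subdivision n (frag_of \<sigma>) - frag_of \<sigma>"
proof -
  have face: "chain_map n \<sigma> (subd (n - 1) (chain_boundary n (identity_simplex n))) =
      frag_extend (subdivision_homotopy (n - 1)) (chain_boundary n (frag_of \<sigma>))"
  proof (cases n)
    case (Suc m)
    then show ?thesis
      by (simp add: chain_boundary_of subd_power_sum subd_power_uminus chain_map_sum frag_extend_sum
          frag_extend_cmul chain_map_subd_face del: sum.atMost_Suc)
  qed (simp add: chain_boundary_def)
  have "chain_boundary (Suc n) (subdivision_homotopy n \<sigma>) =
      chain_map n \<sigma> (chain_boundary (Suc n) (subd n (identity_simplex n)))"
    unfolding subdivision_homotopy_def using chain_boundary_chain_map[OF subd_identity_chain] by simp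
  also have "\<dots> = chain_map n \<sigma> (simplicial_subdivision n (identity_simplex n)) - frag_of \<sigma>
      - frag_extend (subdivision_homotopy (n - 1)) (chain_boundary n (frag_of \<sigma>))"
    using chain_homotopic_simplicial_subdivision3[OF identity_simplex_chain] face chain_map_identity[OF \<sigma>]
    by (simp add: chain_map_diff)
  finally show ?thesis by (simp add: singular_subdivision_def)
qed

text \<open>Naturality moves the iteration into the standard simplex, where the library's result on
  fine subdivisions is available.\<close>

lemma iterated_subdivision_chain_map:
  assumes "\<sigma> \<in> extensional (standard_simplex n)"
  shows "(singular_subdivision n ^^ m) (frag_of \<sigma>) = chain_map n \<sigma> ((singular_subdivision n ^^ m) (identity_simplex n))"
    and "singular_chain n (simplex_topology n) ((singular_subdivision n ^^ m) (identity_simplex n))"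
proof (induction m)
  case 0
  show "(singular_subdivision n ^^ 0) (frag_of \<sigma>) = chain_map n \<sigma> ((singular_subdivision n ^^ 0) (identity_simplex n))"
    using chain_map_identity[OF assms] by simp
  show "singular_chain n (simplex_topology n) ((singular_subdivision n ^^ 0) (identity_simplex n))"
    using simplicial_imp_singular_chain[OF identity_simplex_chain] by simp
next
  case (Suc m)
  then show "(singular_subdivision n ^^ Suc m) (frag_of \<sigma>) = chain_map n \<sigma> ((singular_subdivision n ^^ Suc m) (identity_simplex n))"
    unfolding funpow.simps o_apply using naturality_singular_subdivision by metis
  show "singular_chain n (simplex_topology n) ((singular_subdivision n ^^ Suc m) (identity_simplex n))"
    unfolding funpow.simps o_apply by (rule singular_chain_singular_subdivision[OF Suc(2)])
qed

theorem mayer_vietoris_simplex_I: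
  assumes X: "closure_space X" and cover: "interior_cover X {A, B}"
  shows "mayer_vietoris (simplicial_cplx simplex_I simplical_face) simplicial_incl X A B"
proof -
  have AB: "A \<subseteq> points X" "B \<subseteq> points X" using cover by (auto simp: interior_cover_def)
  let ?S = "singular_simplices simplex_I"
  have S_iff: "\<sigma> \<in> ?S Y n \<longleftrightarrow> n \<ge> 0 \<and> \<sigma> \<in> ?S Y (int (nat n))" for \<sigma> :: "(nat \<Rightarrow> real) \<Rightarrow> 'a" and Y n
    by (auto simp: singular_simplices_def)
  have ext: "\<sigma> \<in> extensional (standard_simplex (nat n))" if "\<sigma> \<in> ?S Y n" for \<sigma> :: "(nat \<Rightarrow> real) \<Rightarrow> 'a" and Y n
    using that by (auto simp: singular_simplices_def points_simplex_I split: if_splits)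
  let ?sd = "\<lambda>n \<sigma>. chain_map (nat n) \<sigma> (simplicial_subdivision (nat n) (identity_simplex (nat n)))"
  have sd: "frag_extend (?sd n) = singular_subdivision (nat n)" for n
    by (simp add: singular_subdivision_def)
  show ?thesis
  proof (rule simplex_I.mayer_vietoris_subdivision[OF X AB, where sd = ?sd and h = "\<lambda>n. subdivision_homotopy (nat n)"])
    fix n \<sigma> assume \<sigma>: "\<sigma> \<in> ?S X n"
    then have n: "n \<ge> 0" and \<sigma>': "\<sigma> \<in> ?S X (int (nat n))" using S_iff by blast+
    show "?sd n \<sigma> \<in> free_chains (?S X n)"
      using chain_map_in_chains[OF \<sigma>' simplicial_imp_singular_chain[OF
          simplicial_chain_simplicial_subdivision[OF identity_simplex_chain]]] n by simp
    have "nat (n + 1) = Suc (nat n)" "nat (n - 1) = nat n - 1" using n by auto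
    then have "frag_extend (simplex_bdry simplex_I simplical_face (n + 1)) (subdivision_homotopy (nat n) \<sigma>)
        + frag_extend (subdivision_homotopy (nat (n - 1))) (frag_extend (simplex_bdry simplex_I simplical_face n) (frag_of \<sigma>))
        - (frag_extend (?sd n) (frag_of \<sigma>) - frag_of \<sigma>) = 0"
      unfolding sd simplex_bdry_I using subdivision_homotopy[OF ext[OF \<sigma>]] by simp
    then show "frag_extend (simplex_bdry simplex_I simplical_face (n + 1)) (subdivision_homotopy (nat n) \<sigma>)
        + frag_extend (subdivision_homotopy (nat (n - 1))) (simplex_bdry simplex_I simplical_face n \<sigma>)
        - (?sd n \<sigma> - frag_of \<sigma>) \<in> free_chains {}"
      by simp
    let ?T = "simplex_topology (nat n)" and ?id = "identity_simplex (nat n)"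
    \<comment> \<open>The library's result on fine subdivisions asks for an open cover, hence the
      interiors of the preimages.\<close>
    let ?V = "\<lambda>U. ?T interior_of {y \<in> standard_simplex (nat n). \<sigma> y \<in> U}"
    have \<sigma>_cont: "ccontinuous (simplex_I (nat n)) X \<sigma>"
      using \<sigma> n by (simp add: singular_simplices_def)
    have "x \<in> ?V A \<or> x \<in> ?V B" if x: "x \<in> topspace ?T" for x
    proof -
      have x': "x \<in> points (simplex_I (nat n))" using x by (simp add: points_simplex_I)
      have "x \<in> ?V U" if "nhood X (\<sigma> x) U" for U
        using ccontinuous_nhood[of X "simplex_I (nat n)" \<sigma> x U, OF X \<sigma>_cont x' that]
        unfolding points_simplex_I by (simp add: simplex_I_def nhood_cspace_of_iff)
      then show ?thesis
        using interior_cover_nhood[OF cover ccontinuous_in_points[OF \<sigma>_cont x']] by blast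
    qed
    then have cov: "topspace ?T \<subseteq> \<Union>{?V A, ?V B}" by blast
    have id: "singular_chain (nat n) ?T ?id"
      by (rule simplicial_imp_singular_chain[OF identity_simplex_chain])
    obtain k where k: "\<And>m f. k \<le> m \<Longrightarrow> f \<in> Poly_Mapping.keys ((singular_subdivision (nat n) ^^ m) ?id) \<Longrightarrow>
        \<exists>V\<in>{?V A, ?V B}. f \<in> standard_simplex (nat n) \<rightarrow> V"
      by (rule sufficient_iterated_singular_subdivision_exists[of "{?V A, ?V B}", OF _ cov id])
        (use openin_interior_of in blast)+
    have "(frag_extend (?sd n) ^^ m) (frag_of \<sigma>) \<in> free_chains (?S (csubspace X A) n \<union> ?S (csubspace X B) n)"
      if m: "k \<le> m" for m
    proof -
      have "simplex_map (nat n) \<sigma> f \<in> ?S (csubspace X A) n \<union> ?S (csubspace X B) n"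
        if f: "f \<in> Poly_Mapping.keys ((singular_subdivision (nat n) ^^ m) ?id)" for f
      proof -
        obtain U where U: "U \<in> {A, B}" "f \<in> standard_simplex (nat n) \<rightarrow> ?V U"
          using k[OF m f] by blast
        have "singular_simplex (nat n) ?T f"
          using f iterated_subdivision_chain_map(2)[OF ext[OF \<sigma>]] by (auto simp: singular_chain_def)
        then have "simplex_map (nat n) \<sigma> f \<in> ?S X (int (nat n))"
          by (rule simplex_map_in_simplices[OF \<sigma>'])
        moreover have "simplex_map (nat n) \<sigma> f ` standard_simplex (nat n) \<subseteq> U"
          using U(2) interior_of_subset[of ?T "{y \<in> standard_simplex (nat n). \<sigma> y \<in> U}"]
          by (auto simp: simplex_map_def)
        ultimately have "simplex_map (nat n) \<sigma> f \<in> ?S (csubspace X U) n"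
          using simplex_I.S_sub[OF X, of U n] U(1) AB n by (auto simp: points_simplex_I)
        then show ?thesis using U(1) by blast
      qed
      then show ?thesis
        unfolding sd iterated_subdivision_chain_map(1)[OF ext[OF \<sigma>]]
        using keys_chain_map[of "nat n" \<sigma> "(singular_subdivision (nat n) ^^ m) ?id"] by blast
    qed
    then show "\<exists>k. \<forall>m\<ge>k. (frag_extend (?sd n) ^^ m) (frag_of \<sigma>) \<in> free_chains (simplex_I.small X A B n)"
      unfolding simplex_I.small_def[OF X AB] by blast
  next
    fix Y :: "'a cspace" and n \<sigma> assume \<sigma>: "\<sigma> \<in> ?S Y n"
    then have n: "n \<ge> 0" and \<sigma>': "\<sigma> \<in> ?S Y (int (nat n))" using S_iff by blast+
    have "int (Suc (nat n)) = n + 1" using n by simp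
    then show "subdivision_homotopy (nat n) \<sigma> \<in> free_chains (?S Y (n + 1))"
      using chain_map_in_chains[OF \<sigma>' subd_identity_chain] by (simp only: subdivision_homotopy_def)
  qed simp
qed


section \<open>Products of closure spaces\<close>

lemma nhood_mono:
  assumes "closure_space X" "nhood X x U" "U \<subseteq> V" "V \<subseteq> points X"
  shows "nhood X x V"
  using assms(2-4) closure_space_mono[OF assms(1), of "points X - V" "points X - U"]
  by (auto simp: nhood_def cinterior_def)

lemma nhood_INT:
  assumes "closure_space X" "x \<in> points X" "finite K" "\<And>i. i \<in> K \<Longrightarrow> nhood X x (U i)"
  shows "nhood X x {y \<in> points X. \<forall>i\<in>K. y \<in> U i}"
  using assms(3,4)
proof (induction K rule: finite_induct)
  case empty
  then show ?case using nhood_points[OF assms(1,2)] by simp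
next
  case (insert i K)
  have "{y \<in> points X. \<forall>i\<in>insert i K. y \<in> U i} = U i \<inter> {y \<in> points X. \<forall>i\<in>K. y \<in> U i}"
    using insert.prems[of i] by (auto simp: nhood_def)
  then show ?case using insert nhood_Int[OF assms(1)] by simp
qed

text \<open>Converse of \<open>ccontinuous_nhood\<close>: if \<open>f x\<close> is outside the
  closure of the image of \<open>A\<close>, the complement of that image is a neighborhood of
  \<open>f x\<close>, and its preimage is a neighborhood of \<open>x\<close> disjoint from
  \<open>A\<close>.\<close>

lemma ccontinuousI_nhood:
  assumes X: "closure_space X" and Y: "closure_space Y" and f: "\<And>x. x \<in> points X \<Longrightarrow> f x \<in> points Y"
    and nh: "\<And>x V. \<lbrakk>x \<in> points X; nhood Y (f x) V\<rbrakk> \<Longrightarrow> nhood X x {y \<in> points X. f y \<in> V}"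
  shows "ccontinuous X Y f"
proof -
  have "f x \<in> cl Y (f ` A)" if A: "A \<subseteq> points X" and x: "x \<in> cl X A" for A x
  proof (rule ccontr)
    assume nx: "f x \<notin> cl Y (f ` A)"
    have xX: "x \<in> points X" using closure_space_cl_subset[OF X A] x by blast
    have "points Y - (points Y - f ` A) = f ` A" using f A by blast
    then have "nhood Y (f x) (points Y - f ` A)"
      using nx f[OF xX] by (simp add: nhood_def cinterior_def)
    then have "nhood X x {y \<in> points X. f y \<in> points Y - f ` A}" using nh[OF xX] by blast
    then have "x \<notin> cl X (points X - {y \<in> points X. f y \<in> points Y - f ` A})"
      by (simp add: nhood_def cinterior_def)
    moreover have "A \<subseteq> points X - {y \<in> points X. f y \<in> points Y - f ` A}" using A by blast
    ultimately show False using closure_space_mono[OF X] x by blast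
  qed
  then show ?thesis using f by (auto simp: ccontinuous_def)
qed

lemma points_cpower: "points (cpower J n) = {1..n} \<rightarrow>\<^sub>E points J"
  by (simp add: cpower_def)

text \<open>Universal property of the product: the preimage of a product of coordinate neighborhoods
  is a finite intersection of neighborhoods.\<close>

lemma ccontinuous_into_cpower:
  assumes X: "closure_space X" and J: "closure_space J"
    and f: "\<And>x. x \<in> points X \<Longrightarrow> f x \<in> extensional {1..n}"
    and comp: "\<And>i. i \<in> {1..n} \<Longrightarrow> ccontinuous X J (\<lambda>x. f x i)"
  shows "ccontinuous X (cpower J n) f"
proof (rule ccontinuousI_nhood[OF X closure_space_cpower[OF J]])
  show fp: "f x \<in> points (cpower J n)" if "x \<in> points X" for x
    using f[OF that] ccontinuous_in_points[OF comp that] by (auto simp: points_cpower PiE_iff)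
  fix x V assume x: "x \<in> points X" and V: "nhood (cpower J n) (f x) V"
  obtain U where U: "\<And>i. i \<in> {1..n} \<Longrightarrow> nhood J (f x i) (U i)" "PiE {1..n} U \<subseteq> V"
    using V unfolding nhood_cpower_iff by blast
  have "nhood X x {y \<in> points X. f y i \<in> U i}" if "i \<in> {1..n}" for i
    using ccontinuous_nhood[of J X "\<lambda>x. f x i" x "U i", OF J comp[OF that] x U(1)[OF that]] .
  then have "nhood X x {y \<in> points X. \<forall>i\<in>{1..n}. y \<in> {y \<in> points X. f y i \<in> U i}}"
    by (intro nhood_INT[OF X x]) auto
  then show "nhood X x {y \<in> points X. f y \<in> V}"
  proof (rule nhood_mono[OF X])
    show "{y \<in> points X. \<forall>i\<in>{1..n}. y \<in> {y \<in> points X. f y i \<in> U i}} \<subseteq> {y \<in> points X. f y \<in> V}"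
      using U(2) f by (auto simp: PiE_iff subset_iff)
  qed auto
qed

lemma ccontinuous_projection:
  assumes J: "closure_space J" and i: "i \<in> {1..n}"
  shows "ccontinuous (cpower J n) J (\<lambda>x. x i)"
proof (rule ccontinuousI_nhood[OF closure_space_cpower[OF J] J])
  fix x V assume x: "x \<in> points (cpower J n)" and V: "nhood J (x i) V"
  let ?U = "\<lambda>k. if k = i then V else points J"
  have "\<forall>k\<in>{1..n}. nhood J (x k) (?U k)"
    using x V nhood_points[OF J] by (auto simp: points_cpower)
  moreover have "PiE {1..n} ?U \<subseteq> {1..n} \<rightarrow>\<^sub>E points J"
    using V by (intro PiE_mono) (auto simp: nhood_def)
  moreover have "y i \<in> V" if "y \<in> PiE {1..n} ?U" for y
    using PiE_mem[OF that i] by simp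
  ultimately have "(\<forall>k\<in>{1..n}. nhood J (x k) (?U k)) \<and>
      PiE {1..n} ?U \<subseteq> {y \<in> {1..n} \<rightarrow>\<^sub>E points J. y i \<in> V}"
    by blast
  then show "nhood (cpower J n) x {y \<in> points (cpower J n). y i \<in> V}"
    unfolding nhood_cpower_iff points_cpower using x[unfolded points_cpower]
    by (intro conjI exI[of _ ?U]) blast+
qed (use i in \<open>auto simp: points_cpower\<close>)

lemma ccontinuous_const:
  assumes "closure_space X" "closure_space Y" "a \<in> points Y"
  shows "ccontinuous X Y (\<lambda>x. a)"
proof (rule ccontinuousI_nhood[OF assms(1,2)])
  fix x V assume x: "x \<in> points X" and "nhood Y a V"
  then have "{y \<in> points X. a \<in> V} = points X" using nhood_mem[OF assms(2)] by auto
  then show "nhood X x {y \<in> points X. a \<in> V}" using nhood_points[OF assms(1) x] by simp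
qed (use assms(3) in simp)


section \<open>Singular cubes\<close>

lemma frag_cmul_diff_distrib2: "frag_cmul c (a - b) = frag_cmul c a - frag_cmul c b"
  by (rule poly_mapping_eqI) (simp add: lookup_minus algebra_simps)

lemma insert_coord_insert_coord:
  "i \<le> j \<Longrightarrow> insert_coord (Suc j) t (insert_coord i s x) = insert_coord i s (insert_coord j t x)"
  by (rule ext) (auto simp: insert_coord_def)

lemma cube_D_eq: "cube_D J Y n = free_chains (degenerate_cubes J Y n)"
  unfolding cube_D_def cube_Q_def
  by (rule generate_frag_of) (auto simp: degenerate_cubes_def)

text \<open>Stated for extensions from generators, so that it covers both the cubical boundary and,
  with \<open>b = frag_of\<close>, the inclusion of a subspace.\<close>

lemma coset_map_free_chains:
  assumes "T \<subseteq> S" "T' \<subseteq> S'" "c \<in> free_chains S"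
    and "\<And>\<sigma>. \<sigma> \<in> S \<Longrightarrow> b \<sigma> \<in> free_chains S'" "\<And>\<sigma>. \<sigma> \<in> T \<Longrightarrow> b \<sigma> \<in> free_chains T'"
  shows "coset_map (free_Abelian_group S') (free_chains T') (frag_extend b) (free_chains T #>\<^bsub>free_Abelian_group S\<^esub> c)
    = free_chains T' #>\<^bsub>free_Abelian_group S'\<^esub> frag_extend b c"
proof -
  have "free_chains T \<subseteq> free_chains S" "free_chains T' \<subseteq> free_chains S'" using assms(1,2) by auto
  then have "coset_map (free_Abelian_group S') ((\<lambda>c. c) ` free_chains T') (frag_extend b)
      ((\<lambda>c. c) ` free_chains T #>\<^bsub>free_Abelian_group S\<^esub> c)
    = (\<lambda>c. c) ` free_chains T' #>\<^bsub>free_Abelian_group S'\<^esub> frag_extend b c"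
  proof (rule coset_map_presents[OF presents_free_Abelian_group presents_free_Abelian_group
        free_chains_subgroup _ free_chains_subgroup])
    show "frag_extend b x \<in> free_chains S'" if "x \<in> free_chains S" for x
      using that assms(4) by (rule free_chains_extend)
    show "frag_extend b x \<in> free_chains T'" if "x \<in> free_chains T" for x
      using that assms(5) by (rule free_chains_extend)
  qed (use assms(3) in \<open>simp_all only: frag_extend_add\<close>)
  then show ?thesis by (simp only: image_ident)
qed

locale cubical_model =
  fixes J :: "real cspace"
  assumes J: "closure_space J" and J01: "0 \<in> points J" "1 \<in> points J"
begin

abbreviation cube :: "int \<Rightarrow> (nat \<Rightarrow> real) set" where
  "cube n \<equiv> points (cpower J (nat n))"

lemma ccontinuous_insert_coord:
  assumes i: "i \<in> {1..Suc n}" and t: "t \<in> points J"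
  shows "ccontinuous (cpower J n) (cpower J (Suc n)) (insert_coord i t)"
proof (rule ccontinuous_into_cpower[OF closure_space_cpower[OF J] J])
  show "insert_coord i t x \<in> extensional {1..Suc n}" if "x \<in> points (cpower J n)" for x
  proof -
    have "insert_coord i t x k = undefined" if k: "k \<notin> {1..Suc n}" for k
    \<comment> \<open>Index 0 is treated separately because \<open>0 - 1\<close> is 0 for natural
      numbers.\<close>
    proof (cases "k = 0")
      case False
      then have "k - 1 \<notin> {1..n}" "\<not> k < i" "k \<noteq> i" using k i by auto
      then show ?thesis
        using \<open>x \<in> points (cpower J n)\<close> by (simp add: points_cpower insert_coord_def PiE_iff extensional_def)
    qed (use \<open>x \<in> points (cpower J n)\<close> i in \<open>auto simp: points_cpower insert_coord_def PiE_iff extensional_def\<close>)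
    then show ?thesis by (simp add: extensional_def)
  qed
  fix k assume k: "k \<in> {1..Suc n}"
  consider "k < i" | "k = i" | "k > i" by linarith
  then show "ccontinuous (cpower J n) J (\<lambda>x. insert_coord i t x k)"
  proof cases
    case 1
    then show ?thesis using ccontinuous_projection[OF J, of k n] k i by (simp add: insert_coord_def)
  next
    case 2
    then show ?thesis using ccontinuous_const[OF closure_space_cpower[OF J] J t] by (simp add: insert_coord_def)
  next
    case 3
    then have "k - 1 \<in> {1..n}" using k i by auto
    from ccontinuous_projection[OF J this] 3 show ?thesis by (simp add: insert_coord_def)
  qed
qed

lemma insert_coord_in_cube:
  assumes "n > 0" "i \<in> {1..nat n}" "t \<in> points J" "x \<in> cube (n - 1)"
  shows "insert_coord i t x \<in> cube n"
proof -
  have "nat n = Suc (nat (n - 1))" using assms(1) by simp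
  then show ?thesis using ccontinuous_in_points[OF ccontinuous_insert_coord assms(4)] assms(2,3) by simp
qed

lemma cube_face_in_cubes:
  assumes "\<sigma> \<in> singular_cubes J Y n" "n > 0" "i \<in> {1..nat n}" "t \<in> points J"
  shows "cube_face J n i t \<sigma> \<in> singular_cubes J Y (n - 1)"
proof -
  have n: "nat n = Suc (nat n - 1)" "nat (n - 1) = nat n - 1" using assms(2) by auto
  have "ccontinuous (cpower J (nat n - 1)) (cpower J (nat n)) (insert_coord i t)"
    using ccontinuous_insert_coord[of i "nat n - 1" t] assms n by simp
  moreover have "ccontinuous (cpower J (nat n)) Y \<sigma>" using assms(1,2) by (simp add: singular_cubes_def)
  ultimately have "ccontinuous (cpower J (nat n - 1)) Y (\<sigma> \<circ> insert_coord i t)"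
    by (rule ccontinuous_compose)
  then show ?thesis
    using assms(2) n ccontinuous_restrict[OF closure_space_cpower[OF J]]
    by (auto simp: singular_cubes_def cube_face_def)
qed

lemma cube_face_apply:
  "x \<in> cube (n - 1) \<Longrightarrow> cube_face J n i t \<sigma> x = \<sigma> (insert_coord i t x)"
proof -
  have "nat (n - 1) = nat n - 1" by simp
  then show "x \<in> cube (n - 1) \<Longrightarrow> cube_face J n i t \<sigma> x = \<sigma> (insert_coord i t x)"
    by (simp only: cube_face_def restrict_apply if_True o_apply)
qed

text \<open>In the direction on which the cube does not depend the two faces coincide and will
  cancel; in every other direction the faces still ignore a coordinate.\<close>

lemma cube_face_degenerate:
  assumes \<sigma>: "\<sigma> \<in> degenerate_cubes J Y n" and k: "k \<in> {1..nat n}"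
  shows "cube_face J n k 0 \<sigma> = cube_face J n k 1 \<sigma> \<or>
    (\<forall>t\<in>points J. cube_face J n k t \<sigma> \<in> degenerate_cubes J Y (n - 1))"
proof -
  obtain i where i: "i \<in> {1..nat n}"
    and eq': "\<forall>x\<in>cube n. \<forall>y\<in>cube n. (\<forall>l. l \<noteq> i \<longrightarrow> x l = y l) \<longrightarrow> \<sigma> x = \<sigma> y"
    using \<sigma> unfolding degenerate_cubes_def by blast
  have eq: "\<sigma> x = \<sigma> y" if "x \<in> cube n" "y \<in> cube n" "\<And>l. l \<noteq> i \<Longrightarrow> x l = y l" for x y
    using eq' that by blast
  have n: "n > 0" using k by auto
  have S: "\<sigma> \<in> singular_cubes J Y n" using \<sigma> by (simp add: degenerate_cubes_def)
  show ?thesis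
  proof (cases "k = i")
    case True
    have "cube_face J n k 0 \<sigma> = cube_face J n k 1 \<sigma>"
      unfolding cube_face_def
    proof (rule restrict_ext)
      fix x assume "x \<in> points (cpower J (nat n - 1))"
      then have x: "x \<in> cube (n - 1)" using n by (simp add: nat_diff_distrib')
      show "(\<sigma> \<circ> insert_coord k 0) x = (\<sigma> \<circ> insert_coord k 1) x"
        unfolding o_apply
        by (rule eq) (use insert_coord_in_cube[OF n k _ x] J01 True in \<open>auto simp: insert_coord_def\<close>)
    qed
    then show ?thesis ..
  next
    case False
    \<comment> \<open>The position of the \<open>i\<close>-th coordinate once the
      \<open>k\<close>-th one has been removed.\<close>
    define j where "j = (if i < k then i else i - 1)"
    have j: "j \<in> {1..nat (n - 1)}" using i k False by (auto simp: j_def)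
    have "cube_face J n k t \<sigma> \<in> degenerate_cubes J Y (n - 1)" if t: "t \<in> points J" for t
    proof -
      have "cube_face J n k t \<sigma> x = cube_face J n k t \<sigma> y"
        if x: "x \<in> cube (n - 1)" "y \<in> cube (n - 1)" and xy: "\<forall>l. l \<noteq> j \<longrightarrow> x l = y l" for x y
        unfolding cube_face_apply[OF x(1)] cube_face_apply[OF x(2)]
      proof (rule eq)
        show "insert_coord k t x l = insert_coord k t y l" if "l \<noteq> i" for l
          using xy that False by (auto simp: insert_coord_def j_def split: if_splits)
      qed (use x insert_coord_in_cube[OF n k t] in auto)
      then show ?thesis
        using j cube_face_in_cubes[OF S n k t] unfolding degenerate_cubes_def by blast
    qed
    then show ?thesis by blast
  qed
qed

lemma cube_bdry_in_chains:
  assumes "\<sigma> \<in> singular_cubes J Y n"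
  shows "cube_bdry J n \<sigma> \<in> free_chains (singular_cubes J Y (n - 1))"
proof (cases "n > 0")
  case True
  have "frag_cmul ((-1) ^ i) (frag_of (cube_face J n i 0 \<sigma>) - frag_of (cube_face J n i 1 \<sigma>))
      \<in> free_chains (singular_cubes J Y (n - 1))" if "i \<in> {1..nat n}" for i
    using cube_face_in_cubes[OF assms True that] J01
    by (auto dest!: subsetD[OF keys_diff] split: if_splits)
  then show ?thesis unfolding cube_bdry_def using keys_sum by fastforce
qed (simp add: cube_bdry_def)

lemma cube_bdry_degenerate:
  assumes "\<sigma> \<in> degenerate_cubes J Y n"
  shows "cube_bdry J n \<sigma> \<in> free_chains (degenerate_cubes J Y (n - 1))"
proof -
  have "frag_cmul ((-1) ^ i) (frag_of (cube_face J n i 0 \<sigma>) - frag_of (cube_face J n i 1 \<sigma>))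
      \<in> free_chains (degenerate_cubes J Y (n - 1))" if "i \<in> {1..nat n}" for i
    using cube_face_degenerate[OF assms that]
  proof
    assume "\<forall>t\<in>points J. cube_face J n i t \<sigma> \<in> degenerate_cubes J Y (n - 1)"
    then show ?thesis using J01 by (auto dest!: subsetD[OF keys_diff] split: if_splits)
  qed simp
  then show ?thesis unfolding cube_bdry_def using keys_sum by fastforce
qed

lemma cube_face_cube_face:
  assumes "n > 1" "1 \<le> i" "i \<le> j" "j \<le> nat (n - 1)" "s \<in> points J" "t \<in> points J"
  shows "cube_face J (n - 1) i s (cube_face J n (Suc j) t \<sigma>) = cube_face J (n - 1) j t (cube_face J n i s \<sigma>)"
proof
  fix x
  show "cube_face J (n - 1) i s (cube_face J n (Suc j) t \<sigma>) x = cube_face J (n - 1) j t (cube_face J n i s \<sigma>) x"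
  proof (cases "x \<in> cube (n - 1 - 1)")
    case True
    then have "insert_coord i s x \<in> cube (n - 1)" "insert_coord j t x \<in> cube (n - 1)"
      using assms by (auto intro!: insert_coord_in_cube)
    then show ?thesis
      using True by (simp add: cube_face_apply insert_coord_insert_coord[OF assms(3)] del: diff_diff_eq)
  next
    case False
    moreover have "nat (n - 1) - 1 = nat (n - 1 - 1)" by simp
    ultimately show ?thesis by (simp only: cube_face_def restrict_apply if_False)
  qed
qed

lemma cube_bdry_bdry: "frag_extend (cube_bdry J (n - 1)) (cube_bdry J n \<sigma>) = 0"
proof (cases "n \<le> 1")
  case True
  then show ?thesis by (intro frag_extend_eq_0) (simp add: cube_bdry_def)
next
  case False
  define m where "m = nat n - 2"
  have n: "nat n = Suc (Suc m)" "nat (n - 1) = Suc m" "n > 1" using False by (auto simp: m_def)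
  define F where "F i s x t = frag_of (cube_face J (n - 1) (Suc i) s (cube_face J n (Suc x) t \<sigma>))" for i s x t
  \<comment> \<open>The four iterated faces in a pair of directions with their signs. Exchanging the
    directions also exchanges the ends \<open>s\<close> and \<open>t\<close>, which leaves the
    combination unchanged.\<close>
  let ?g = "\<lambda>i x. F i 0 x 0 - F i 1 x 0 - (F i 0 x 1 - F i 1 x 1)"
  have F: "F i s (Suc j) t = F j t i s" if "i \<le> j" "j \<le> Suc m - 1" "s \<in> {0, 1}" "t \<in> {0, 1}" for i j s t
    unfolding F_def using cube_face_cube_face[of n "Suc i" "Suc j" s t \<sigma>] that n J01 by auto
  have sum: "sum f {1..Suc k} = (\<Sum>i\<le>k. f (Suc i))" for f :: "nat \<Rightarrow> 'b :: comm_monoid_add" and k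
    using sum.atLeast1_atMost_eq[of f "Suc k"] by (simp add: lessThan_Suc_atMost)
  have 1: "cube_bdry J (n - 1) (cube_face J n (Suc x) 0 \<sigma>) - cube_bdry J (n - 1) (cube_face J n (Suc x) 1 \<sigma>)
      = (\<Sum>i\<le>m. frag_cmul ((-1) ^ Suc i) (?g i x))" for x
    unfolding cube_bdry_def n sum F_def sum_subtractf[symmetric] frag_cmul_diff_distrib2[symmetric] ..
  have "frag_extend (cube_bdry J (n - 1)) (cube_bdry J n \<sigma>) =
      (\<Sum>x\<le>Suc m. frag_cmul ((-1) ^ Suc x) (cube_bdry J (n - 1) (cube_face J n (Suc x) 0 \<sigma>)
        - cube_bdry J (n - 1) (cube_face J n (Suc x) 1 \<sigma>)))"
    unfolding cube_bdry_def[of J n] n sum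
    by (simp only: frag_extend_sum finite_atMost o_def frag_extend_cmul frag_extend_diff frag_extend_of)
  \<comment> \<open>Both indices were shifted down by one, which changes the exponent by two and no
    sign.\<close>
  also have "\<dots> = (\<Sum>x\<le>Suc m. \<Sum>i\<le>m. frag_cmul ((-1) ^ (x + i)) (?g i x))"
    unfolding 1 by (simp add: frag_cmul_sum power_add del: sum.atMost_Suc)
  also have "\<dots> = 0" by (rule iterated_faces_sum) (simp add: F)
  finally show ?thesis .
qed

sublocale singular_theory "singular_cubes J" "degenerate_cubes J" cube "cube_bdry J" "cubical_cplx J"
  "cubical_incl J" "\<lambda>Y n c. cube_D J Y n #>\<^bsub>cube_Q J Y n\<^esub> c"
proof
  show S: "singular_cubes J (csubspace X U) n = {\<sigma> \<in> singular_cubes J X n. \<sigma> ` cube n \<subseteq> U}"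
    if "U \<subseteq> points X" for X :: "'a cspace" and U n
    using ccontinuous_csubspace_iff[OF closure_space_cpower[OF J] that] by (auto simp: singular_cubes_def)
  show "degenerate_cubes J (csubspace X U) n = degenerate_cubes J X n \<inter> singular_cubes J (csubspace X U) n"
    if "U \<subseteq> points X" for X :: "'a cspace" and U n
    unfolding degenerate_cubes_def S[OF that] by blast
  have T: "degenerate_cubes J Y n \<subseteq> singular_cubes J Y n" for Y :: "'a cspace" and n
    by (auto simp: degenerate_cubes_def)
  then show "degenerate_cubes J Y n \<subseteq> singular_cubes J Y n" for Y :: "'a cspace" and n .
  show "presents (chains (cubical_cplx J Y) n) (free_chains (singular_cubes J Y n))
      (free_chains (degenerate_cubes J Y n)) (\<lambda>c. cube_D J Y n #>\<^bsub>cube_Q J Y n\<^esub> c)" for Y :: "'a cspace" and n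
    using presents_free_Mod[OF T, of Y n] by (simp add: cubical_cplx_def cube_D_eq cube_Q_def)
  show "bdry (cubical_cplx J Y) n (cube_D J Y n #>\<^bsub>cube_Q J Y n\<^esub> c) =
      cube_D J Y (n - 1) #>\<^bsub>cube_Q J Y (n - 1)\<^esub> frag_extend (cube_bdry J n) c"
    if "c \<in> free_chains (singular_cubes J Y n)" for Y :: "'a cspace" and n c
    using coset_map_free_chains[OF T T that cube_bdry_in_chains cube_bdry_degenerate]
    by (simp add: cubical_cplx_def cube_D_eq cube_Q_def)
  show "cubical_incl J Y n (cube_D J Z n #>\<^bsub>cube_Q J Z n\<^esub> c) = cube_D J Y n #>\<^bsub>cube_Q J Y n\<^esub> c"
    if "singular_cubes J Z n \<subseteq> singular_cubes J Y n" "degenerate_cubes J Z n \<subseteq> degenerate_cubes J Y n"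
      "c \<in> free_chains (singular_cubes J Z n)" for Y Z :: "'a cspace" and n c
  proof -
    \<comment> \<open>The identity is written as an extension from generators, the form required by
      \<open>coset_map_free_chains\<close>.\<close>
    have "frag_extend frag_of = (\<lambda>c :: ((nat \<Rightarrow> real) \<Rightarrow> 'a) \<Rightarrow>\<^sub>0 int. c)"
      using frag_expansion by metis
    moreover have "coset_map (free_Abelian_group (singular_cubes J Y n)) (free_chains (degenerate_cubes J Y n))
        (frag_extend frag_of) (free_chains (degenerate_cubes J Z n) #>\<^bsub>free_Abelian_group (singular_cubes J Z n)\<^esub> c)
      = free_chains (degenerate_cubes J Y n) #>\<^bsub>free_Abelian_group (singular_cubes J Y n)\<^esub> frag_extend frag_of c"
      by (rule coset_map_free_chains[OF T T that(3)]) (use that(1,2) in auto)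
    ultimately show ?thesis by (simp only: cubical_incl_def cube_D_eq cube_Q_def)
  qed
qed (use cube_bdry_in_chains cube_bdry_degenerate cube_bdry_bdry in blast)+

text \<open>The point with all coordinates \<open>a\<close> inherits the property of
  \<open>a\<close>, because a product of neighborhoods of \<open>a\<close> is the whole
  cube.\<close>

lemma mayer_vietoris_cubical_focal:
  assumes X: "closure_space X" and cover: "interior_cover X {A, B}"
    and focal: "a \<in> points J" "\<And>V. nhood J a V \<Longrightarrow> points J \<subseteq> V"
  shows "mayer_vietoris (cubical_cplx J) (cubical_incl J) X A B"
proof (rule mayer_vietoris_all_small[OF X])
  show AB: "A \<subseteq> points X" "B \<subseteq> points X" using cover by (auto simp: interior_cover_def)
  show "singular_cubes J X n \<subseteq> singular_cubes J (csubspace X A) n \<union> singular_cubes J (csubspace X B) n" for n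
  proof
    fix \<sigma> assume \<sigma>: "\<sigma> \<in> singular_cubes J X n"
    then have cont: "ccontinuous (cpower J (nat n)) X \<sigma>" by (simp add: singular_cubes_def split: if_splits)
    have "(\<lambda>i\<in>{1..nat n}. a) \<in> cube n" using focal(1) by (auto simp: points_cpower)
    moreover have "cube n \<subseteq> V" if V: "nhood (cpower J (nat n)) (\<lambda>i\<in>{1..nat n}. a) V" for V
    proof -
      obtain U where U: "\<forall>i\<in>{1..nat n}. nhood J a (U i)" "PiE {1..nat n} U \<subseteq> V"
        using V unfolding nhood_cpower_iff by auto
      have "cube n \<subseteq> PiE {1..nat n} U"
        unfolding points_cpower using U(1) focal(2) by (intro PiE_mono) auto
      then show ?thesis using U(2) by blast
    qed
    ultimately have "\<sigma> ` cube n \<subseteq> A \<or> \<sigma> ` cube n \<subseteq> B"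
      by (rule ccontinuous_image_in_cover[OF X cover cont])
    then show "\<sigma> \<in> singular_cubes J (csubspace X A) n \<union> singular_cubes J (csubspace X B) n"
      using \<sigma> S_sub[OF X AB(1)] S_sub[OF X AB(2)] by blast
  qed
qed

end


section \<open>Neighborhoods in the unit cube\<close>

interpretation J_one: cubical_model J_one
  by unfold_locales (rule closure_space_J, simp_all add: J_one_def indiscrete_def)

interpretation J_plus: cubical_model J_plus
  by unfold_locales (rule closure_space_J, simp_all add: J_plus_def)

interpretation J_I: cubical_model J_I
  by unfold_locales (rule closure_space_J, simp_all add: J_I_def cspace_of_def)

lemma nhood_J_one: "nhood J_one 0 V \<Longrightarrow> points J_one \<subseteq> V"
  by (auto simp: nhood_def cinterior_def J_one_def indiscrete_def split: if_splits)

lemma nhood_J_plus: "nhood J_plus 1 V \<Longrightarrow> points J_plus \<subseteq> V"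
  by (auto simp: nhood_def cinterior_def J_plus_def split: if_splits)

lemma points_J_I: "points J_I = {0..1}"
  by (simp add: J_I_def cspace_of_def)

lemma nhood_J_I_iff:
  "nhood J_I t V \<longleftrightarrow> t \<in> {0..1} \<and> V \<subseteq> {0..1} \<and> (\<exists>r>0. \<forall>s\<in>{0..1}. \<bar>s - t\<bar> < r \<longrightarrow> s \<in> V)"
proof
  assume L: "nhood J_I t V"
  then have V: "V \<subseteq> {0..1}" and t: "t \<in> top_of_set {0..1} interior_of V"
    by (simp_all add: J_I_def nhood_cspace_of_iff)
  obtain W where W: "openin (top_of_set {0..1}) W" "t \<in> W" "W \<subseteq> V"
    using t by (auto simp: interior_of_def)
  then obtain r where "r > 0" "\<forall>s\<in>{0..1}. dist s t < r \<longrightarrow> s \<in> W"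
    unfolding openin_euclidean_subtopology_iff by blast
  then show "t \<in> {0..1} \<and> V \<subseteq> {0..1} \<and> (\<exists>r>0. \<forall>s\<in>{0..1}. \<bar>s - t\<bar> < r \<longrightarrow> s \<in> V)"
    using V W by (auto simp: dist_real_def)
next
  assume R: "t \<in> {0..1} \<and> V \<subseteq> {0..1} \<and> (\<exists>r>0. \<forall>s\<in>{0..1}. \<bar>s - t\<bar> < r \<longrightarrow> s \<in> V)"
  then obtain r where r: "r > 0" "\<And>s. s \<in> {0..1} \<Longrightarrow> \<bar>s - t\<bar> < r \<Longrightarrow> s \<in> V" by blast
  have "openin (top_of_set {0..1}) ({0..1} \<inter> ball t r)" by (simp add: openin_open_Int)
  moreover have "{0..1} \<inter> ball t r \<subseteq> V" using r by (auto simp: dist_real_def abs_minus_commute)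
  moreover have "t \<in> {0..1} \<inter> ball t r" using R r(1) by simp
  ultimately have "t \<in> top_of_set {0..1} interior_of V" unfolding interior_of_def by blast
  then show "nhood J_I t V" using R by (simp add: J_I_def nhood_cspace_of_iff)
qed

abbreviation unit_cube :: "nat \<Rightarrow> (nat \<Rightarrow> real) set" where
  "unit_cube n \<equiv> {1..n} \<rightarrow>\<^sub>E {0..1}"

lemma points_cube_I: "points (cpower J_I n) = unit_cube n"
  by (simp add: points_cpower points_J_I)

text \<open>The neighborhoods are those of the maximum metric, in which the size of small cubes will
  be measured.\<close>

lemma nhood_cube_I_iff:
  "nhood (cpower J_I n) x W \<longleftrightarrow> x \<in> unit_cube n \<and> W \<subseteq> unit_cube n \<and>
     (\<exists>r>0. \<forall>y\<in>unit_cube n. (\<forall>i\<in>{1..n}. \<bar>y i - x i\<bar> < r) \<longrightarrow> y \<in> W)"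
proof
  assume "nhood (cpower J_I n) x W"
  then obtain U where x: "x \<in> unit_cube n" and W: "W \<subseteq> unit_cube n"
    and U: "\<forall>i\<in>{1..n}. nhood J_I (x i) (U i)" "PiE {1..n} U \<subseteq> W"
    unfolding nhood_cpower_iff points_J_I by blast
  have "\<forall>i\<in>{1..n}. \<exists>r>0. \<forall>s\<in>{0..1}. \<bar>s - x i\<bar> < r \<longrightarrow> s \<in> U i"
    using U(1) unfolding nhood_J_I_iff by blast
  then obtain r where r: "\<And>i. i \<in> {1..n} \<Longrightarrow> r i > 0"
    "\<And>i s. i \<in> {1..n} \<Longrightarrow> s \<in> {0..1} \<Longrightarrow> \<bar>s - x i\<bar> < r i \<Longrightarrow> s \<in> U i" by metis
  \<comment> \<open>Inserting 1 keeps the set nonempty when \<open>n = 0\<close>.\<close>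
  let ?r = "Min (insert 1 (r ` {1..n}))"
  have "?r > 0" using r(1) by simp
  have le: "?r \<le> r i" if "i \<in> {1..n}" for i by (rule Min_le) (use that in auto)
  have "y \<in> W" if y: "y \<in> unit_cube n" "\<forall>i\<in>{1..n}. \<bar>y i - x i\<bar> < ?r" for y
  proof (rule subsetD[OF U(2)], rule PiE_I)
    show "y i \<in> U i" if i: "i \<in> {1..n}" for i
      using r(2)[OF i PiE_mem[OF y(1) i]] bspec[OF y(2) i] le[OF i] by linarith
    show "y i = undefined" if "i \<notin> {1..n}" for i
      using PiE_arb[OF y(1) that] .
  qed
  with \<open>?r > 0\<close> show "x \<in> unit_cube n \<and> W \<subseteq> unit_cube n \<and>
     (\<exists>r>0. \<forall>y\<in>unit_cube n. (\<forall>i\<in>{1..n}. \<bar>y i - x i\<bar> < r) \<longrightarrow> y \<in> W)"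
    using x W by blast
next
  assume R: "x \<in> unit_cube n \<and> W \<subseteq> unit_cube n \<and>
     (\<exists>r>0. \<forall>y\<in>unit_cube n. (\<forall>i\<in>{1..n}. \<bar>y i - x i\<bar> < r) \<longrightarrow> y \<in> W)"
  then obtain r where r: "r > 0" "\<forall>y\<in>unit_cube n. (\<forall>i\<in>{1..n}. \<bar>y i - x i\<bar> < r) \<longrightarrow> y \<in> W" by blast
  let ?U = "\<lambda>i. {s \<in> {0..1}. \<bar>s - x i\<bar> < r}"
  have "nhood J_I (x i) (?U i)" if "i \<in> {1..n}" for i
    unfolding nhood_J_I_iff using R r(1) that by auto
  moreover have "PiE {1..n} ?U \<subseteq> W" using r(2) by (auto simp: PiE_iff)
  ultimately show "nhood (cpower J_I n) x W"
    unfolding nhood_cpower_iff points_J_I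
    by (intro conjI exI[of _ ?U]) (use R in blast)+
qed

text \<open>Each point \<open>x\<close> gets a radius \<open>r x\<close> whose box lies in a member
  of the family. The boxes of half that radius are open, unlike the members, so finitely many cover
  the cube. A set of diameter at most every one of these half radii that meets one of the half boxes
  lies in the corresponding full box.\<close>

lemma cube_lebesgue:
  assumes nh: "\<And>x. x \<in> unit_cube n \<Longrightarrow> \<exists>V\<in>\<C>. nhood (cpower J_I n) x V"
  obtains \<delta> where "\<delta> > 0"
    "\<forall>K. K \<subseteq> unit_cube n \<and> K \<noteq> {} \<and> (\<forall>x\<in>K. \<forall>y\<in>K. \<forall>i\<in>{1..n}. \<bar>x i - y i\<bar> \<le> \<delta>)
       \<longrightarrow> (\<exists>V\<in>\<C>. K \<subseteq> V)"
proof -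
  let ?P = "\<lambda>x r. \<exists>V\<in>\<C>. \<forall>y\<in>unit_cube n. (\<forall>i\<in>{1..n}. \<bar>y i - x i\<bar> < r) \<longrightarrow> y \<in> V"
  have "\<exists>r>0. ?P x r" if "x \<in> unit_cube n" for x
  proof -
    obtain V where V: "V \<in> \<C>" "nhood (cpower J_I n) x V" using nh[OF \<open>x \<in> unit_cube n\<close>] by blast
    then have "\<exists>r>0. \<forall>y\<in>unit_cube n. (\<forall>i\<in>{1..n}. \<bar>y i - x i\<bar> < r) \<longrightarrow> y \<in> V"
      unfolding nhood_cube_I_iff by (elim conjE)
    then show ?thesis using V(1) by (elim exE conjE) (intro exI conjI bexI)
  qed
  then have "\<exists>r. \<forall>x\<in>unit_cube n. r x > 0 \<and> ?P x (r x)" by (intro bchoice ballI) blast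
  then obtain r where "\<forall>x\<in>unit_cube n. r x > 0 \<and> ?P x (r x)" by (rule exE)
  then have r: "\<And>x. x \<in> unit_cube n \<Longrightarrow> r x > 0" "\<And>x. x \<in> unit_cube n \<Longrightarrow> ?P x (r x)"
    by (simp_all only:)
  let ?T = "product_topology (\<lambda>_. top_of_set {0..1::real}) {1..n}"
  let ?O = "\<lambda>x. PiE {1..n} (\<lambda>i. {0..1} \<inter> ball (x i) (r x / 2))"
  have top: "topspace ?T = unit_cube n" by simp
  have "compact_space ?T"
    by (simp add: compact_space_product_topology compact_space_subtopology)
  moreover have "openin ?T (?O x)" for x
    by (simp add: openin_PiE openin_open_Int)
  moreover have "topspace ?T \<subseteq> \<Union> (?O ` unit_cube n)"
  proof
    fix x assume "x \<in> topspace ?T"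
    then have x: "x \<in> unit_cube n" by simp
    then have "x \<in> ?O x" using r(1)[OF x] by (auto simp: PiE_iff)
    then show "x \<in> \<Union> (?O ` unit_cube n)" using x by blast
  qed
  ultimately obtain \<F> where \<F>: "finite \<F>" "\<F> \<subseteq> ?O ` unit_cube n" "topspace ?T \<subseteq> \<Union>\<F>"
    unfolding compact_space_alt by (elim allE[of _ "?O ` unit_cube n"] impE) blast+
  obtain F where "F \<subseteq> unit_cube n" "finite F" "\<F> = ?O ` F"
    using finite_subset_image[OF \<F>(1,2)] by blast
  then have F: "finite F" "F \<subseteq> unit_cube n" "unit_cube n \<subseteq> \<Union> (?O ` F)"
    using \<F>(3) unfolding top by simp_all
  let ?d = "Min (insert 1 ((\<lambda>x. r x / 2) ` F))"
  have d: "?d > 0" using F r(1) by (auto simp: subset_iff)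
  show thesis
  proof (rule that[OF d], intro allI impI, elim conjE)
    fix K assume K: "K \<subseteq> unit_cube n" "\<forall>x\<in>K. \<forall>y\<in>K. \<forall>i\<in>{1..n}. \<bar>x i - y i\<bar> \<le> ?d" "K \<noteq> {}"
    obtain y where y: "y \<in> K" using K(3) by blast
    then obtain x where x: "x \<in> F" "y \<in> ?O x" using K(1) F(3) by blast
    have le: "?d \<le> r x / 2" by (rule Min_le) (use x(1) F(1) in auto)
    obtain V where V: "V \<in> \<C>" "\<forall>y\<in>unit_cube n. (\<forall>i\<in>{1..n}. \<bar>y i - x i\<bar> < r x) \<longrightarrow> y \<in> V"
      using r(2) x(1) F(2) by blast
    have "z \<in> V" if z: "z \<in> K" for z
    proof -
      have "\<bar>z i - x i\<bar> < r x" if i: "i \<in> {1..n}" for i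
      proof -
        have "\<bar>z i - y i\<bar> \<le> r x / 2" using bspec[OF bspec[OF bspec[OF K(2) z] y] i] le by linarith
        moreover have "\<bar>x i - y i\<bar> < r x / 2" using PiE_mem[OF x(2) i] by (simp add: dist_real_def)
        ultimately show ?thesis by linarith
      qed
      then show ?thesis using V(2) K(1) z by blast
    qed
    then show "\<exists>V\<in>\<C>. K \<subseteq> V" using V(1) by blast
  qed
qed


section \<open>Subdivision of cubes\<close>

text \<open>For a vertex \<open>e\<close> of the cube, \<open>interp e\<close> deforms, coordinate by coordinate, the contraction
  \<open>x \<mapsto> (x + e) / 2\<close> (at \<open>t = 0\<close>) into the identity if \<open>e = 0\<close> and into the constant \<open>1\<close> if
  \<open>e = 1\<close> (at \<open>t = 1\<close>). The common face of two adjacent small cubes moves in the same way on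
  both sides (\<open>interp_middle\<close>), so the prisms cancel there.\<close>

definition interp :: "real \<Rightarrow> real \<Rightarrow> real \<Rightarrow> real" where
  "interp e x t = (if e = 0 then x * (1 + t) / 2 else 1 - (1 - x) * (1 - t) / 2)"

lemma interp_1: "interp e x 1 = (if e = 0 then x else 1)"
  by (simp add: interp_def)

lemma interp_outer: "interp 0 0 t = 0" "interp 1 1 t = 1"
  by (simp_all add: interp_def)

lemma interp_middle: "interp 1 0 t = interp 0 1 t"
  by (simp add: interp_def field_simps)

lemma interp_in:
  assumes "x \<in> {0..1}" "t \<in> {0..1}"
  shows "interp e x t \<in> {0..1}"
proof -
  have "x * (1 + t) \<le> 1 * 2" "(1 - x) * (1 - t) \<le> 1 * 2" using assms by (intro mult_mono; simp)+
  moreover have "0 \<le> x * (1 + t)" "0 \<le> (1 - x) * (1 - t)" using assms by simp_all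
  ultimately show ?thesis unfolding interp_def by auto
qed

text \<open>The difference splits into a change of \<open>x\<close> and a change of
  \<open>t\<close>. The coefficients lie between 0 and 2, which the division by 2
  compensates.\<close>

lemma interp_lipschitz:
  assumes "x \<in> {0..1}" "t \<in> {0..1}" "x' \<in> {0..1}" "t' \<in> {0..1}"
  shows "\<bar>interp e x t - interp e x' t'\<bar> \<le> \<bar>x - x'\<bar> + \<bar>t - t'\<bar>"
proof -
  have *: "\<bar>a * u + b * v\<bar> \<le> 2 * (\<bar>a\<bar> + \<bar>b\<bar>)" if "0 \<le> u" "u \<le> 2" "0 \<le> v" "v \<le> 2" for a b u v :: real
  proof -
    have "\<bar>a\<bar> * \<bar>u\<bar> \<le> \<bar>a\<bar> * 2" "\<bar>b\<bar> * \<bar>v\<bar> \<le> \<bar>b\<bar> * 2" using that by (intro mult_left_mono; simp)+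
    then show ?thesis using abs_triangle_ineq[of "a * u" "b * v"] by (simp add: abs_mult)
  qed
  show ?thesis
  proof (cases "e = 0")
    case True
    then have eq: "interp e x t - interp e x' t' = ((x - x') * (1 + t) + (t - t') * x') / 2"
      by (simp add: interp_def field_simps)
    show ?thesis unfolding eq using *[of "1 + t" x' "x - x'" "t - t'"] assms by simp
  next
    case False
    then have eq: "interp e x t - interp e x' t' = ((x - x') * (1 - t) + (t - t') * (1 - x')) / 2"
      by (simp add: interp_def field_simps)
    show ?thesis unfolding eq using *[of "1 - t" "1 - x'" "x - x'" "t - t'"] assms by simp
  qed
qed

section \<open>Prisms over the small cubes\<close>

definition corners :: "nat \<Rightarrow> (nat \<Rightarrow> real) set" where
  "corners n = {1..n} \<rightarrow>\<^sub>E {0, 1}"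

lemma finite_corners: "finite (corners n)"
  by (simp add: corners_def finite_PiE)

text \<open>The coordinate \<open>Suc n\<close> is the deformation parameter; placing it last keeps
  the numbering of the other directions.\<close>

definition prism_map :: "nat \<Rightarrow> (nat \<Rightarrow> real) \<Rightarrow> (nat \<Rightarrow> real) \<Rightarrow> nat \<Rightarrow> real" where
  "prism_map n e y = (\<lambda>i\<in>{1..n}. interp (e i) (y i) (y (Suc n)))"

definition prism :: "nat \<Rightarrow> (nat \<Rightarrow> real) \<Rightarrow> ((nat \<Rightarrow> real) \<Rightarrow> 'a) \<Rightarrow> (nat \<Rightarrow> real) \<Rightarrow> 'a" where
  "prism n e \<sigma> = restrict (\<sigma> \<circ> prism_map n e) (unit_cube (Suc n))"

definition prism_face :: "nat \<Rightarrow> real \<Rightarrow> (nat \<Rightarrow> real) \<Rightarrow> ((nat \<Rightarrow> real) \<Rightarrow> 'a) \<Rightarrow> (nat \<Rightarrow> real) \<Rightarrow> 'a" where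
  "prism_face n t e \<sigma> = cube_face J_I (int (Suc n)) (Suc n) t (prism n e \<sigma>)"

definition cube_prisms :: "nat \<Rightarrow> ((nat \<Rightarrow> real) \<Rightarrow> 'a) \<Rightarrow> ((nat \<Rightarrow> real) \<Rightarrow> 'a) \<Rightarrow>\<^sub>0 int" where
  "cube_prisms n \<sigma> = (\<Sum>e\<in>corners n. frag_of (prism n e \<sigma>))"

text \<open>No signs occur: at parameter 0 each coordinate becomes \<open>x / 2\<close> or
  \<open>(1 + x) / 2\<close>, increasing in both cases, so all small cubes are oriented like
  \<open>\<sigma>\<close>.\<close>

definition cube_subdivision :: "nat \<Rightarrow> ((nat \<Rightarrow> real) \<Rightarrow> 'a) \<Rightarrow> ((nat \<Rightarrow> real) \<Rightarrow> 'a) \<Rightarrow>\<^sub>0 int" where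
  "cube_subdivision n \<sigma> = (\<Sum>e\<in>corners n. frag_of (prism_face n 0 e \<sigma>))"

lemma ccontinuous_prism_map: "ccontinuous (cpower J_I (Suc n)) (cpower J_I n) (prism_map n e)"
proof (rule ccontinuous_into_cpower[OF closure_space_cpower[OF J_I.J] J_I.J])
  fix i assume i: "i \<in> {1..n}"
  let ?f = "\<lambda>y. interp (e i) (y i) (y (Suc n))"
  have I: "y i \<in> {0..1}" "y (Suc n) \<in> {0..1}" if "y \<in> unit_cube (Suc n)" for y
    using PiE_mem[OF that, of i] PiE_mem[OF that, of "Suc n"] i by auto
  have "ccontinuous (cpower J_I (Suc n)) J_I ?f"
  proof (rule ccontinuousI_nhood[OF closure_space_cpower[OF J_I.J] J_I.J], unfold points_cube_I)
    show "?f y \<in> points J_I" if "y \<in> unit_cube (Suc n)" for y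
      unfolding points_J_I using interp_in[OF I[OF that]] .
    fix x V assume x: "x \<in> unit_cube (Suc n)" and "nhood J_I (?f x) V"
    then obtain r where r: "r > 0" "\<And>s. s \<in> {0..1} \<Longrightarrow> \<bar>s - ?f x\<bar> < r \<Longrightarrow> s \<in> V"
      unfolding nhood_J_I_iff by blast
    \<comment> \<open>By \<open>interp_lipschitz\<close> the value moves by at most the sum of the
      changes of its two coordinates, hence \<open>r / 2\<close> for each.\<close>
    have "?f y \<in> V" if y: "y \<in> unit_cube (Suc n)" "\<forall>k\<in>{1..Suc n}. \<bar>y k - x k\<bar> < r / 2" for y
    proof (rule r(2)[OF interp_in[OF I[OF y(1)]]])
      have "\<bar>y i - x i\<bar> < r / 2" "\<bar>y (Suc n) - x (Suc n)\<bar> < r / 2" using y(2) i by auto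
      then show "\<bar>?f y - ?f x\<bar> < r"
        using interp_lipschitz[OF I[OF y(1)] I[OF x], of "e i"] by linarith
    qed
    then have "\<exists>\<delta>>0. \<forall>y\<in>unit_cube (Suc n). (\<forall>k\<in>{1..Suc n}. \<bar>y k - x k\<bar> < \<delta>) \<longrightarrow>
        y \<in> {y \<in> unit_cube (Suc n). ?f y \<in> V}"
      using r(1) by (intro exI[of _ "r / 2"]) simp
    then show "nhood (cpower J_I (Suc n)) x {y \<in> unit_cube (Suc n). ?f y \<in> V}"
      unfolding nhood_cube_I_iff using x by (intro conjI) auto
  qed
  then show "ccontinuous (cpower J_I (Suc n)) J_I (\<lambda>y. prism_map n e y i)"
    using i by (simp add: prism_map_def)
qed (simp add: prism_map_def)

lemma prism_map_in: "y \<in> unit_cube (Suc n) \<Longrightarrow> prism_map n e y \<in> unit_cube n"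
  using ccontinuous_in_points[OF ccontinuous_prism_map] by (simp only: points_cube_I)

lemma prism_in_cubes:
  assumes "\<sigma> \<in> singular_cubes J_I Y (int n)"
  shows "prism n e \<sigma> \<in> singular_cubes J_I Y (int (Suc n))"
proof -
  have "ccontinuous (cpower J_I n) Y \<sigma>" using assms by (simp add: singular_cubes_def)
  then have "ccontinuous (cpower J_I (Suc n)) Y (\<sigma> \<circ> prism_map n e)"
    by (rule ccontinuous_compose[OF ccontinuous_prism_map])
  from ccontinuous_restrict[OF closure_space_cpower[OF J_I.J] this]
  show ?thesis by (simp add: singular_cubes_def prism_def points_cube_I del: of_nat_Suc)
qed

lemma prism_face_in_cubes:
  assumes "\<sigma> \<in> singular_cubes J_I Y (int n)" "t \<in> {0..1}"
  shows "prism_face n t e \<sigma> \<in> singular_cubes J_I Y (int n)"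
  unfolding prism_face_def
  using J_I.cube_face_in_cubes[OF prism_in_cubes[OF assms(1)], of "Suc n" t] assms(2)
  by (simp add: points_J_I)

lemma insert_coord_in_unit_cube:
  assumes "i \<in> {1..Suc n}" "t \<in> {0..1}" "x \<in> unit_cube n"
  shows "insert_coord i t x \<in> unit_cube (Suc n)"
  using ccontinuous_in_points[OF J_I.ccontinuous_insert_coord[of i n t]] assms
  by (simp add: points_cube_I points_J_I)

lemma cube_face_unit_cube:
  "cube_face J_I (int (Suc n)) i t \<sigma> = restrict (\<sigma> \<circ> insert_coord i t) (unit_cube n)"
  by (simp add: cube_face_def points_cube_I del: of_nat_Suc)

lemma prism_face_apply:
  assumes "x \<in> unit_cube n" "t \<in> {0..1}"
  shows "prism_face n t e \<sigma> x = \<sigma> (\<lambda>i\<in>{1..n}. interp (e i) (x i) t)"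
proof -
  have "prism_map n e (insert_coord (Suc n) t x) = (\<lambda>i\<in>{1..n}. interp (e i) (x i) t)"
    unfolding prism_map_def by (rule restrict_ext) (simp add: insert_coord_def)
  then show ?thesis
    using assms insert_coord_in_unit_cube[of "Suc n" n t x]
    by (simp add: prism_face_def cube_face_unit_cube prism_def del: of_nat_Suc)
qed

text \<open>Each coordinate is deformed on its own. The parameter is \<open>x (Suc m)\<close>, and
  the insertion moves it to position \<open>Suc (Suc m)\<close>.\<close>

lemma prism_map_insert_coord:
  assumes "i \<in> {1..Suc m}"
  shows "prism_map (Suc m) (insert_coord i v e) (insert_coord i s x) =
    insert_coord i (interp v s (x (Suc m))) (prism_map m e x)"
proof
  fix k
  consider "k < i" | "k = i" | "i < k" "k \<le> Suc m" | "k > Suc m" using assms by force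
  then show "prism_map (Suc m) (insert_coord i v e) (insert_coord i s x) k =
    insert_coord i (interp v s (x (Suc m))) (prism_map m e x) k"
    using assms by cases (auto simp: prism_map_def insert_coord_def)
qed

text \<open>Corners are paired along direction \<open>i\<close>; the inverse of the insertion
  deletes that coordinate.\<close>

lemma sum_corners_Suc:
  fixes f :: "(nat \<Rightarrow> real) \<Rightarrow> 'b::comm_monoid_add"
  assumes i: "i \<in> {1..Suc m}"
  shows "(\<Sum>e\<in>corners (Suc m). f e) = (\<Sum>e\<in>corners m. f (insert_coord i 0 e) + f (insert_coord i 1 e))"
proof -
  let ?del = "\<lambda>e k. if k < i then e k else e (Suc k)"
  have "(\<Sum>e\<in>corners (Suc m). f e) = (\<Sum>(v, e)\<in>{0, 1} \<times> corners m. f (insert_coord i v e))"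
  proof (rule sum.reindex_bij_witness[of _ "\<lambda>(v, e). insert_coord i v e" "\<lambda>e. (e i, ?del e)"])
    fix e assume e: "e \<in> corners (Suc m)"
    show eq: "(case (e i, ?del e) of (v, e) \<Rightarrow> insert_coord i v e) = e"
      by (auto simp: insert_coord_def fun_eq_iff)
    then show "(case (e i, ?del e) of (v, e) \<Rightarrow> f (insert_coord i v e)) = f e" by simp
    have "?del e k \<in> {0, 1}" if "k \<in> {1..m}" for k
      using PiE_mem[OF e[unfolded corners_def], of k] PiE_mem[OF e[unfolded corners_def], of "Suc k"] that by auto
    moreover have "?del e k = undefined" if "k \<notin> {1..m}" for k
      using PiE_arb[OF e[unfolded corners_def], of k] PiE_arb[OF e[unfolded corners_def], of "Suc k"] that i by auto
    ultimately have "?del e \<in> corners m" unfolding corners_def by (rule PiE_I)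
    moreover have "e i \<in> {0, 1}" using PiE_mem[OF e[unfolded corners_def] i] .
    ultimately show "(e i, ?del e) \<in> {0, 1} \<times> corners m" by blast
  next
    fix p :: "real \<times> (nat \<Rightarrow> real)" assume "p \<in> {0, 1} \<times> corners m"
    then obtain v e where p: "p = (v, e)" "v \<in> {0, 1}" "e \<in> corners m" by blast
    show "((case p of (v, e) \<Rightarrow> insert_coord i v e) i, ?del (case p of (v, e) \<Rightarrow> insert_coord i v e)) = p"
      by (auto simp: p(1) insert_coord_def fun_eq_iff)
    have "insert_coord i v e k \<in> {0, 1}" if k: "k \<in> {1..Suc m}" for k
    proof -
      have "k \<in> {1..m}" if "k < i" using that k i by auto
      moreover have "k - 1 \<in> {1..m}" if "i < k" using that k i by auto
      ultimately show ?thesis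
        using PiE_mem[OF p(3)[unfolded corners_def], of k] PiE_mem[OF p(3)[unfolded corners_def], of "k - 1"] p(2)
        unfolding insert_coord_def by (cases k i rule: linorder_cases) simp_all
    qed
    moreover have "insert_coord i v e k = undefined" if k: "k \<notin> {1..Suc m}" for k
    proof -
      have "k \<notin> {1..m}" "k \<noteq> i" using k i by auto
      moreover have "k - 1 \<notin> {1..m}" if "i < k" using that k i by auto
      ultimately show ?thesis
        using PiE_arb[OF p(3)[unfolded corners_def], of k] PiE_arb[OF p(3)[unfolded corners_def], of "k - 1"]
        unfolding insert_coord_def by (cases k i rule: linorder_cases) simp_all
    qed
    ultimately have "insert_coord i v e \<in> corners (Suc m)" unfolding corners_def by (rule PiE_I)
    then show "(case p of (v, e) \<Rightarrow> insert_coord i v e) \<in> corners (Suc m)" by (simp add: p(1))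
  qed
  also have "\<dots> = (\<Sum>v\<in>{0, 1}. \<Sum>e\<in>corners m. f (insert_coord i v e))"
    by (rule sum.cartesian_product[symmetric])
  also have "\<dots> = (\<Sum>e\<in>corners m. f (insert_coord i 0 e) + f (insert_coord i 1 e))"
    by (simp add: sum.distrib)
  finally show ?thesis .
qed

lemma cube_face_prism:
  assumes i: "i \<in> {1..Suc m}" and s: "s \<in> {0, 1}"
  shows "cube_face J_I (int (Suc (Suc m))) i s (prism (Suc m) (insert_coord i v e) \<sigma>) =
    (\<lambda>x\<in>unit_cube (Suc m). \<sigma> (insert_coord i (interp v s (x (Suc m))) (prism_map m e x)))"
proof -
  have "insert_coord i s x \<in> unit_cube (Suc (Suc m))" if "x \<in> unit_cube (Suc m)" for x
    by (rule insert_coord_in_unit_cube) (use i s that in auto)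
  then show ?thesis
    unfolding cube_face_unit_cube prism_def
    by (intro restrict_ext) (simp add: prism_map_insert_coord[OF i])
qed

text \<open>Two corners that differ only in direction \<open>i\<close> give four faces in this
  direction. The two in the middle coincide by \<open>interp_middle\<close> and have opposite signs;
  the two outer ones are prisms over the faces of \<open>\<sigma>\<close>.\<close>

lemma sum_cube_faces_prism:
  assumes i: "i \<in> {1..Suc m}"
  shows "(\<Sum>e\<in>corners (Suc m). frag_of (cube_face J_I (int (Suc (Suc m))) i 0 (prism (Suc m) e \<sigma>))
      - frag_of (cube_face J_I (int (Suc (Suc m))) i 1 (prism (Suc m) e \<sigma>)))
    = cube_prisms m (cube_face J_I (int (Suc m)) i 0 \<sigma>) - cube_prisms m (cube_face J_I (int (Suc m)) i 1 \<sigma>)"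
proof -
  let ?F = "\<lambda>v s e. cube_face J_I (int (Suc (Suc m))) i s (prism (Suc m) (insert_coord i v e) \<sigma>)"
  have middle: "?F 1 0 e = ?F 0 1 e" for e
    unfolding cube_face_prism[OF i insertI1] cube_face_prism[OF i insertI2[OF singletonI]] interp_middle ..
  have outer: "?F s s e = prism m e (cube_face J_I (int (Suc m)) i s \<sigma>)" if s: "s \<in> {0, 1}" for s e
  proof -
    have "interp s s t = s" for t using s interp_outer by auto
    then show ?thesis
      unfolding cube_face_prism[OF i s] unfolding prism_def cube_face_unit_cube
      by (intro restrict_ext) (simp add: prism_map_in del: One_nat_def)
  qed
  show ?thesis
    unfolding sum_corners_Suc[OF i] cube_prisms_def sum_subtractf[symmetric]
    by (rule sum.cong) (simp_all only: middle outer insert_iff empty_iff simp_thms, simp)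
qed

lemma degenerate_cubes_I_iff:
  "\<sigma> \<in> degenerate_cubes J_I Y (int n) \<longleftrightarrow> \<sigma> \<in> singular_cubes J_I Y (int n) \<and>
     (\<exists>i\<in>{1..n}. \<forall>x\<in>unit_cube n. \<forall>y\<in>unit_cube n. (\<forall>k. k \<noteq> i \<longrightarrow> x k = y k) \<longrightarrow> \<sigma> x = \<sigma> y)"
  by (simp only: degenerate_cubes_def mem_Collect_eq nat_int points_cube_I)

text \<open>At parameter 1 the \<open>i\<close>-th coordinate has become constantly 1, so the face
  ignores the \<open>i\<close>-th variable.\<close>

lemma degenerate_prism_face:
  assumes \<sigma>: "\<sigma> \<in> singular_cubes J_I Y (int n)" and e: "i \<in> {1..n}" "e i \<noteq> 0"
  shows "prism_face n 1 e \<sigma> \<in> degenerate_cubes J_I Y (int n)"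
proof -
  have "prism_face n 1 e \<sigma> x = prism_face n 1 e \<sigma> y"
    if "x \<in> unit_cube n" "y \<in> unit_cube n" and xy: "\<forall>k. k \<noteq> i \<longrightarrow> x k = y k" for x y
  proof -
    have "(\<lambda>k\<in>{1..n}. interp (e k) (x k) 1) = (\<lambda>k\<in>{1..n}. interp (e k) (y k) 1)"
      by (rule restrict_ext) (use e xy in \<open>auto simp: interp_1\<close>)
    then show ?thesis using that prism_face_apply[of _ n 1 e \<sigma>] by simp
  qed
  then have "\<forall>x\<in>unit_cube n. \<forall>y\<in>unit_cube n. (\<forall>k. k \<noteq> i \<longrightarrow> x k = y k) \<longrightarrow>
      prism_face n 1 e \<sigma> x = prism_face n 1 e \<sigma> y" by (intro ballI impI)
  moreover have "prism_face n 1 e \<sigma> \<in> singular_cubes J_I Y (int n)"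
    by (rule prism_face_in_cubes[OF \<sigma>]) simp
  ultimately show ?thesis
    unfolding degenerate_cubes_I_iff by (intro conjI bexI[OF _ e(1)])
qed

text \<open>A prism deforms each coordinate separately, so independence of a coordinate is
  inherited.\<close>

lemma degenerate_prism:
  assumes \<sigma>: "\<sigma> \<in> degenerate_cubes J_I Y (int n)"
  shows "prism n e \<sigma> \<in> degenerate_cubes J_I Y (int (Suc n))"
proof -
  obtain i where i: "i \<in> {1..n}" and S: "\<sigma> \<in> singular_cubes J_I Y (int n)"
    and eq: "\<forall>x\<in>unit_cube n. \<forall>y\<in>unit_cube n. (\<forall>k. k \<noteq> i \<longrightarrow> x k = y k) \<longrightarrow> \<sigma> x = \<sigma> y"
    using \<sigma> unfolding degenerate_cubes_I_iff by (elim conjE bexE)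
  have eq': "prism n e \<sigma> x = prism n e \<sigma> y"
    if x: "x \<in> unit_cube (Suc n)" "y \<in> unit_cube (Suc n)" and xy: "\<forall>k. k \<noteq> i \<longrightarrow> x k = y k" for x y
  proof -
    have "\<forall>k. k \<noteq> i \<longrightarrow> prism_map n e x k = prism_map n e y k"
      using xy i by (auto simp: prism_map_def)
    then have "\<sigma> (prism_map n e x) = \<sigma> (prism_map n e y)"
      by (rule mp[OF bspec[OF bspec[OF eq prism_map_in[OF x(1)]] prism_map_in[OF x(2)]]])
    then show ?thesis using x by (simp add: prism_def)
  qed
  have "\<forall>x\<in>unit_cube (Suc n). \<forall>y\<in>unit_cube (Suc n). (\<forall>k. k \<noteq> i \<longrightarrow> x k = y k) \<longrightarrow>
      prism n e \<sigma> x = prism n e \<sigma> y"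
    by (intro ballI impI) (rule eq')
  moreover have i': "i \<in> {1..Suc n}" using i by auto
  ultimately show ?thesis
    unfolding degenerate_cubes_I_iff
    by (intro conjI bexI[OF _ i'] prism_in_cubes[OF S])
qed

text \<open>The first \<open>n\<close> directions give the prisms over the boundary. In the last
  direction the faces at 0 form the subdivision; those at 1 are \<open>\<sigma>\<close> itself, for
  the corner with all coordinates 0, and degenerate cubes, collected in \<open>d\<close>.\<close>

lemma cube_bdry_prisms:
  fixes \<sigma> :: "(nat \<Rightarrow> real) \<Rightarrow> 'a"
  assumes \<sigma>: "\<sigma> \<in> singular_cubes J_I Y (int n)"
  obtains d where "d \<in> free_chains (degenerate_cubes J_I Y (int n))"
    "frag_extend (cube_bdry J_I (int (Suc n))) (cube_prisms n \<sigma>) =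
      frag_extend (cube_prisms (n - 1)) (cube_bdry J_I (int n) \<sigma>)
      + frag_cmul ((-1) ^ Suc n) (cube_subdivision n \<sigma> - frag_of \<sigma> - d)"
proof -
  let ?z = "\<lambda>i\<in>{1..n}. 0 :: real"
  define d where "d = (\<Sum>e\<in>corners n - {?z}. frag_of (prism_face n 1 e \<sigma>))"
  let ?D = "\<lambda>i e. frag_of (cube_face J_I (int (Suc n)) i 0 (prism n e \<sigma>))
      - frag_of (cube_face J_I (int (Suc n)) i 1 (prism n e \<sigma>))"
  have "prism_face n 1 e \<sigma> \<in> degenerate_cubes J_I Y (int n)" if e: "e \<in> corners n - {?z}" for e
  proof -
    have "\<exists>i\<in>{1..n}. e i \<noteq> 0"
    proof (rule ccontr)
      assume "\<not> ?thesis"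
      then have "e = ?z"
        using e by (intro extensionalityI[of _ "{1..n}"]) (auto simp: corners_def PiE_iff)
      then show False using e by blast
    qed
    then show ?thesis using degenerate_prism_face[OF \<sigma>] by blast
  qed
  then have d: "d \<in> free_chains (degenerate_cubes J_I Y (int n))"
    unfolding d_def using keys_sum[of "\<lambda>e. frag_of (prism_face n 1 e \<sigma>)" "corners n - {?z}"] by fastforce
  have "prism_face n 1 ?z \<sigma> = \<sigma>"
  proof (rule extensionalityI[of _ "unit_cube n"])
    show "prism_face n 1 ?z \<sigma> \<in> extensional (unit_cube n)" "\<sigma> \<in> extensional (unit_cube n)"
      using prism_face_in_cubes[OF \<sigma>, of 1 ?z] \<sigma> by (simp_all add: singular_cubes_def points_cube_I)
    fix x assume x: "x \<in> unit_cube n"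
    then have "(\<lambda>i\<in>{1..n}. interp (?z i) (x i) 1) = x"
      by (intro extensionalityI[of _ "{1..n}"]) (auto simp: interp_1 PiE_iff)
    then show "prism_face n 1 ?z \<sigma> x = \<sigma> x" using prism_face_apply[OF x, of 1 ?z \<sigma>] by simp
  qed
  moreover have "?z \<in> corners n" by (auto simp: corners_def)
  ultimately have "(\<Sum>e\<in>corners n. frag_of (prism_face n 1 e \<sigma>)) = frag_of \<sigma> + d"
    unfolding d_def using sum.remove[OF finite_corners, of ?z n "\<lambda>e. frag_of (prism_face n 1 e \<sigma>)"]
    by (simp only:)
  then have last: "(\<Sum>e\<in>corners n. ?D (Suc n) e) = cube_subdivision n \<sigma> - frag_of \<sigma> - d"
    by (simp add: sum_subtractf prism_face_def[symmetric] cube_subdivision_def del: of_nat_Suc)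
  have others: "(\<Sum>i\<in>{1..n}. frag_cmul ((-1) ^ i) (\<Sum>e\<in>corners n. ?D i e)) =
      frag_extend (cube_prisms (n - 1)) (cube_bdry J_I (int n) \<sigma>)"
  proof (cases n)
    case (Suc m)
    have "(\<Sum>e\<in>corners n. ?D i e) = cube_prisms m (cube_face J_I (int n) i 0 \<sigma>) - cube_prisms m (cube_face J_I (int n) i 1 \<sigma>)"
      if "i \<in> {1..n}" for i
      using sum_cube_faces_prism[of i m \<sigma>] that unfolding Suc .
    then show ?thesis
      by (simp add: cube_bdry_def frag_extend_sum frag_extend_cmul frag_extend_diff Suc del: of_nat_Suc sum.cl_ivl_Suc)
  \<comment> \<open>For \<open>n = 0\<close> there are no such directions and both sides vanish,
    whatever the truncated \<open>n - 1\<close> is.\<close>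
  qed (simp add: cube_bdry_def)
  have "frag_extend (cube_bdry J_I (int (Suc n))) (cube_prisms n \<sigma>) =
      (\<Sum>e\<in>corners n. \<Sum>i\<in>{1..Suc n}. frag_cmul ((-1) ^ i) (?D i e))"
    by (simp add: cube_prisms_def frag_extend_sum finite_corners cube_bdry_def o_def del: of_nat_Suc sum.cl_ivl_Suc)
  also have "\<dots> = (\<Sum>i\<in>{1..Suc n}. frag_cmul ((-1) ^ i) (\<Sum>e\<in>corners n. ?D i e))"
    unfolding frag_cmul_sum by (rule sum.swap)
  also have "\<dots> = frag_extend (cube_prisms (n - 1)) (cube_bdry J_I (int n) \<sigma>)
      + frag_cmul ((-1) ^ Suc n) (cube_subdivision n \<sigma> - frag_of \<sigma> - d)"
    unfolding others[symmetric] last[symmetric] by (simp del: of_nat_Suc)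
  finally show thesis using that d by blast
qed


text \<open>Each cube of the iterated subdivision is \<open>\<sigma>\<close> composed with a map
  \<open>g\<close> of the model. Size is measured on \<open>g\<close>, as the target has no metric,
  and every subdivision halves all coordinate differences.\<close>

lemma iterated_cube_subdivision:
  assumes \<sigma>: "\<sigma> \<in> singular_cubes J_I Y (int n)"
    and \<tau>: "\<tau> \<in> Poly_Mapping.keys ((frag_extend (cube_subdivision n) ^^ m) (frag_of \<sigma>))"
  obtains g where "\<tau> \<in> singular_cubes J_I Y (int n)"
    and "\<And>x. x \<in> unit_cube n \<Longrightarrow> g x \<in> unit_cube n \<and> \<tau> x = \<sigma> (g x)"
    and "\<And>x y i. \<lbrakk>x \<in> unit_cube n; y \<in> unit_cube n; i \<in> {1..n}\<rbrakk> \<Longrightarrow>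
      \<bar>g x i - g y i\<bar> \<le> \<bar>x i - y i\<bar> / 2 ^ m"
  using \<tau>
proof (induction m arbitrary: \<tau> thesis)
  case 0
  then have "\<tau> = \<sigma>" by simp
  then show ?case using 0(1)[of "\<lambda>x. x"] \<sigma> by simp
next
  case (Suc m)
  have "\<tau> \<in> Poly_Mapping.keys (frag_extend (cube_subdivision n)
      ((frag_extend (cube_subdivision n) ^^ m) (frag_of \<sigma>)))"
    using Suc.prems(2) by (simp only: funpow.simps o_apply)
  from subsetD[OF keys_frag_extend this] obtain \<tau>' where \<tau>': "\<tau>' \<in> Poly_Mapping.keys ((frag_extend (cube_subdivision n) ^^ m) (frag_of \<sigma>))"
    "\<tau> \<in> Poly_Mapping.keys (cube_subdivision n \<tau>')"
    by (rule UN_E)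
  obtain g where g: "\<tau>' \<in> singular_cubes J_I Y (int n)"
    "\<And>x. x \<in> unit_cube n \<Longrightarrow> g x \<in> unit_cube n \<and> \<tau>' x = \<sigma> (g x)"
    "\<And>x y i. \<lbrakk>x \<in> unit_cube n; y \<in> unit_cube n; i \<in> {1..n}\<rbrakk> \<Longrightarrow> \<bar>g x i - g y i\<bar> \<le> \<bar>x i - y i\<bar> / 2 ^ m"
    using \<tau>'(1) by (rule Suc.IH[rotated]) (rule that)
  obtain e where e: "e \<in> corners n" "\<tau> = prism_face n 0 e \<tau>'"
    using subsetD[OF keys_sum \<tau>'(2)[unfolded cube_subdivision_def]] by auto
  \<comment> \<open>The contraction of the cube toward its corner \<open>e\<close> by the factor
    1/2.\<close>
  define half where "half x = (\<lambda>i\<in>{1..n}. interp (e i) (x i) 0)" for x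
  have half: "half x \<in> unit_cube n" if x: "x \<in> unit_cube n" for x
  proof (rule PiE_I)
    show "half x i \<in> {0..1}" if i: "i \<in> {1..n}" for i
      using interp_in[OF PiE_mem[OF x i], of 0 "e i"] i by (simp add: half_def)
  qed (auto simp: half_def)
  show ?case
  proof (rule Suc.prems(1)[of "g \<circ> half"])
    show "\<tau> \<in> singular_cubes J_I Y (int n)"
      unfolding e(2) by (rule prism_face_in_cubes[OF g(1)]) simp
    show "(g \<circ> half) x \<in> unit_cube n \<and> \<tau> x = \<sigma> ((g \<circ> half) x)" if x: "x \<in> unit_cube n" for x
      using g(2)[OF half[OF x]] prism_face_apply[OF x, of 0 e \<tau>'] unfolding e(2) o_apply half_def by simp
    show "\<bar>(g \<circ> half) x i - (g \<circ> half) y i\<bar> \<le> \<bar>x i - y i\<bar> / 2 ^ Suc m"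
      if x: "x \<in> unit_cube n" and y: "y \<in> unit_cube n" and i: "i \<in> {1..n}" for x y i
    proof -
      have eq: "half x i - half y i = (x i - y i) / 2"
        using i by (simp add: half_def interp_def field_simps)
      have "\<bar>half x i - half y i\<bar> / 2 ^ m = \<bar>x i - y i\<bar> / 2 ^ Suc m" unfolding eq by simp
      then show ?thesis using g(3)[OF half[OF x] half[OF y] i] by simp
    qed
  qed
qed

theorem mayer_vietoris_cube_I:
  assumes X: "closure_space X" and cover: "interior_cover X {A, B}"
  shows "mayer_vietoris (cubical_cplx J_I) (cubical_incl J_I) X A B"
proof -
  have AB: "A \<subseteq> points X" "B \<subseteq> points X" using cover by (auto simp: interior_cover_def)
  let ?S = "singular_cubes J_I" and ?T = "degenerate_cubes J_I"
  have S_nat: "\<exists>k. n = int k" if "\<sigma> \<in> ?S Y n" for \<sigma> :: "(nat \<Rightarrow> real) \<Rightarrow> 'a" and Y n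
  proof -
    have "0 \<le> n" using that by (simp add: singular_cubes_def split: if_splits)
    then show ?thesis by (intro exI[of _ "nat n"]) simp
  qed
  \<comment> \<open>In \<open>cube_bdry_prisms\<close> the last direction carries the sign
    \<open>(-1) ^ Suc n\<close>. Multiplying by it frees the subdivision of its sign, and as the
    sign alternates with the degree, the prisms over the boundary cancel in the homotopy
    formula.\<close>
  let ?h = "\<lambda>n \<sigma>. frag_cmul ((-1) ^ Suc (nat n)) (cube_prisms (nat n) \<sigma>)"
  have h: "frag_extend (?h n) c = frag_cmul ((-1) ^ Suc (nat n)) (frag_extend (cube_prisms (nat n)) c)" for n c
    by (simp only: frag_extend_def frag_cmul_sum frag_cmul_cmul mult.commute)
  show ?thesis
  proof (rule J_I.mayer_vietoris_subdivision[OF X AB, where sd = "\<lambda>n. cube_subdivision (nat n)" and h = ?h])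
    fix n \<sigma> assume "\<sigma> \<in> ?S X n"
    then obtain k where n: "n = int k" and \<sigma>: "\<sigma> \<in> ?S X (int k)" using S_nat by blast
    have "prism_face k 0 e \<sigma> \<in> ?S X (int k)" for e by (rule prism_face_in_cubes[OF \<sigma>]) simp
    then show "cube_subdivision (nat n) \<sigma> \<in> free_chains (?S X n)"
      unfolding n nat_int cube_subdivision_def
      using keys_sum[of "\<lambda>e. frag_of (prism_face k 0 e \<sigma>)" "corners k"] by auto
    obtain d where d: "d \<in> free_chains (?T X (int k))"
      "J_I.bd (int (Suc k)) (cube_prisms k \<sigma>) =
        frag_extend (cube_prisms (k - 1)) (cube_bdry J_I (int k) \<sigma>)
        + frag_cmul ((-1) ^ Suc k) (cube_subdivision k \<sigma> - frag_of \<sigma> - d)"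
      using \<sigma> by (rule cube_bdry_prisms)
    let ?P = "frag_extend (cube_prisms (k - 1)) (cube_bdry J_I (int k) \<sigma>)"
    have 1: "frag_extend (?h (n - 1)) (cube_bdry J_I n \<sigma>) = frag_cmul ((-1) ^ k) ?P"
    proof (cases k)
      case (Suc l)
      then have "nat (n - 1) = l" using n by simp
      then show ?thesis unfolding h using n Suc by simp
    qed (use n in \<open>simp add: cube_bdry_def\<close>)
    have n1: "n + 1 = int (Suc k)" using n by simp
    have "J_I.bd (n + 1) (?h n \<sigma>) = frag_cmul ((-1) ^ Suc k) (J_I.bd (int (Suc k)) (cube_prisms k \<sigma>))"
      unfolding n1 frag_extend_cmul by (simp only: n nat_int)
    also have "\<dots> = frag_cmul ((-1) ^ Suc k) ?P + (cube_subdivision k \<sigma> - frag_of \<sigma> - d)"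
      unfolding d(2) frag_cmul_distrib2 by (simp flip: power_mult_distrib)
    finally have "J_I.bd (n + 1) (?h n \<sigma>) + frag_extend (?h (n - 1)) (cube_bdry J_I n \<sigma>)
        - (cube_subdivision (nat n) \<sigma> - frag_of \<sigma>)
      = (frag_cmul ((-1) ^ Suc k) ?P + frag_cmul ((-1) ^ k) ?P) - d"
      unfolding 1 using n by (simp add: algebra_simps)
    also have "frag_cmul ((-1) ^ Suc k) ?P + frag_cmul ((-1) ^ k) ?P = 0"
      unfolding frag_cmul_distrib[symmetric] by simp
    finally have "J_I.bd (n + 1) (?h n \<sigma>) + frag_extend (?h (n - 1)) (cube_bdry J_I n \<sigma>)
        - (cube_subdivision (nat n) \<sigma> - frag_of \<sigma>) = - d" by simp
    then show "J_I.bd (n + 1) (?h n \<sigma>) + frag_extend (?h (n - 1)) (cube_bdry J_I n \<sigma>)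
        - (cube_subdivision (nat n) \<sigma> - frag_of \<sigma>) \<in> free_chains (?T X n)"
      using add_subgroup_closed(3)[OF free_chains_subgroup d(1)] n by (simp only:)
    let ?V = "\<lambda>U. {y \<in> unit_cube k. \<sigma> y \<in> U}"
    have cont: "ccontinuous (cpower J_I k) X \<sigma>" using \<sigma> by (simp add: singular_cubes_def)
    have "\<exists>V\<in>{?V A, ?V B}. nhood (cpower J_I k) x V" if "x \<in> unit_cube k" for x
    proof -
      have x: "x \<in> points (cpower J_I k)" using that by (simp only: points_cube_I)
      have "nhood (cpower J_I k) x (?V U)" if "nhood X (\<sigma> x) U" for U
        using ccontinuous_nhood[of X "cpower J_I k" \<sigma> x U, OF X cont x that] unfolding points_cube_I .
      then show ?thesis using interior_cover_nhood[OF cover ccontinuous_in_points[OF cont x]] by blast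
    qed
    then obtain \<delta> where \<delta>: "\<delta> > 0"
      "\<forall>K. K \<subseteq> unit_cube k \<and> K \<noteq> {} \<and> (\<forall>x\<in>K. \<forall>y\<in>K. \<forall>i\<in>{1..k}. \<bar>x i - y i\<bar> \<le> \<delta>)
        \<longrightarrow> (\<exists>V\<in>{?V A, ?V B}. K \<subseteq> V)"
      by (rule cube_lebesgue)
    \<comment> \<open>The unit cube has side 1, so \<open>l\<close> halvings bring all coordinate
      differences below \<open>\<delta>\<close>.\<close>
    obtain l where l: "(1 / 2 :: real) ^ l < \<delta>" using real_arch_pow_inv[OF \<delta>(1), of "1 / 2"] by auto
    have "\<tau> \<in> ?S (csubspace X A) n \<union> ?S (csubspace X B) n"
      if m: "l \<le> m" and \<tau>: "\<tau> \<in> Poly_Mapping.keys ((frag_extend (cube_subdivision k) ^^ m) (frag_of \<sigma>))" for m \<tau>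
    proof -
      obtain g where \<tau>_S: "\<tau> \<in> ?S X (int k)"
        and g: "\<And>x. x \<in> unit_cube k \<Longrightarrow> g x \<in> unit_cube k \<and> \<tau> x = \<sigma> (g x)"
        and lip: "\<And>x y i. \<lbrakk>x \<in> unit_cube k; y \<in> unit_cube k; i \<in> {1..k}\<rbrakk> \<Longrightarrow> \<bar>g x i - g y i\<bar> \<le> \<bar>x i - y i\<bar> / 2 ^ m"
        using \<sigma> \<tau> by (rule iterated_cube_subdivision) (rule that)
      have "\<exists>V\<in>{?V A, ?V B}. g ` unit_cube k \<subseteq> V"
      proof (rule mp[OF spec[OF \<delta>(2)]], intro conjI ballI)
        show "g ` unit_cube k \<subseteq> unit_cube k" using g by blast
        show "g ` unit_cube k \<noteq> {}" by (simp add: PiE_eq_empty_iff)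
        fix u v i assume "u \<in> g ` unit_cube k" "v \<in> g ` unit_cube k" and i: "i \<in> {1..k}"
        then obtain x y where xy: "x \<in> unit_cube k" "y \<in> unit_cube k" "u = g x" "v = g y" by blast
        have "\<bar>x i - y i\<bar> \<le> 1" using PiE_mem[OF xy(1) i] PiE_mem[OF xy(2) i] by auto
        then have "\<bar>x i - y i\<bar> / 2 ^ m \<le> (1 / 2) ^ m" by (simp add: power_divide divide_right_mono)
        also have "\<dots> \<le> (1 / 2) ^ l" using m by (intro power_decreasing) auto
        finally show "\<bar>u i - v i\<bar> \<le> \<delta>" using lip[OF xy(1,2) i] l unfolding xy(3,4) by linarith
      qed
      then obtain U where U: "U \<in> {A, B}" "g ` unit_cube k \<subseteq> ?V U" by blast
      have "\<tau> ` unit_cube k \<subseteq> U"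
      proof (rule image_subsetI)
        fix x assume x: "x \<in> unit_cube k"
        then have "g x \<in> ?V U" using U(2) by blast
        then show "\<tau> x \<in> U" using g[OF x] by simp
      qed
      then have "\<tau> \<in> ?S (csubspace X U) n"
        using J_I.S_sub[OF X, of U n] \<tau>_S U(1) AB unfolding n nat_int points_cube_I by blast
      then show ?thesis using U(1) by blast
    qed
    then have "(frag_extend (cube_subdivision k) ^^ m) (frag_of \<sigma>) \<in> free_chains (J_I.small X A B n)" if "l \<le> m" for m
      unfolding J_I.small_def[OF X AB] using that by blast
    then show "\<exists>l. \<forall>m\<ge>l. (frag_extend (cube_subdivision (nat n)) ^^ m) (frag_of \<sigma>) \<in> free_chains (J_I.small X A B n)"
      unfolding n nat_int by blast
  next
    fix Y :: "'a cspace" and n \<sigma> assume "\<sigma> \<in> ?S Y n"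
    then obtain k where n: "n = int k" and \<sigma>: "\<sigma> \<in> ?S Y (int k)" using S_nat by blast
    have n1: "n + 1 = int (Suc k)" "nat n = k" using n by simp_all
    have "cube_prisms k \<sigma> \<in> free_chains (?S Y (int (Suc k)))"
      unfolding cube_prisms_def
      using keys_sum[of "\<lambda>e. frag_of (prism k e \<sigma>)" "corners k"] prism_in_cubes[OF \<sigma>] by auto
    then show "?h n \<sigma> \<in> free_chains (?S Y (n + 1))"
      unfolding n1 by (rule free_chains_cmul)
  next
    fix n \<sigma> assume "\<sigma> \<in> ?T X n"
    moreover from this obtain k where n: "n = int k" using S_nat J_I.T_S[OF X] by blast
    ultimately have \<sigma>: "\<sigma> \<in> ?T X (int k)" by simp
    have n1: "n + 1 = int (Suc k)" "nat n = k" using n by simp_all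
    have "cube_prisms k \<sigma> \<in> free_chains (?T X (int (Suc k)))"
      unfolding cube_prisms_def
      using keys_sum[of "\<lambda>e. frag_of (prism k e \<sigma>)" "corners k"] degenerate_prism[OF \<sigma>] by auto
    then show "?h n \<sigma> \<in> free_chains (?T X (n + 1))"
      unfolding n1 by (rule free_chains_cmul)
  qed
qed

theorem theorem1p4:
  fixes X :: "'a cspace" and A B :: "'a set"
  assumes "closure_space X"
    and "interior_cover X {A, B}"
  shows "mayer_vietoris (simplicial_cplx simplex_I simplical_face) simplicial_incl X A B \<and>
         mayer_vietoris (simplicial_cplx simplex_one vertex_face) simplicial_incl X A B \<and>
         mayer_vietoris (simplicial_cplx simplex_plus vertex_face) simplicial_incl X A B \<and>
         (\<forall>J \<in> {J_I, J_one, J_plus}. mayer_vietoris (cubical_cplx J) (cubical_incl J) X A B)"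
proof -
  have one: "\<exists>x\<in>points (simplex_one n). \<forall>V. nhood (simplex_one n) x V \<longrightarrow> points (simplex_one n) \<subseteq> V" for n
    using simplex_one_focal by (intro bexI[of _ 0]) (auto simp: simplex_one_def indiscrete_def)
  have plus: "\<exists>x\<in>points (simplex_plus n). \<forall>V. nhood (simplex_plus n) x V \<longrightarrow> points (simplex_plus n) \<subseteq> V" for n
    using simplex_plus_focal by (intro bexI[of _ n]) (auto simp: simplex_plus_def)
  show ?thesis
    using mayer_vietoris_simplex_I[OF assms] mayer_vietoris_cube_I[OF assms]
      simplex_one.mayer_vietoris_simplicial_focal[OF assms one]
      simplex_plus.mayer_vietoris_simplicial_focal[OF assms plus]
      J_one.mayer_vietoris_cubical_focal[OF assms J_one.J01(1) nhood_J_one]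
      J_plus.mayer_vietoris_cubical_focal[OF assms J_plus.J01(2) nhood_J_plus]
    by blast
qed


end
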